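(* Let $\mathbb K$ be an algebraically closed field of characteristic $3$. Let $\mathfrak f_4=\mathfrak g(A)$ be the Lie algebra with purely even Cartan matrix $A=\begin{pmatrix}2&-1&0&0\\-1&2&-2&0\\0&-1&2&-1\\0&0&-1&2\end{pmatrix}$, and let $\mathfrak g(1,6)=\mathfrak g(\widetilde A)$ be the Elduque and Cunha Lie superalgebra with Cartan matrix $\widetilde A=\begin{pmatrix}2&-1&0\\-1&2&-2\\0&-1&0\end{pmatrix}$ in which the first two indices are even and the third index is odd. Then the semisimplification of $\mathfrak f_4$, as an object in $\mathrm{Rep}\,\alpha_3$ under the adjoint action of $e_4$, is (isomorphic as a Lie superalgebra to) $\mathfrak g(1,6)$.
   Context: **Contragredient Lie superalgebras.** Lie superalgebras in characteristic $3$ are required to satisfy $[x,[x,x]]=0$ for odd $x$. Let $A=(a_{ij})$ be an $n\times n$ integer matrix (a Cartan matrix) with a parity $\mathrm{par}(i)\in\mathbb Z/2$ for each index; let $\overline A=(\overline a_{ij})$ be its reduction mod $3$, of rank $s$. Let $\widetilde{\mathfrak h}$ be a $\mathbb K$-vector space of dimension $2n-s$ with linearly independent $h_1,\dots,h_n\in\widetilde{\mathfrak h}$ and linearly independent $\alpha_1,\dots,\alpha_n\in\widetilde{\mathfrak h}^*$ such that $\alpha_j(h_i)=\overline a_{ij}$. $\widetilde{\mathfrak g}(A)$ is the Lie superalgebra generated by $\widetilde{\mathfrak h}$ (even) and $e_i,f_i$ ($1\le i\le n$) of parity $\mathrm{par}(i)$, with relations $[e_i,f_j]=\delta_{ij}h_i$,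 $[h,e_j]=\alpha_j(h)e_j$, $[h,f_j]=-\alpha_j(h)f_j$, $[\widetilde{\mathfrak h},\widetilde{\mathfrak h}]=0$. It is graded by the free abelian group $Q=\bigoplus_k\mathbb Z\alpha_k$ with $\deg e_i=\alpha_i$, $\deg f_i=-\alpha_i$, $\deg h=0$. $\mathfrak g(A)=\widetilde{\mathfrak g}(A)/\mathfrak r$, where $\mathfrak r$ is the largest $Q$-graded ideal meeting $\widetilde{\mathfrak h}$ trivially; images of $e_i,f_i,h_i$ keep their names. If all parities are $0$, $\mathfrak g(A)$ is a Lie algebra. **Semisimplification.** $\mathrm{Rep}\,\alpha_3$ (representations of the Frobenius kernel of $\mathbb G_a$) is the symmetric tensor category of finite-dimensional $\mathbb K[t]/(t^3)$-modules, with $t$ acting on $V\otimes W$ by $t\otimes1+1\otimes t$ and the flip as braiding. Its indecomposables are $J_1,J_2,J_3$, where $t$ acts on $J_n=\mathbb K^n$ as one nilpotent Jordan block. A Lie algebra $\mathfrak g$ with a derivation $d$, $d^3=0$, is a Lie algebra in $\mathrm{Rep}\,\alpha_3$ with $t$ acting by $d$; "under the adjoint action of $x$" means $d=\mathrm{ad}\,x$. The semisimplification functor $V\mapsto\overline V$ is the quotient of $\mathrm{Rep}\,\alpha_3$ by negligible morphisms ($u:V\to W$ with $\mathrm{tr}(u\circ v)=0$ for all $v:W\to V$), with target the Verlinde category $\mathrm{Ver}_3$, whose simple objects are $L_1=\overline{J_1}$, $L_2=\overline{J_2}$ ($\overline{J_3}=0$); $\mathrm{Ver}_3$ is identified with super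 vector spaces, $L_1$ being an even line and $L_2$ an odd line, so $\overline{\mathfrak g}$ is a Lie superalgebra. Explicitly, decompose $\mathfrak g$ into Jordan blocks $x_i$ ($i\le n_1$), $x_i\mapsto x_i'$ ($n_1<i\le n_1+n_2$), and blocks $x_i\mapsto x_i'\mapsto x_i''$ (arrows are the action of $d$). Then $\overline{\mathfrak g}$ has basis $y_i$ ($i\le n_1+n_2$), even for $i\le n_1$ and odd for $i>n_1$; the coefficient of $y_k$ in $[y_i,y_j]$ is the coefficient of $x_k$ in $[x_i,x_j]$ if the parities of $y_i,y_j,y_k$ are compatible and $y_i,y_j$ are not both odd; it is the coefficient of $x_k$ in $-[x_i,x_j']+[x_i',x_j]$ if $i,j>n_1$, $k\le n_1$; and $0$ otherwise. *)

theory Defs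
  imports
    "Jordan_Normal_Form.DL_Rank"
    "HOL-Algebra.QuotRing"
    "HOL-Library.Poly_Mapping"
    "HOL-Library.Z2"
begin

section \<open>Lie superalgebras\<close>

text \<open>
  A nonassociative superalgebra over a field \<open>'k\<close> (viewed as the ring \<^term>\<open>class_ring\<close>) is a
  module record whose multiplication \<open>\<otimes>\<close> is the bracket, together with its homogeneous parts
  indexed by \<open>\<int>/2\<close>. The record field \<^const>\<open>one\<close> plays no role and is always set to zero.
\<close>

record ('k, 'v) superalgebra = "('k, 'v) module" +
  part :: "bit \<Rightarrow> 'v set"

definition koszul :: "bit \<Rightarrow> bit \<Rightarrow> 'k::field" where
  "koszul i j = (if i = 1 \<and> j = 1 then - 1 else 1)"

text \<open>
  The axiom \<open>odd_cube\<close> follows from the Jacobi identity unless 3 is zero in the field, in which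
  case it is imposed. The field is tacitly assumed not to have characteristic 2.
\<close>

locale lie_superalgebra = vectorspace class_ring L
  for L :: "('k::field, 'v, 'm) superalgebra_scheme" (structure) +
  assumes part_subspace: "VectorSpace.subspace class_ring (part L i) L"
    and part_Int: "part L 0 \<inter> part L 1 = {\<zero>}"
    and part_sum: "carrier L = part L 0 <+>\<^bsub>L\<^esub> part L 1"
    and bracket_part: "\<lbrakk>x \<in> part L i; y \<in> part L j\<rbrakk> \<Longrightarrow> x \<otimes> y \<in> part L (i + j)"
    and bracket_add_left: "\<lbrakk>x \<in> carrier L; y \<in> carrier L; z \<in> carrier L\<rbrakk>
          \<Longrightarrow> (x \<oplus> y) \<otimes> z = x \<otimes> z \<oplus> y \<otimes> z"
    and bracket_add_right: "\<lbrakk>x \<in> carrier L; y \<in> carrier L; z \<in> carrier L\<rbrakk>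
          \<Longrightarrow> x \<otimes> (y \<oplus> z) = x \<otimes> y \<oplus> x \<otimes> z"
    and bracket_smult_left: "\<lbrakk>x \<in> carrier L; y \<in> carrier L\<rbrakk> \<Longrightarrow> (c \<odot>\<^bsub>L\<^esub> x) \<otimes> y = c \<odot>\<^bsub>L\<^esub> (x \<otimes> y)"
    and bracket_smult_right: "\<lbrakk>x \<in> carrier L; y \<in> carrier L\<rbrakk> \<Longrightarrow> x \<otimes> (c \<odot>\<^bsub>L\<^esub> y) = c \<odot>\<^bsub>L\<^esub> (x \<otimes> y)"
    and antisymmetry: "\<lbrakk>x \<in> part L i; y \<in> part L j\<rbrakk>
          \<Longrightarrow> x \<otimes> y = \<ominus> (koszul i j \<odot>\<^bsub>L\<^esub> (y \<otimes> x))"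
    and jacobi: "\<lbrakk>x \<in> part L i; y \<in> part L j; z \<in> part L k\<rbrakk>
          \<Longrightarrow> x \<otimes> (y \<otimes> z) = (x \<otimes> y) \<otimes> z \<oplus> koszul i j \<odot>\<^bsub>L\<^esub> (y \<otimes> (x \<otimes> z))"
    and odd_cube: "x \<in> part L 1 \<Longrightarrow> x \<otimes> (x \<otimes> x) = \<zero>"

definition isomorphic_lie_superalgebras ::
  "('k::field, 'v, 'm) superalgebra_scheme \<Rightarrow> ('k, 'w, 'n) superalgebra_scheme \<Rightarrow> bool" where
  "isomorphic_lie_superalgebras L M \<longleftrightarrow>
     lie_superalgebra L \<and> lie_superalgebra M \<and>
     (\<exists>\<phi>. linear_map class_ring L M \<phi> \<and> bij_betw \<phi> (carrier L) (carrier M) \<and>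
          (\<forall>x\<in>carrier L. \<forall>y\<in>carrier L. \<phi> (x \<otimes>\<^bsub>L\<^esub> y) = \<phi> x \<otimes>\<^bsub>M\<^esub> \<phi> y) \<and>
          (\<forall>i. \<phi> ` part L i = part M i))"

definition alg_ideal :: "('k::field, 'v, 'm) superalgebra_scheme \<Rightarrow> 'v set \<Rightarrow> bool" where
  "alg_ideal A I \<longleftrightarrow>
     VectorSpace.subspace class_ring I A \<and>
     (\<forall>x\<in>carrier A. \<forall>y\<in>I. x \<otimes>\<^bsub>A\<^esub> y \<in> I \<and> y \<otimes>\<^bsub>A\<^esub> x \<in> I)"

definition quot_superalgebra ::
  "('k, 'v, 'm) superalgebra_scheme \<Rightarrow> 'v set \<Rightarrow> ('k, 'v set) superalgebra" where
  "quot_superalgebra A I =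
     \<lparr>carrier = a_rcosets\<^bsub>A\<^esub> I, mult = rcoset_mult A I, one = I, zero = I, add = set_add A,
      smult = (\<lambda>c X. \<Union>x\<in>X. I +>\<^bsub>A\<^esub> (c \<odot>\<^bsub>A\<^esub> x)),
      part = (\<lambda>p. (\<lambda>x. I +>\<^bsub>A\<^esub> x) ` part A p)\<rparr>"


section \<open>Free nonassociative superalgebras\<close>

datatype 'g magma = Gen 'g | Br "'g magma" "'g magma"

primrec weight :: "('g \<Rightarrow> 'd::comm_monoid_add) \<Rightarrow> 'g magma \<Rightarrow> 'd" where
  "weight f (Gen g) = f g"
| "weight f (Br u v) = weight f u + weight f v"

definition weight_space ::
  "'g set \<Rightarrow> ('g \<Rightarrow> 'd::comm_monoid_add) \<Rightarrow> 'd \<Rightarrow> ('g magma \<Rightarrow>\<^sub>0 'k::field) set" where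
  "weight_space X f d = {p. \<forall>w\<in>Poly_Mapping.keys p. set_magma w \<subseteq> X \<and> weight f w = d}"

definition free_superalgebra ::
  "'g set \<Rightarrow> ('g \<Rightarrow> bit) \<Rightarrow> ('k::field, 'g magma \<Rightarrow>\<^sub>0 'k) superalgebra" where
  "free_superalgebra X par =
     \<lparr>carrier = {p. \<forall>w\<in>Poly_Mapping.keys p. set_magma w \<subseteq> X},
      mult = (\<lambda>p q. \<Sum>u\<in>Poly_Mapping.keys p. \<Sum>v\<in>Poly_Mapping.keys q.
                Poly_Mapping.single (Br u v) (Poly_Mapping.lookup p u * Poly_Mapping.lookup q v)),
      one = 0, zero = 0, add = (+), smult = (\<lambda>c. Poly_Mapping.map ((*) c)),
      part = weight_space X par\<rparr>"

definition gen :: "'g \<Rightarrow> 'g magma \<Rightarrow>\<^sub>0 'k::field" where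
  "gen g = Poly_Mapping.single (Gen g) 1"

text \<open>The elements that must vanish for a nonassociative superalgebra to be a Lie superalgebra.\<close>

definition lie_relations :: "('k::field, 'v, 'm) superalgebra_scheme \<Rightarrow> 'v set" where
  "lie_relations A =
     {x \<otimes>\<^bsub>A\<^esub> y \<oplus>\<^bsub>A\<^esub> koszul i j \<odot>\<^bsub>A\<^esub> (y \<otimes>\<^bsub>A\<^esub> x) | i j x y. x \<in> part A i \<and> y \<in> part A j} \<union>
     {x \<otimes>\<^bsub>A\<^esub> (y \<otimes>\<^bsub>A\<^esub> z) \<ominus>\<^bsub>A\<^esub> ((x \<otimes>\<^bsub>A\<^esub> y) \<otimes>\<^bsub>A\<^esub> z \<oplus>\<^bsub>A\<^esub> koszul i j \<odot>\<^bsub>A\<^esub> (y \<otimes>\<^bsub>A\<^esub> (x \<otimes>\<^bsub>A\<^esub> z)))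
        | i j k x y z. x \<in> part A i \<and> y \<in> part A j \<and> z \<in> part A k} \<union>
     {x \<otimes>\<^bsub>A\<^esub> (x \<otimes>\<^bsub>A\<^esub> x) | x. x \<in> part A 1}"


section \<open>Contragredient Lie superalgebras\<close>

text \<open>
  The vector space, the vectors \<open>h\<^sub>i\<close> (\<open>coroot\<close>) and the functionals \<open>\<alpha>\<^sub>i\<close> (\<open>root\<close>) attached to a
  Cartan matrix. All indices start from 0.
\<close>

record ('k, 'h) realization = "('k, 'h) module" +
  coroot :: "nat \<Rightarrow> 'h"
  root :: "nat \<Rightarrow> 'h \<Rightarrow> 'k"

definition realization_of :: "int mat \<Rightarrow> ('k::field, 'h) realization \<Rightarrow> bool" where
  "realization_of A R \<longleftrightarrow>
     (let n = dim_row A in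
      vectorspace class_ring R \<and>
      vectorspace.fin_dim class_ring R \<and>
      vectorspace.dim class_ring R = 2 * n - vec_space.rank n (map_mat of_int A :: 'k mat) \<and>
      (\<forall>i<n. coroot R i \<in> carrier R) \<and>
      (\<forall>c. (\<Oplus>\<^bsub>R\<^esub>i\<in>{..<n}. c i \<odot>\<^bsub>R\<^esub> coroot R i) = \<zero>\<^bsub>R\<^esub> \<longrightarrow> (\<forall>i<n. c i = 0)) \<and>
      (\<forall>j<n. \<forall>x\<in>carrier R. \<forall>y\<in>carrier R. \<forall>c.
          root R j (x \<oplus>\<^bsub>R\<^esub> y) = root R j x + root R j y \<and>
          root R j (c \<odot>\<^bsub>R\<^esub> x) = c * root R j x) \<and>
      (\<forall>c. (\<forall>x\<in>carrier R. (\<Sum>j<n. c j * root R j x) = 0) \<longrightarrow> (\<forall>j<n. c j = 0)) \<and>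
      (\<forall>i<n. \<forall>j<n. root R j (coroot R i) = of_int (A $$ (i, j))))"

datatype 'h chevalley = CartanGen 'h | EGen nat | FGen nat

primrec gen_parity :: "(nat \<Rightarrow> bit) \<Rightarrow> 'h chevalley \<Rightarrow> bit" where
  "gen_parity par (CartanGen h) = 0"
| "gen_parity par (EGen i) = par i"
| "gen_parity par (FGen i) = par i"

text \<open>
  The grading group is the free abelian group \<^typ>\<open>nat \<Rightarrow>\<^sub>0 int\<close>, in which the \<open>i\<close>-th
  simple root is \<^term>\<open>Poly_Mapping.single i 1\<close>.
\<close>

primrec gen_degree :: "'h chevalley \<Rightarrow> (nat \<Rightarrow>\<^sub>0 int)" where
  "gen_degree (CartanGen h) = 0"
| "gen_degree (EGen i) = Poly_Mapping.single i 1"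
| "gen_degree (FGen i) = Poly_Mapping.single i (- 1)"

definition generators :: "nat \<Rightarrow> ('k, 'h) realization \<Rightarrow> 'h chevalley set" where
  "generators n R = CartanGen ` carrier R \<union> EGen ` {..<n} \<union> FGen ` {..<n}"

definition free_contragredient ::
  "nat \<Rightarrow> (nat \<Rightarrow> bit) \<Rightarrow> ('k::field, 'h) realization \<Rightarrow>
     ('k, 'h chevalley magma \<Rightarrow>\<^sub>0 'k) superalgebra" where
  "free_contragredient n par R = free_superalgebra (generators n R) (gen_parity par)"

text \<open>The first set of relations makes \<open>h \<mapsto> gen (CartanGen h)\<close> linear.\<close>

definition chevalley_relations ::
  "nat \<Rightarrow> (nat \<Rightarrow> bit) \<Rightarrow> ('k::field, 'h) realization \<Rightarrow> ('h chevalley magma \<Rightarrow>\<^sub>0 'k) set" where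
  "chevalley_relations n par R =
     (let T = free_contragredient n par R;
          H = (\<lambda>h. gen (CartanGen h)); E = (\<lambda>i. gen (EGen i)); F = (\<lambda>i. gen (FGen i)) in
      {H (c \<odot>\<^bsub>R\<^esub> h \<oplus>\<^bsub>R\<^esub> h') \<ominus>\<^bsub>T\<^esub> (c \<odot>\<^bsub>T\<^esub> H h \<oplus>\<^bsub>T\<^esub> H h') | c h h'. h \<in> carrier R \<and> h' \<in> carrier R} \<union>
      {E i \<otimes>\<^bsub>T\<^esub> F j \<ominus>\<^bsub>T\<^esub> (if i = j then H (coroot R i) else \<zero>\<^bsub>T\<^esub>) | i j. i < n \<and> j < n} \<union>
      {H h \<otimes>\<^bsub>T\<^esub> E j \<ominus>\<^bsub>T\<^esub> root R j h \<odot>\<^bsub>T\<^esub> E j | h j. h \<in> carrier R \<and> j < n} \<union>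
      {H h \<otimes>\<^bsub>T\<^esub> F j \<oplus>\<^bsub>T\<^esub> root R j h \<odot>\<^bsub>T\<^esub> F j | h j. h \<in> carrier R \<and> j < n} \<union>
      {H h \<otimes>\<^bsub>T\<^esub> H h' | h h'. h \<in> carrier R \<and> h' \<in> carrier R})"

definition tilde_ideal ::
  "nat \<Rightarrow> (nat \<Rightarrow> bit) \<Rightarrow> ('k::field, 'h) realization \<Rightarrow> ('h chevalley magma \<Rightarrow>\<^sub>0 'k) set" where
  "tilde_ideal n par R =
     alg_ideal (free_contragredient n par R) hull
       (lie_relations (free_contragredient n par R) \<union> chevalley_relations n par R)"

definition tilde_coset ::
  "nat \<Rightarrow> (nat \<Rightarrow> bit) \<Rightarrow> ('k::field, 'h) realization \<Rightarrow>
     ('h chevalley magma \<Rightarrow>\<^sub>0 'k) \<Rightarrow> ('h chevalley magma \<Rightarrow>\<^sub>0 'k) set" where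
  "tilde_coset n par R x = tilde_ideal n par R +>\<^bsub>free_contragredient n par R\<^esub> x"

definition contragredient_tilde ::
  "nat \<Rightarrow> (nat \<Rightarrow> bit) \<Rightarrow> ('k::field, 'h) realization \<Rightarrow>
     ('k, ('h chevalley magma \<Rightarrow>\<^sub>0 'k) set) superalgebra" where
  "contragredient_tilde n par R =
     quot_superalgebra (free_contragredient n par R) (tilde_ideal n par R)"

definition tilde_root_space ::
  "nat \<Rightarrow> (nat \<Rightarrow> bit) \<Rightarrow> ('k::field, 'h) realization \<Rightarrow> (nat \<Rightarrow>\<^sub>0 int) \<Rightarrow>
     ('h chevalley magma \<Rightarrow>\<^sub>0 'k) set set" where
  "tilde_root_space n par R q = tilde_coset n par R ` weight_space (generators n R) gen_degree q"

definition tilde_cartan ::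
  "nat \<Rightarrow> (nat \<Rightarrow> bit) \<Rightarrow> ('k::field, 'h) realization \<Rightarrow> ('h chevalley magma \<Rightarrow>\<^sub>0 'k) set set" where
  "tilde_cartan n par R = (\<lambda>h. tilde_coset n par R (gen (CartanGen h))) ` carrier R"

definition graded_ideal ::
  "nat \<Rightarrow> (nat \<Rightarrow> bit) \<Rightarrow> ('k::field, 'h) realization \<Rightarrow>
     ('h chevalley magma \<Rightarrow>\<^sub>0 'k) set set \<Rightarrow> bool" where
  "graded_ideal n par R I \<longleftrightarrow>
     alg_ideal (contragredient_tilde n par R) I \<and>
     I \<subseteq> LinearCombinations.module.span class_ring (contragredient_tilde n par R)
           (\<Union>q. I \<inter> tilde_root_space n par R q)"

definition max_ideal ::
  "nat \<Rightarrow> (nat \<Rightarrow> bit) \<Rightarrow> ('k::field, 'h) realization \<Rightarrow> ('h chevalley magma \<Rightarrow>\<^sub>0 'k) set set" where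
  "max_ideal n par R =
     (GREATEST I. graded_ideal n par R I \<and>
        I \<inter> tilde_cartan n par R = {\<zero>\<^bsub>contragredient_tilde n par R\<^esub>})"

text \<open>
  The Cartan matrix enters the construction only through its size and a realization of it
  (see \<^const>\<open>realization_of\<close>).
\<close>

definition contragredient ::
  "nat \<Rightarrow> (nat \<Rightarrow> bit) \<Rightarrow> ('k::field, 'h) realization \<Rightarrow>
     ('k, ('h chevalley magma \<Rightarrow>\<^sub>0 'k) set set) superalgebra" where
  "contragredient n par R =
     quot_superalgebra (contragredient_tilde n par R) (max_ideal n par R)"

definition contragredient_e ::
  "nat \<Rightarrow> (nat \<Rightarrow> bit) \<Rightarrow> ('k::field, 'h) realization \<Rightarrow> nat \<Rightarrow>
     ('h chevalley magma \<Rightarrow>\<^sub>0 'k) set set" where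
  "contragredient_e n par R i =
     max_ideal n par R +>\<^bsub>contragredient_tilde n par R\<^esub> tilde_coset n par R (gen (EGen i))"

definition f4_matrix :: "int mat" where
  "f4_matrix = mat_of_rows_list 4
     [[ 2, -1,  0,  0],
      [-1,  2, -2,  0],
      [ 0, -1,  2, -1],
      [ 0,  0, -1,  2]]"

definition g16_matrix :: "int mat" where
  "g16_matrix = mat_of_rows_list 3
     [[ 2, -1,  0],
      [-1,  2, -2],
      [ 0, -1,  0]]"

definition f4 ::
  "('k::field, 'h) realization \<Rightarrow> ('k, ('h chevalley magma \<Rightarrow>\<^sub>0 'k) set set) superalgebra" where
  "f4 R = contragredient 4 (\<lambda>_. 0) R"

definition g16 ::
  "('k::field, 'h) realization \<Rightarrow> ('k, ('h chevalley magma \<Rightarrow>\<^sub>0 'k) set set) superalgebra" where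
  "g16 R = contragredient 3 (\<lambda>i. if i = 2 then 1 else 0) R"

text \<open>The adjoint action of \<open>e\<^sub>4\<close>, which has index 3 when counting from 0.\<close>

definition f4_ad_e4 ::
  "('k::field, 'h) realization \<Rightarrow> ('h chevalley magma \<Rightarrow>\<^sub>0 'k) set set
     \<Rightarrow> ('h chevalley magma \<Rightarrow>\<^sub>0 'k) set set" where
  "f4_ad_e4 R x = contragredient_e 4 (\<lambda>_. 0) R 3 \<otimes>\<^bsub>f4 R\<^esub> x"


section \<open>Semisimplification\<close>

text \<open>A Lie algebra in \<open>Rep \<alpha>\<^sub>3\<close>, where \<open>t\<close> acts by \<open>d\<close>.\<close>

definition rep_alpha3_lie_algebra ::
  "('k::field, 'v, 'm) superalgebra_scheme \<Rightarrow> ('v \<Rightarrow> 'v) \<Rightarrow> bool" where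
  "rep_alpha3_lie_algebra L d \<longleftrightarrow>
     lie_superalgebra L \<and> part L 1 = {\<zero>\<^bsub>L\<^esub>} \<and>
     vectorspace.fin_dim class_ring L \<and>
     linear_map class_ring L L d \<and>
     (\<forall>x\<in>carrier L. \<forall>y\<in>carrier L. d (x \<otimes>\<^bsub>L\<^esub> y) = d x \<otimes>\<^bsub>L\<^esub> y \<oplus>\<^bsub>L\<^esub> x \<otimes>\<^bsub>L\<^esub> d y) \<and>
     (\<forall>x\<in>carrier L. d (d (d x)) = \<zero>\<^bsub>L\<^esub>)"

text \<open>
  A decomposition into Jordan blocks: \<open>n1\<close> blocks \<open>x i\<close>, then \<open>n2\<close> blocks \<open>x i \<mapsto> d (x i)\<close>, then
  \<open>n3\<close> blocks \<open>x i \<mapsto> d (x i) \<mapsto> d (d (x i))\<close>.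
\<close>

definition block_size :: "nat \<Rightarrow> nat \<Rightarrow> nat \<Rightarrow> nat" where
  "block_size n1 n2 i = (if i < n1 then 1 else if i < n1 + n2 then 2 else 3)"

definition jordan_indices :: "nat \<Rightarrow> nat \<Rightarrow> nat \<Rightarrow> (nat \<times> nat) set" where
  "jordan_indices n1 n2 n3 = (SIGMA i:{..<n1 + n2 + n3}. {..<block_size n1 n2 i})"

definition jordan_vector :: "('v \<Rightarrow> 'v) \<Rightarrow> (nat \<Rightarrow> 'v) \<Rightarrow> nat \<times> nat \<Rightarrow> 'v" where
  "jordan_vector d x = (\<lambda>(i, k). (d ^^ k) (x i))"

definition jordan_decomposition ::
  "('k::field, 'v, 'm) module_scheme \<Rightarrow> ('v \<Rightarrow> 'v) \<Rightarrow> nat \<Rightarrow> nat \<Rightarrow> nat \<Rightarrow> (nat \<Rightarrow> 'v) \<Rightarrow> bool" where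
  "jordan_decomposition V d n1 n2 n3 x \<longleftrightarrow>
     inj_on (jordan_vector d x) (jordan_indices n1 n2 n3) \<and>
     vectorspace.basis class_ring V (jordan_vector d x ` jordan_indices n1 n2 n3) \<and>
     (\<forall>i<n1 + n2 + n3. (d ^^ block_size n1 n2 i) (x i) = \<zero>\<^bsub>V\<^esub>)"

text \<open>The coefficient of the basis vector \<open>b\<close> in the expansion of \<open>v\<close> in the finite basis \<open>B\<close>.\<close>

definition basis_coeff :: "('k::field, 'v, 'm) module_scheme \<Rightarrow> 'v set \<Rightarrow> 'v \<Rightarrow> 'v \<Rightarrow> 'k" where
  "basis_coeff V B v b = (THE a. a \<in> extensional B \<and> module.lincomb V a B = v) b"

definition block_parity :: "nat \<Rightarrow> nat \<Rightarrow> bit" where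
  "block_parity n1 i = (if i < n1 then 0 else 1)"

text \<open>
  The coefficient of \<open>y\<^sub>k\<close> in the bracket of \<open>y\<^sub>i\<close> and \<open>y\<^sub>j\<close>, for \<open>i\<close>, \<open>j\<close>, \<open>k\<close> less than \<open>n1 + n2\<close>. The
  case of two odd indices evaluates the bracket on the \<open>t\<close>-invariant element
  \<open>- x\<^sub>i \<otimes> d x\<^sub>j + d x\<^sub>i \<otimes> x\<^sub>j\<close>, which spans the summand \<open>J\<^sub>1\<close> of the tensor product of two blocks \<open>J\<^sub>2\<close>.
\<close>

definition semisimplification_coeff ::
  "('k::field, 'v, 'm) superalgebra_scheme \<Rightarrow> ('v \<Rightarrow> 'v) \<Rightarrow> nat \<Rightarrow> nat \<Rightarrow> nat \<Rightarrow> (nat \<Rightarrow> 'v)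
     \<Rightarrow> nat \<Rightarrow> nat \<Rightarrow> nat \<Rightarrow> 'k" where
  "semisimplification_coeff L d n1 n2 n3 x i j k =
     (let coeff = (\<lambda>v. basis_coeff L (jordan_vector d x ` jordan_indices n1 n2 n3) v (x k));
          p = block_parity n1 in
      if p i + p j \<noteq> p k then 0
      else if p i = 1 \<and> p j = 1
        then coeff (\<ominus>\<^bsub>L\<^esub> (x i \<otimes>\<^bsub>L\<^esub> d (x j)) \<oplus>\<^bsub>L\<^esub> d (x i) \<otimes>\<^bsub>L\<^esub> x j)
      else coeff (x i \<otimes>\<^bsub>L\<^esub> x j))"

text \<open>
  The image of \<open>L\<close> in \<open>Ver\<^sub>3\<close>, identified with super vector spaces, computed from a Jordan
  decomposition \<open>x\<close>: blocks of size 3 are negligible, blocks of size 1 and 2 give even and odd basis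
  vectors \<open>y\<^sub>i\<close>. Its elements are the coordinate vectors with respect to the \<open>y\<^sub>i\<close>, extended by 0.
\<close>

definition semisimplification ::
  "('k::field, 'v, 'm) superalgebra_scheme \<Rightarrow> ('v \<Rightarrow> 'v) \<Rightarrow> nat \<Rightarrow> nat \<Rightarrow> nat \<Rightarrow> (nat \<Rightarrow> 'v)
     \<Rightarrow> ('k, nat \<Rightarrow> 'k) superalgebra" where
  "semisimplification L d n1 n2 n3 x =
     \<lparr>carrier = {v. \<forall>i\<ge>n1 + n2. v i = 0},
      mult = (\<lambda>v w k. if k < n1 + n2
                then \<Sum>i<n1 + n2. \<Sum>j<n1 + n2.
                       v i * w j * semisimplification_coeff L d n1 n2 n3 x i j k
                else 0),
      one = (\<lambda>_. 0), zero = (\<lambda>_. 0), add = (\<lambda>v w i. v i + w i), smult = (\<lambda>c v i. c * v i),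
      part = (\<lambda>p. {v. \<forall>i. v i \<noteq> 0 \<longrightarrow> i < n1 + n2 \<and> block_parity n1 i = p})\<rparr>"

end

theory Submission
  imports Defs "HOL-Library.Function_Algebras"
begin

text \<open>
  Both contragredient algebras are identified with explicit algebras given by tables of structure constants.
  A finite-dimensional Lie superalgebra \<open>M\<close>, graded by the root lattice with one-dimensional root spaces and
  generated by elements \<open>e\<^sub>i\<close>, \<open>f\<^sub>i\<close> that satisfy the Chevalley relations, is contragredient as soon as every root
  vector can be moved to a nonzero vector of degree 0 by repeated brackets with generators. Indeed, by the
  triangular decomposition, the degree 0 part of the universal algebra is the Cartan subalgebra, on which the
  map to \<open>M\<close> is injective; hence its kernel is a graded ideal that meets the Cartan subalgebra trivially, and the
  descent to degree 0 shows that it contains every other such ideal. The Jacobi identity of \<open>M\<close> only needs to be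
  checked with a generator in first position, since the elements that act as derivations form a subalgebra.

  The tops of the blocks of sizes 1 and 2 are bases of \<open>ker d / (ker d \<inter> im d)\<close> and
  \<open>ker d\<^sup>2 / (ker d + ker d\<^sup>2 \<inter> im d)\<close>, and the brackets of the semisimplification are well defined on these
  quotients, so they do not depend on the Jordan decomposition. It suffices to compute them in a basis of \<open>f4\<close>
  adapted to \<open>ad e\<^sub>4\<close>, with 21 blocks of size 1, 14 of size 2 and one of size 3; the criterion above then
  applies to the outcome with the Cartan matrix of \<open>g(1,6)\<close>.
\<close>

section \<open>Ideals and quotients of nonassociative superalgebras\<close>

text \<open>The matrix of g(1,6) can be read off from that of f4. The odd generator f_3 becomes the
  top of the block that ends in the old f_3, so it has degree - alpha_3 - alpha_4, and its odd
  bracket with e_3 is -2 (h_3 - h_4) = h_3 - h_4. Row 3 minus row 4 of the matrix of f4 is (0, -1,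
  3, -3), which modulo 3 is (0, -1, 0, 0): the third row of the other matrix, followed by a zero
  which says that h_3 - h_4 commutes with e_4. So do h_1 and h_2, whereas h_4 lies in the middle of
  the block f_4, h_4, e_4 of size 3 and disappears.

  The bracket table of f4 is the only one entered as data. That of the semisimplification is
  computed from it by the bracket formula, so its agreement with the semisimplification is proved
  once and its antisymmetry is inherited. Both Cartan matrices stay invertible modulo 3, hence the
  coroots span the Cartan space of any realization and the Cartan part of each model is determined
  by brackets of generators.\<close>

locale class_vectorspace = vectorspace class_ring V
  for V :: "('k::field, 'v, 'm) module_scheme" (structure)
begin

lemma smult_carrier: "x \<in> carrier V \<Longrightarrow> c \<odot>\<^bsub>V\<^esub> x \<in> carrier V"
  by (rule smult_closed) auto

lemma zero_smult: "x \<in> carrier V \<Longrightarrow> 0 \<odot>\<^bsub>V\<^esub> x = \<zero>"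
  using smult_l_null[of x] by simp

lemma one_smult: "x \<in> carrier V \<Longrightarrow> 1 \<odot>\<^bsub>V\<^esub> x = x"
  using smult_one[of x] by simp

lemma add_smult: "x \<in> carrier V \<Longrightarrow> (a + b) \<odot>\<^bsub>V\<^esub> x = a \<odot>\<^bsub>V\<^esub> x \<oplus> b \<odot>\<^bsub>V\<^esub> x"
  using smult_l_distr[of a b x] by simp

lemma smult_add: "\<lbrakk>x \<in> carrier V; y \<in> carrier V\<rbrakk> \<Longrightarrow> a \<odot>\<^bsub>V\<^esub> (x \<oplus> y) = a \<odot>\<^bsub>V\<^esub> x \<oplus> a \<odot>\<^bsub>V\<^esub> y"
  using smult_r_distr[of a x y] by simp

lemma smult_smult: "x \<in> carrier V \<Longrightarrow> a \<odot>\<^bsub>V\<^esub> (b \<odot>\<^bsub>V\<^esub> x) = (a * b) \<odot>\<^bsub>V\<^esub> x"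
  using smult_assoc1[of a b x] by simp

lemma neg_smult: assumes "x \<in> carrier V" shows "\<ominus> x = (- 1) \<odot>\<^bsub>V\<^esub> x"
proof -
  have "(- 1) \<odot>\<^bsub>V\<^esub> x \<oplus> x = (- 1 + 1) \<odot>\<^bsub>V\<^esub> x"
    using assms by (simp only: add_smult one_smult)
  also have "\<dots> = \<zero>" using assms by (simp add: zero_smult)
  finally show ?thesis using assms by (intro minus_equality) (auto intro: smult_carrier)
qed

lemma smult_minus: assumes "x \<in> carrier V" "y \<in> carrier V"
  shows "c \<odot>\<^bsub>V\<^esub> (x \<ominus> y) = c \<odot>\<^bsub>V\<^esub> x \<ominus> c \<odot>\<^bsub>V\<^esub> y"
  using assms by (simp add: a_minus_def neg_smult smult_carrier smult_add smult_smult)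

end

locale bilinear_algebra = class_vectorspace A
  for A :: "('k::field, 'v, 'm) superalgebra_scheme" (structure) +
  assumes mult_closed: "\<lbrakk>x \<in> carrier A; y \<in> carrier A\<rbrakk> \<Longrightarrow> x \<otimes> y \<in> carrier A"
    and mult_add_left: "\<lbrakk>x \<in> carrier A; y \<in> carrier A; z \<in> carrier A\<rbrakk>
          \<Longrightarrow> (x \<oplus> y) \<otimes> z = x \<otimes> z \<oplus> y \<otimes> z"
    and mult_add_right: "\<lbrakk>x \<in> carrier A; y \<in> carrier A; z \<in> carrier A\<rbrakk>
          \<Longrightarrow> x \<otimes> (y \<oplus> z) = x \<otimes> y \<oplus> x \<otimes> z"
    and mult_smult_left: "\<lbrakk>x \<in> carrier A; y \<in> carrier A\<rbrakk> \<Longrightarrow> (c \<odot>\<^bsub>A\<^esub> x) \<otimes> y = c \<odot>\<^bsub>A\<^esub> (x \<otimes> y)"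
    and mult_smult_right: "\<lbrakk>x \<in> carrier A; y \<in> carrier A\<rbrakk> \<Longrightarrow> x \<otimes> (c \<odot>\<^bsub>A\<^esub> y) = c \<odot>\<^bsub>A\<^esub> (x \<otimes> y)"
begin

lemma mult_minus_left: assumes "x \<in> carrier A" "y \<in> carrier A" "z \<in> carrier A"
  shows "(x \<ominus> y) \<otimes> z = x \<otimes> z \<ominus> y \<otimes> z"
  using assms by (simp add: a_minus_def neg_smult smult_carrier mult_add_left mult_smult_left mult_closed)

lemma mult_minus_right: assumes "x \<in> carrier A" "y \<in> carrier A" "z \<in> carrier A"
  shows "z \<otimes> (x \<ominus> y) = z \<otimes> x \<ominus> z \<otimes> y"
  using assms by (simp add: a_minus_def neg_smult smult_carrier mult_add_right mult_smult_right mult_closed)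

end

locale algebra_ideal = bilinear_algebra A
  for A :: "('k::field, 'v, 'm) superalgebra_scheme" (structure) +
  fixes I
  assumes ideal: "alg_ideal A I"
begin

lemma sub: "submodule class_ring I A"
  using ideal by (auto simp: alg_ideal_def VectorSpace.subspace_def)

lemma ideal_carrier: "x \<in> I \<Longrightarrow> x \<in> carrier A"
  using sub by (auto simp: submodule_def)
lemma ideal_add: "x \<in> I \<Longrightarrow> y \<in> I \<Longrightarrow> x \<oplus> y \<in> I"
  using sub by (auto simp: submodule_def)
lemma ideal_smult: "x \<in> I \<Longrightarrow> c \<odot>\<^bsub>A\<^esub> x \<in> I"
  using sub by (auto simp: submodule_def)
lemma ideal_zero: "\<zero> \<in> I"
  using sub by (auto simp: submodule_def)
lemma ideal_mult_right: "x \<in> carrier A \<Longrightarrow> y \<in> I \<Longrightarrow> x \<otimes> y \<in> I"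
  using ideal by (auto simp: alg_ideal_def)
lemma ideal_mult_left: "x \<in> carrier A \<Longrightarrow> y \<in> I \<Longrightarrow> y \<otimes> x \<in> I"
  using ideal by (auto simp: alg_ideal_def)

sublocale abelian_subgroup I A
proof (rule abelian_subgroupI3)
  show "additive_subgroup I A"
  proof (rule additive_subgroupI, unfold_locales)
    fix x assume "x \<in> I"
    then have "\<ominus> x \<in> I" by (simp add: neg_smult ideal_carrier ideal_smult)
    then show "inv\<^bsub>add_monoid A\<^esub> x \<in> I" by (simp add: a_inv_def)
  qed (auto simp: ideal_carrier ideal_add ideal_zero)
  show "abelian_group A" by (rule abelian_group_axioms)
qed

lemma coset_eq_iff:
  assumes "x \<in> carrier A" "y \<in> carrier A"
  shows "I +> x = I +> y \<longleftrightarrow> x \<ominus> y \<in> I"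
proof -
  have "x \<in> I +> y \<longleftrightarrow> x \<ominus> y \<in> I"
    using a_rcos_module[OF assms(2,1)] by (simp add: a_minus_def)
  then show ?thesis using assms a_repr_independence'[of x y] a_rcos_self[of x] by metis
qed

lemma mem_coset: "x \<in> carrier A \<Longrightarrow> y \<in> I +> x \<Longrightarrow> y \<in> carrier A \<and> I +> y = I +> x"
  by (metis a_elemrcos_carrier a_repr_independence' abelian_group_axioms)

abbreviation "Q \<equiv> quot_superalgebra A I"

lemma quot_carrier: "carrier Q = (\<lambda>x. I +> x) ` carrier A"
  by (auto simp: quot_superalgebra_def A_RCOSETS_def')

lemma quot_zero: "\<zero>\<^bsub>Q\<^esub> = I +> \<zero>"
  by (simp add: quot_superalgebra_def a_rcos_const ideal_zero)

lemma quot_part: "part Q i = (\<lambda>x. I +> x) ` part A i"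
  by (simp add: quot_superalgebra_def)

lemma quot_add: "\<lbrakk>x \<in> carrier A; y \<in> carrier A\<rbrakk> \<Longrightarrow> (I +> x) \<oplus>\<^bsub>Q\<^esub> (I +> y) = I +> (x \<oplus> y)"
  by (simp add: quot_superalgebra_def a_rcos_sum)

text \<open>Scaling in the quotient is a union over all representatives; it is one coset because
  each representative contributes the same one.\<close>

lemma quot_smult: assumes x: "x \<in> carrier A" shows "c \<odot>\<^bsub>Q\<^esub> (I +> x) = I +> (c \<odot>\<^bsub>A\<^esub> x)"
proof -
  have "I +> (c \<odot>\<^bsub>A\<^esub> y) = I +> (c \<odot>\<^bsub>A\<^esub> x)" if "y \<in> I +> x" for y
  proof -
    from mem_coset[OF x that] have y: "y \<in> carrier A" "y \<ominus> x \<in> I" using x by (auto simp: coset_eq_iff)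
    from ideal_smult[OF y(2), of c] x y show ?thesis by (simp add: coset_eq_iff smult_carrier smult_minus)
  qed
  then have "(\<Union>y\<in>I +> x. I +> (c \<odot>\<^bsub>A\<^esub> y)) = (\<Union>y\<in>I +> x. I +> (c \<odot>\<^bsub>A\<^esub> x))" by (rule SUP_cong[OF refl])
  also have "\<dots> = I +> (c \<odot>\<^bsub>A\<^esub> x)" using a_rcos_self[OF x] by blast
  finally show ?thesis unfolding quot_superalgebra_def by (simp only: module.simps superalgebra.simps)
qed

text \<open>Representatives are exchanged one factor at a time, which uses the ideal property once
  on each side.\<close>

lemma quot_mult: assumes x: "x \<in> carrier A" and y: "y \<in> carrier A"
  shows "(I +> x) \<otimes>\<^bsub>Q\<^esub> (I +> y) = I +> (x \<otimes> y)"
proof -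
  have "I +> (x' \<otimes> y') = I +> (x \<otimes> y)" if h: "x' \<in> I +> x" "y' \<in> I +> y" for x' y'
  proof -
    from mem_coset[OF x h(1)] have x': "x' \<in> carrier A" "x' \<ominus> x \<in> I" using x by (auto simp: coset_eq_iff)
    from mem_coset[OF y h(2)] have y': "y' \<in> carrier A" "y' \<ominus> y \<in> I" using y by (auto simp: coset_eq_iff)
    have "I +> (x' \<otimes> y') = I +> (x \<otimes> y')"
      using ideal_mult_left[OF y'(1) x'(2)] x x' y' by (simp add: coset_eq_iff mult_closed mult_minus_left)
    also have "\<dots> = I +> (x \<otimes> y)"
      using ideal_mult_right[OF x y'(2)] x y y' by (simp add: coset_eq_iff mult_closed mult_minus_right)
    finally show ?thesis .
  qed
  then have "(\<Union>a\<in>I +> x. \<Union>b\<in>I +> y. I +> (a \<otimes> b)) = (\<Union>a\<in>I +> x. \<Union>b\<in>I +> y. I +> (x \<otimes> y))"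
    by (intro SUP_cong[OF refl])
  also have "\<dots> = I +> (x \<otimes> y)" using a_rcos_self[OF x] a_rcos_self[OF y] by blast
  finally show ?thesis
    unfolding quot_superalgebra_def rcoset_mult_def by (simp only: monoid.simps)
qed

lemma coset_in_quot: "x \<in> carrier A \<Longrightarrow> I +> x \<in> carrier Q"
  by (simp add: quot_carrier)

sublocale quot: bilinear_algebra Q
proof -
  have 1: "vectorspace (class_ring :: 'k ring) Q"
  proof (rule vs_criteria)
    show "field (class_ring :: 'k ring)" by (rule class_field.field_axioms)
    show "\<forall>v\<in>carrier Q. \<exists>neg_v\<in>carrier Q. v \<oplus>\<^bsub>Q\<^esub> neg_v = \<zero>\<^bsub>Q\<^esub>"
    proof
      fix v assume "v \<in> carrier Q"
      then obtain x where x: "x \<in> carrier A" "v = I +> x" by (auto simp: quot_carrier)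
      then have "v \<oplus>\<^bsub>Q\<^esub> (I +> (\<ominus> x)) = \<zero>\<^bsub>Q\<^esub>" by (simp add: quot_add quot_zero r_neg)
      moreover have "I +> (\<ominus> x) \<in> carrier Q" using x by (simp add: coset_in_quot)
      ultimately show "\<exists>neg_v\<in>carrier Q. v \<oplus>\<^bsub>Q\<^esub> neg_v = \<zero>\<^bsub>Q\<^esub>" by blast
    qed
  qed (auto simp: quot_carrier quot_zero quot_add quot_smult smult_carrier a_ac add_smult smult_add
        smult_smult one_smult simp del: a_coset_add_zero)
  show "bilinear_algebra Q"
    unfolding bilinear_algebra_def bilinear_algebra_axioms_def class_vectorspace_def using 1
    by (auto simp: quot_carrier quot_add quot_smult quot_mult smult_carrier mult_closed
        mult_add_left mult_add_right mult_smult_left mult_smult_right)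
qed

end

section \<open>Free superalgebras\<close>

context bilinear_algebra
begin

lemma subspaceI:
  assumes "I \<subseteq> carrier A" "\<zero> \<in> I" "\<And>x y. x \<in> I \<Longrightarrow> y \<in> I \<Longrightarrow> x \<oplus> y \<in> I"
    "\<And>c x. x \<in> I \<Longrightarrow> c \<odot>\<^bsub>A\<^esub> x \<in> I"
  shows "VectorSpace.subspace class_ring I A"
  unfolding VectorSpace.subspace_def submodule_def
  using assms vectorspace_axioms module_axioms by auto

lemma alg_idealI:
  assumes "I \<subseteq> carrier A" "\<zero> \<in> I" "\<And>x y. x \<in> I \<Longrightarrow> y \<in> I \<Longrightarrow> x \<oplus> y \<in> I"
    "\<And>c x. x \<in> I \<Longrightarrow> c \<odot>\<^bsub>A\<^esub> x \<in> I"
    "\<And>x y. x \<in> carrier A \<Longrightarrow> y \<in> I \<Longrightarrow> x \<otimes> y \<in> I"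
    "\<And>x y. x \<in> carrier A \<Longrightarrow> y \<in> I \<Longrightarrow> y \<otimes> x \<in> I"
  shows "alg_ideal A I"
  unfolding alg_ideal_def using subspaceI[OF assms(1-4)] assms(5,6) by auto

lemma alg_ideal_hull:
  assumes "R \<subseteq> carrier A"
  shows "alg_ideal A (alg_ideal A hull R)"
proof -
  \<comment> \<open>The carrier is itself an ideal containing \<open>R\<close>, so the intersection
    that defines the hull runs over a nonempty family and stays in the carrier.\<close>
  have C: "alg_ideal A (carrier A)"
    by (rule alg_idealI) (auto simp: mult_closed smult_carrier)
  have sub: "submodule class_ring I A" if "alg_ideal A I" for I
    using that by (auto simp: alg_ideal_def VectorSpace.subspace_def)
  show ?thesis
  proof (rule alg_idealI)
    show "alg_ideal A hull R \<subseteq> carrier A" using assms by (intro hull_minimal C)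
  qed (auto simp: hull_def alg_ideal_def VectorSpace.subspace_def submodule_def)
qed

end

lemma lookup_smult: "Poly_Mapping.lookup (Poly_Mapping.map ((*) c) p) w = c * Poly_Mapping.lookup p w"
  for c :: "'k::field"
  by (simp add: Poly_Mapping.map.rep_eq when_def)

lemma smult_single: "Poly_Mapping.map ((*) c) (Poly_Mapping.single w a) = Poly_Mapping.single w (c * a)"
  for c :: "'k::field"
  by (rule poly_mapping_eqI) (simp add: lookup_smult lookup_single when_def)

lemma keys_smult: "Poly_Mapping.keys (Poly_Mapping.map ((*) c) p) \<subseteq> Poly_Mapping.keys p"
  for c :: "'k::field"
  by (auto simp: in_keys_iff lookup_smult)

lemma free_simps:
  "carrier (free_superalgebra X par) = {p. \<forall>w\<in>Poly_Mapping.keys p. set_magma w \<subseteq> X}"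
  "add (free_superalgebra X par) = (+)"
  "zero (free_superalgebra X par) = 0"
  "smult (free_superalgebra X par) = (\<lambda>c. Poly_Mapping.map ((*) c))"
  "part (free_superalgebra X par) = weight_space X par"
  by (simp_all add: free_superalgebra_def)

text \<open>The additional terms have coefficient 0. Larger index sets make it possible to compare
  products whose factors have different supports, as in the proof of additivity.\<close>

lemma free_mult:
  assumes "finite A" "Poly_Mapping.keys p \<subseteq> A" "finite B" "Poly_Mapping.keys q \<subseteq> B"
  shows "p \<otimes>\<^bsub>free_superalgebra X par\<^esub> q = (\<Sum>u\<in>A. \<Sum>v\<in>B.
     Poly_Mapping.single (Br u v) (Poly_Mapping.lookup p u * Poly_Mapping.lookup q v))"
proof -
  have "p \<otimes>\<^bsub>free_superalgebra X par\<^esub> q = (\<Sum>u\<in>Poly_Mapping.keys p. \<Sum>v\<in>Poly_Mapping.keys q.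
     Poly_Mapping.single (Br u v) (Poly_Mapping.lookup p u * Poly_Mapping.lookup q v))"
    by (simp add: free_superalgebra_def)
  also have "\<dots> = (\<Sum>u\<in>Poly_Mapping.keys p. \<Sum>v\<in>B.
     Poly_Mapping.single (Br u v) (Poly_Mapping.lookup p u * Poly_Mapping.lookup q v))"
    by (intro sum.cong refl sum.mono_neutral_left assms) (auto simp: in_keys_iff)
  also have "\<dots> = (\<Sum>u\<in>A. \<Sum>v\<in>B.
     Poly_Mapping.single (Br u v) (Poly_Mapping.lookup p u * Poly_Mapping.lookup q v))"
    by (intro sum.mono_neutral_left assms) (auto simp: in_keys_iff)
  finally show ?thesis .
qed

lemma free_mult_single:
  "Poly_Mapping.single u a \<otimes>\<^bsub>free_superalgebra X par\<^esub> Poly_Mapping.single v b =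
     Poly_Mapping.single (Br u v) (a * b)"
  by (subst free_mult[of "{u}" _ "{v}"]) auto

lemma keys_free_mult:
  "Poly_Mapping.keys (p \<otimes>\<^bsub>free_superalgebra X par\<^esub> q) \<subseteq>
     {Br u v | u v. u \<in> Poly_Mapping.keys p \<and> v \<in> Poly_Mapping.keys q}"
proof -
  have "Poly_Mapping.keys (p \<otimes>\<^bsub>free_superalgebra X par\<^esub> q) \<subseteq> (\<Union>u\<in>Poly_Mapping.keys p.
     Poly_Mapping.keys (\<Sum>v\<in>Poly_Mapping.keys q.
        Poly_Mapping.single (Br u v) (Poly_Mapping.lookup p u * Poly_Mapping.lookup q v)))"
    by (simp add: free_superalgebra_def keys_sum)
  also have "\<dots> \<subseteq> (\<Union>u\<in>Poly_Mapping.keys p. \<Union>v\<in>Poly_Mapping.keys q.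
     Poly_Mapping.keys (Poly_Mapping.single (Br u v) (Poly_Mapping.lookup p u * Poly_Mapping.lookup q v)))"
    by (intro UN_mono subset_refl keys_sum)
  also have "\<dots> \<subseteq> {Br u v | u v. u \<in> Poly_Mapping.keys p \<and> v \<in> Poly_Mapping.keys q}" by auto
  finally show ?thesis .
qed

lemma map_smult_sum: "Poly_Mapping.map ((*) c) (\<Sum>x\<in>A. f x) = (\<Sum>x\<in>A. Poly_Mapping.map ((*) c) (f x))"
  for c :: "'k::field"
  by (rule poly_mapping_eqI) (simp add: lookup_smult lookup_sum sum_distrib_left)

lemma free_bilinear_algebra: "bilinear_algebra (free_superalgebra X par :: ('k::field, 'g magma \<Rightarrow>\<^sub>0 'k) superalgebra)"
proof -
  let ?T = "free_superalgebra X par :: ('k, 'g magma \<Rightarrow>\<^sub>0 'k) superalgebra"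
  have "vectorspace (class_ring :: 'k ring) ?T"
  proof (rule vs_criteria)
    show "field (class_ring :: 'k ring)" by (rule class_field.field_axioms)
    show "\<forall>v\<in>carrier ?T. \<exists>w\<in>carrier ?T. v \<oplus>\<^bsub>?T\<^esub> w = \<zero>\<^bsub>?T\<^esub>"
    proof
      fix v assume "v \<in> carrier ?T"
      then show "\<exists>w\<in>carrier ?T. v \<oplus>\<^bsub>?T\<^esub> w = \<zero>\<^bsub>?T\<^esub>"
        by (intro bexI[of _ "- v"]) (auto simp: free_simps)
    qed
  next
    show "\<forall>v w. v \<in> carrier ?T \<and> w \<in> carrier ?T \<longrightarrow> v \<oplus>\<^bsub>?T\<^esub> w \<in> carrier ?T"
      using keys_add by (fastforce simp: free_simps)
  next
    show "\<forall>c v. c \<in> carrier class_ring \<and> v \<in> carrier ?T \<longrightarrow> c \<odot>\<^bsub>?T\<^esub> v \<in> carrier ?T"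
      using keys_smult by (fastforce simp: free_simps)
  qed (auto simp: free_simps lookup_smult lookup_add algebra_simps intro!: poly_mapping_eqI)
  moreover have "bilinear_algebra_axioms ?T"
  proof
    show "x \<otimes>\<^bsub>?T\<^esub> y \<in> carrier ?T" if "x \<in> carrier ?T" "y \<in> carrier ?T" for x y
      using that keys_free_mult[of X par x y] by (fastforce simp: free_simps)
  next
    fix x y z :: "'g magma \<Rightarrow>\<^sub>0 'k"
    let ?X = "Poly_Mapping.keys x \<union> Poly_Mapping.keys y"
    have "(x + y) \<otimes>\<^bsub>?T\<^esub> z = x \<otimes>\<^bsub>?T\<^esub> z + y \<otimes>\<^bsub>?T\<^esub> z"
      using keys_add[of x y]
      by (simp add: free_mult[of ?X _ "Poly_Mapping.keys z"] lookup_add algebra_simps single_add sum.distrib)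
    then show "(x \<oplus>\<^bsub>?T\<^esub> y) \<otimes>\<^bsub>?T\<^esub> z = x \<otimes>\<^bsub>?T\<^esub> z \<oplus>\<^bsub>?T\<^esub> y \<otimes>\<^bsub>?T\<^esub> z" by (simp add: free_simps)
    have "z \<otimes>\<^bsub>?T\<^esub> (x + y) = z \<otimes>\<^bsub>?T\<^esub> x + z \<otimes>\<^bsub>?T\<^esub> y"
      using keys_add[of x y]
      by (simp add: free_mult[of "Poly_Mapping.keys z" _ ?X] lookup_add algebra_simps single_add sum.distrib)
    then show "z \<otimes>\<^bsub>?T\<^esub> (x \<oplus>\<^bsub>?T\<^esub> y) = z \<otimes>\<^bsub>?T\<^esub> x \<oplus>\<^bsub>?T\<^esub> z \<otimes>\<^bsub>?T\<^esub> y" by (simp add: free_simps)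
  next
    fix x y :: "'g magma \<Rightarrow>\<^sub>0 'k" and c :: 'k
    show "(c \<odot>\<^bsub>?T\<^esub> x) \<otimes>\<^bsub>?T\<^esub> y = c \<odot>\<^bsub>?T\<^esub> (x \<otimes>\<^bsub>?T\<^esub> y)"
      using keys_smult[of c x]
      by (simp add: free_mult[of "Poly_Mapping.keys x" _ "Poly_Mapping.keys y"] free_simps(4) lookup_smult
          map_smult_sum smult_single algebra_simps)
    show "x \<otimes>\<^bsub>?T\<^esub> (c \<odot>\<^bsub>?T\<^esub> y) = c \<odot>\<^bsub>?T\<^esub> (x \<otimes>\<^bsub>?T\<^esub> y)"
      using keys_smult[of c y]
      by (simp add: free_mult[of "Poly_Mapping.keys x" _ "Poly_Mapping.keys y"] free_simps(4) lookup_smult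
          map_smult_sum smult_single algebra_simps)
  qed
  ultimately show ?thesis by (simp add: bilinear_algebra_def class_vectorspace_def)
qed

text \<open>Subtraction in the record goes through inverses in its additive monoid, which are
  controlled only on the carrier.\<close>

lemma free_minus:
  assumes "y \<in> carrier (free_superalgebra X par)"
  shows "x \<ominus>\<^bsub>free_superalgebra X par\<^esub> y = x - (y :: 'g magma \<Rightarrow>\<^sub>0 'k::field)"
proof -
  interpret bilinear_algebra "free_superalgebra X par :: ('k, 'g magma \<Rightarrow>\<^sub>0 'k) superalgebra"
    by (rule free_bilinear_algebra)
  have "Poly_Mapping.map ((*) (- 1)) y = - y" by (rule poly_mapping_eqI) (simp add: lookup_smult)
  then show ?thesis using assms by (simp add: a_minus_def neg_smult) (simp add: free_simps)
qed

section \<open>Triangular decomposition of contragredient superalgebras\<close>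

abbreviation word :: "'g magma \<Rightarrow> ('g magma \<Rightarrow>\<^sub>0 'k::field)" where
  "word w \<equiv> Poly_Mapping.single w 1"

abbreviation cartan_word :: "'h \<Rightarrow> 'h chevalley magma" where
  "cartan_word h \<equiv> Gen (CartanGen h)"

lemma sum_monomials:
  "(\<Sum>w\<in>Poly_Mapping.keys p. Poly_Mapping.single w (Poly_Mapping.lookup p w)) = p"
  by (rule poly_mapping_eqI) (simp add: lookup_sum lookup_single when_def sum.delta in_keys_iff)

locale contragredient_presentation = R: vectorspace class_ring R
  for n :: nat and par :: "nat \<Rightarrow> bit" and R :: "('k::field, 'h) realization" +
  assumes coroot_carrier: "i < n \<Longrightarrow> coroot R i \<in> carrier R"
begin

abbreviation "T \<equiv> free_contragredient n par R"
abbreviation "X \<equiv> generators n R"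
abbreviation "C \<equiv> carrier T"
abbreviation "J \<equiv> tilde_ideal n par R"
abbreviation wt :: "'h chevalley magma \<Rightarrow> (nat \<Rightarrow>\<^sub>0 int)" where "wt \<equiv> weight gen_degree"

sublocale T: bilinear_algebra T
  unfolding free_contragredient_def by (rule free_bilinear_algebra)

lemma T_simps: "add T = (+)" "zero T = 0" "smult T = (\<lambda>c. Poly_Mapping.map ((*) c))"
  "part T = weight_space X (gen_parity par)"
  by (simp_all add: free_contragredient_def free_simps)

lemma T_carrier: "x \<in> C \<longleftrightarrow> (\<forall>w\<in>Poly_Mapping.keys x. set_magma w \<subseteq> X)"
  by (simp add: free_contragredient_def free_simps)

lemma T_minus: "y \<in> C \<Longrightarrow> x \<ominus>\<^bsub>T\<^esub> y = x - y"
  unfolding free_contragredient_def by (rule free_minus)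

lemma word_mult: "word u \<otimes>\<^bsub>T\<^esub> word v = word (Br u v)"
  by (simp add: free_contragredient_def free_mult_single)

lemma word_carrier: "set_magma w \<subseteq> X \<Longrightarrow> word w \<in> C"
  by (simp add: T_carrier)

lemma part_carrier: "x \<in> part T i \<Longrightarrow> x \<in> C"
  by (simp add: T_simps T_carrier weight_space_def)

lemma gen_carrier: "g \<in> X \<Longrightarrow> gen g \<in> C"
  by (simp add: gen_def T_carrier)

lemma gen_mem: "i < n \<Longrightarrow> EGen i \<in> X" "i < n \<Longrightarrow> FGen i \<in> X" "h \<in> carrier R \<Longrightarrow> CartanGen h \<in> X"
  by (auto simp: generators_def)

lemma lie_relations_carrier: "lie_relations T \<subseteq> C"
proof -
  have "x \<otimes>\<^bsub>T\<^esub> y \<in> C" "x \<oplus>\<^bsub>T\<^esub> y \<in> C" "x \<ominus>\<^bsub>T\<^esub> y \<in> C" "c \<odot>\<^bsub>T\<^esub> x \<in> C" if "x \<in> C" "y \<in> C" for x y c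
    using that by (auto simp: T.mult_closed T.smult_carrier)
  then show ?thesis by (auto simp: lie_relations_def dest!: part_carrier)
qed

lemma chevalley_relations_carrier: "chevalley_relations n par R \<subseteq> C"
proof -
  have 1: "x \<otimes>\<^bsub>T\<^esub> y \<in> C" "x \<oplus>\<^bsub>T\<^esub> y \<in> C" "x \<ominus>\<^bsub>T\<^esub> y \<in> C" "c \<odot>\<^bsub>T\<^esub> x \<in> C" if "x \<in> C" "y \<in> C" for x y c
    using that by (auto simp: T.mult_closed T.smult_carrier)
  have 2: "gen (EGen i) \<in> C" "gen (FGen i) \<in> C" if "i < n" for i
    using that by (auto intro: gen_carrier gen_mem)
  have 3: "gen (CartanGen h) \<in> C" if "h \<in> carrier R" for h
    using that by (auto intro: gen_carrier gen_mem)
  have 4: "c \<odot>\<^bsub>R\<^esub> h \<oplus>\<^bsub>R\<^esub> h' \<in> carrier R" if "h \<in> carrier R" "h' \<in> carrier R" for c h h'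
    using that by simp
  show ?thesis
    unfolding chevalley_relations_def Let_def by (auto intro!: 1 2 3 4 coroot_carrier)
qed

sublocale tilde: algebra_ideal T J
proof
  show "alg_ideal T J"
    unfolding tilde_ideal_def
    by (intro T.alg_ideal_hull Un_least lie_relations_carrier chevalley_relations_carrier)
qed

lemma relations_in_ideal: "lie_relations T \<subseteq> J" "chevalley_relations n par R \<subseteq> J"
  unfolding tilde_ideal_def using hull_subset by fast+

lemma J_carrier: "x \<in> J \<Longrightarrow> x \<in> C" by (rule tilde.ideal_carrier)
lemma J_add: "x \<in> J \<Longrightarrow> y \<in> J \<Longrightarrow> x + y \<in> J" using tilde.ideal_add by (simp add: T_simps)
lemma J_smult: "x \<in> J \<Longrightarrow> Poly_Mapping.map ((*) c) x \<in> J" using tilde.ideal_smult[of x c] by (simp add: T_simps)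
lemma J_zero: "0 \<in> J" using tilde.ideal_zero by (simp add: T_simps)
lemma J_uminus: "x \<in> J \<Longrightarrow> - x \<in> J"
proof -
  have "- x = Poly_Mapping.map ((*) (- 1)) x" by (rule poly_mapping_eqI) (simp add: lookup_smult)
  then show "x \<in> J \<Longrightarrow> - x \<in> J" by (simp add: J_smult)
qed
lemma J_minus: "x \<in> J \<Longrightarrow> y \<in> J \<Longrightarrow> x - y \<in> J"
  using J_add[of x "- y"] J_uminus[of y] by simp

lemma C_add: "x \<in> C \<Longrightarrow> y \<in> C \<Longrightarrow> x + y \<in> C" using T.a_closed by (simp add: T_simps)
lemma C_smult: "x \<in> C \<Longrightarrow> Poly_Mapping.map ((*) c) x \<in> C" using T.smult_carrier[of x c] by (simp add: T_simps)
lemma C_minus: "x \<in> C \<Longrightarrow> y \<in> C \<Longrightarrow> x - y \<in> C" using T.minus_closed[of x y] by (simp add: T_minus)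
lemma C_zero: "0 \<in> C" using T.zero_closed by (simp add: T_simps)

lemma word_part: "set_magma w \<subseteq> X \<Longrightarrow> word w \<in> part T (weight (gen_parity par) w)"
  by (simp add: T_simps weight_space_def)

text \<open>Only spans matter for the triangular decomposition, so the sign may remain
  anonymous.\<close>

lemma antisym_relation:
  assumes "set_magma u \<subseteq> X" "set_magma v \<subseteq> X"
  shows "\<exists>c. word (Br u v) + Poly_Mapping.map ((*) c) (word (Br v u)) \<in> J"
proof -
  have "word u \<otimes>\<^bsub>T\<^esub> word v \<oplus>\<^bsub>T\<^esub> koszul (weight (gen_parity par) u) (weight (gen_parity par) v) \<odot>\<^bsub>T\<^esub>
     (word v \<otimes>\<^bsub>T\<^esub> word u) \<in> lie_relations T"
    unfolding lie_relations_def using assms word_part by blast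
  then show ?thesis using relations_in_ideal(1) by (auto simp: word_mult T_simps)
qed

lemma jacobi_relation:
  assumes "set_magma u \<subseteq> X" "set_magma v \<subseteq> X" "set_magma w \<subseteq> X"
  shows "\<exists>c. (c = 1 \<or> c = - 1) \<and> word (Br u (Br v w)) - (word (Br (Br u v) w) + Poly_Mapping.map ((*) c) (word (Br v (Br u w)))) \<in> J"
proof -
  let ?c = "koszul (weight (gen_parity par) u) (weight (gen_parity par) v) :: 'k"
  have "word u \<otimes>\<^bsub>T\<^esub> (word v \<otimes>\<^bsub>T\<^esub> word w) \<ominus>\<^bsub>T\<^esub> ((word u \<otimes>\<^bsub>T\<^esub> word v) \<otimes>\<^bsub>T\<^esub> word w \<oplus>\<^bsub>T\<^esub>
     ?c \<odot>\<^bsub>T\<^esub> (word v \<otimes>\<^bsub>T\<^esub> (word u \<otimes>\<^bsub>T\<^esub> word w))) \<in> lie_relations T"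
    unfolding lie_relations_def using assms word_part by blast
  then have "word u \<otimes>\<^bsub>T\<^esub> (word v \<otimes>\<^bsub>T\<^esub> word w) \<ominus>\<^bsub>T\<^esub> ((word u \<otimes>\<^bsub>T\<^esub> word v) \<otimes>\<^bsub>T\<^esub> word w \<oplus>\<^bsub>T\<^esub>
     ?c \<odot>\<^bsub>T\<^esub> (word v \<otimes>\<^bsub>T\<^esub> (word u \<otimes>\<^bsub>T\<^esub> word w))) \<in> J" using relations_in_ideal(1) by blast
  moreover have "(word u \<otimes>\<^bsub>T\<^esub> word v) \<otimes>\<^bsub>T\<^esub> word w \<oplus>\<^bsub>T\<^esub>
     ?c \<odot>\<^bsub>T\<^esub> (word v \<otimes>\<^bsub>T\<^esub> (word u \<otimes>\<^bsub>T\<^esub> word w)) \<in> C"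
    using assms by (intro T.a_closed T.smult_carrier T.mult_closed word_carrier)
  ultimately have "word (Br u (Br v w)) - (word (Br (Br u v) w) + Poly_Mapping.map ((*) ?c) (word (Br v (Br u w)))) \<in> J"
    by (simp add: T_minus) (simp add: word_mult T_simps)
  moreover have "?c = 1 \<or> ?c = - 1" by (simp add: koszul_def)
  ultimately show ?thesis by blast
qed

section \<open>Spans of words of a given degree, modulo the defining relations\<close>

definition wspan :: "'h chevalley magma set \<Rightarrow> (nat \<Rightarrow>\<^sub>0 int) \<Rightarrow> ('h chevalley magma \<Rightarrow>\<^sub>0 'k) set" where
  "wspan W q = {x. \<exists>s. x - s \<in> J \<and> (\<forall>w\<in>Poly_Mapping.keys s. set_magma w \<subseteq> X \<and> w \<in> W \<and> wt w = q)}"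

lemma wspan_carrier: "x \<in> wspan W q \<Longrightarrow> x \<in> C"
proof -
  assume "x \<in> wspan W q"
  then obtain s where "x - s \<in> J" "s \<in> C" by (auto simp: wspan_def T_carrier)
  then have "(x - s) + s \<in> C" using C_add J_carrier by blast
  then show ?thesis by simp
qed

lemma wspan_mono: "W \<subseteq> W' \<Longrightarrow> wspan W q \<subseteq> wspan W' q"
  unfolding wspan_def by blast

lemma wspan_J: "x \<in> J \<Longrightarrow> x \<in> wspan W q"
  unfolding wspan_def by (auto intro!: exI[of _ 0])

lemma wspan_add: "x \<in> wspan W q \<Longrightarrow> y \<in> wspan W q \<Longrightarrow> x + y \<in> wspan W q"
proof -
  assume "x \<in> wspan W q" "y \<in> wspan W q"
  then obtain s t where "x - s \<in> J" "\<forall>w\<in>Poly_Mapping.keys s. set_magma w \<subseteq> X \<and> w \<in> W \<and> wt w = q"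
    "y - t \<in> J" "\<forall>w\<in>Poly_Mapping.keys t. set_magma w \<subseteq> X \<and> w \<in> W \<and> wt w = q" by (auto simp: wspan_def)
  moreover from this have "(x + y) - (s + t) \<in> J" using J_add[of "x - s" "y - t"] by (simp add: algebra_simps)
  ultimately show ?thesis unfolding wspan_def using keys_add[of s t] by blast
qed

lemma wspan_smult: "x \<in> wspan W q \<Longrightarrow> Poly_Mapping.map ((*) c) x \<in> wspan W q"
proof -
  assume "x \<in> wspan W q"
  then obtain s where s: "x - s \<in> J" "\<forall>w\<in>Poly_Mapping.keys s. set_magma w \<subseteq> X \<and> w \<in> W \<and> wt w = q"
    by (auto simp: wspan_def)
  have "Poly_Mapping.map ((*) c) (x - s) = Poly_Mapping.map ((*) c) x - Poly_Mapping.map ((*) c) s"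
    by (rule poly_mapping_eqI) (simp add: lookup_smult lookup_minus algebra_simps)
  then show ?thesis unfolding wspan_def using s J_smult[OF s(1), of c] keys_smult[of c s]
    by (auto intro!: exI[of _ "Poly_Mapping.map ((*) c) s"])
qed

lemma wspan_uminus: "x \<in> wspan W q \<Longrightarrow> - x \<in> wspan W q"
proof -
  have "- x = Poly_Mapping.map ((*) (- 1)) x" by (rule poly_mapping_eqI) (simp add: lookup_smult)
  then show "x \<in> wspan W q \<Longrightarrow> - x \<in> wspan W q" by (simp add: wspan_smult)
qed

lemma wspan_sum: "(\<And>i. i \<in> A \<Longrightarrow> f i \<in> wspan W q) \<Longrightarrow> (\<Sum>i\<in>A. f i) \<in> wspan W q"
  by (induction A rule: infinite_finite_induct) (auto intro: wspan_add wspan_J J_zero)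

lemma wspan_cong: "x - y \<in> J \<Longrightarrow> y \<in> wspan W q \<Longrightarrow> x \<in> wspan W q"
  using wspan_add[OF wspan_J[of "x - y" W q]] by fastforce

lemma wspan_word: "set_magma w \<subseteq> X \<Longrightarrow> w \<in> W \<Longrightarrow> word w \<in> wspan W (wt w)"
  unfolding wspan_def by (auto intro!: exI[of _ "word w"] J_zero)

text \<open>Bilinearity extends the assumption from words to their combinations, and the ideal
  absorbs the errors \<open>x - s\<close> and \<open>y - t\<close>.\<close>

lemma wspan_mult:
  assumes W: "\<And>u v. \<lbrakk>u \<in> W1; v \<in> W2; set_magma u \<subseteq> X; set_magma v \<subseteq> X; wt u = p; wt v = q\<rbrakk> \<Longrightarrow> word (Br u v) \<in> wspan W3 (p + q)"
    and x: "x \<in> wspan W1 p" and y: "y \<in> wspan W2 q"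
  shows "x \<otimes>\<^bsub>T\<^esub> y \<in> wspan W3 (p + q)"
proof -
  obtain s where s: "x - s \<in> J" "\<forall>w\<in>Poly_Mapping.keys s. set_magma w \<subseteq> X \<and> w \<in> W1 \<and> wt w = p"
    using x by (auto simp: wspan_def)
  obtain t where t: "y - t \<in> J" "\<forall>w\<in>Poly_Mapping.keys t. set_magma w \<subseteq> X \<and> w \<in> W2 \<and> wt w = q"
    using y by (auto simp: wspan_def)
  have c: "s \<in> C" "t \<in> C" "x \<in> C" "y \<in> C" using s t x y wspan_carrier by (auto simp: T_carrier)
  have "s \<otimes>\<^bsub>T\<^esub> t = (\<Sum>u\<in>Poly_Mapping.keys s. \<Sum>v\<in>Poly_Mapping.keys t.
     Poly_Mapping.map ((*) (Poly_Mapping.lookup s u * Poly_Mapping.lookup t v)) (word (Br u v)))"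
    by (simp add: free_contragredient_def free_mult[of "Poly_Mapping.keys s" _ "Poly_Mapping.keys t"] smult_single)
  also have "\<dots> \<in> wspan W3 (p + q)"
    using s t by (intro wspan_sum wspan_smult W) auto
  finally have st: "s \<otimes>\<^bsub>T\<^esub> t \<in> wspan W3 (p + q)" .
  have "x \<otimes>\<^bsub>T\<^esub> y - x \<otimes>\<^bsub>T\<^esub> t \<in> J"
    using tilde.ideal_mult_right[OF c(3) t(1)] T.mult_minus_right[of y t x] c
    by (simp add: T_minus T.mult_closed)
  moreover have "x \<otimes>\<^bsub>T\<^esub> t - s \<otimes>\<^bsub>T\<^esub> t \<in> J"
    using tilde.ideal_mult_left[OF c(2) s(1)] T.mult_minus_left[of x s t] c
    by (simp add: T_minus T.mult_closed)
  ultimately show ?thesis using st by (intro wspan_cong[of "x \<otimes>\<^bsub>T\<^esub> y" "x \<otimes>\<^bsub>T\<^esub> t"] wspan_cong[of "x \<otimes>\<^bsub>T\<^esub> t"])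
qed

lemma wspan_swap:
  assumes "set_magma u \<subseteq> X" "set_magma v \<subseteq> X" "word (Br v u) \<in> wspan W q"
  shows "word (Br u v) \<in> wspan W q"
proof -
  obtain c where "word (Br u v) + Poly_Mapping.map ((*) c) (word (Br v u)) \<in> J"
    using antisym_relation assms by blast
  then show ?thesis using wspan_uminus[OF wspan_smult[OF assms(3), of c]]
    by (intro wspan_cong[of "word (Br u v)" "- Poly_Mapping.map ((*) c) (word (Br v u))"]) simp_all
qed

lemma wspan_jacobi:
  assumes "set_magma u \<subseteq> X" "set_magma v \<subseteq> X" "set_magma w \<subseteq> X"
    "word (Br (Br u v) w) \<in> wspan W q" "word (Br v (Br u w)) \<in> wspan W q"
  shows "word (Br u (Br v w)) \<in> wspan W q"
  using jacobi_relation[OF assms(1-3)] assms(4,5) by (blast intro: wspan_cong wspan_add wspan_smult)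

text \<open>Solves the Jacobi relation for \<open>[[u, v], w]\<close>, so that the action of a
  bracket is controlled by the actions of its two factors.\<close>

lemma wspan_jacobi':
  assumes "set_magma u \<subseteq> X" "set_magma v \<subseteq> X" "set_magma w \<subseteq> X"
    "word (Br u (Br v w)) \<in> wspan W q" "word (Br v (Br u w)) \<in> wspan W q"
  shows "word (Br (Br u v) w) \<in> wspan W q"
proof -
  obtain c where "word (Br u (Br v w)) - (word (Br (Br u v) w) + Poly_Mapping.map ((*) c) (word (Br v (Br u w)))) \<in> J"
    using jacobi_relation[OF assms(1-3)] by blast
  from J_uminus[OF this] have "word (Br (Br u v) w) - (word (Br u (Br v w)) + - Poly_Mapping.map ((*) c) (word (Br v (Br u w)))) \<in> J"
    by (simp add: algebra_simps)
  then show ?thesis using assms by (blast intro: wspan_cong wspan_add wspan_smult wspan_uminus)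
qed

section \<open>Raising words, lowering words and Cartan words\<close>

definition "cwords = cartan_word ` carrier R"
definition "gwords K = {w. set_magma w \<subseteq> (K :: 'h chevalley set)}"

lemma gwords_Br: "Br u v \<in> gwords K \<longleftrightarrow> u \<in> gwords K \<and> v \<in> gwords K" by (auto simp: gwords_def)

text \<open>Captures what the raising and the lowering generators have in common, so that one set of
  lemmas serves both halves of the triangular decomposition. Stability on letters suffices, since
  Cartan generators act as derivations.\<close>

definition ladder :: "'h chevalley set \<Rightarrow> bool" where
  "ladder K \<longleftrightarrow> K \<subseteq> X \<and> (\<forall>k\<in>K. \<forall>h\<in>carrier R. word (Br (cartan_word h) (Gen k)) \<in> wspan (gwords K) (gen_degree k))"

lemma gwords_mult: 
  assumes "x \<in> wspan (gwords K) p" "y \<in> wspan (gwords K) q"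
  shows "x \<otimes>\<^bsub>T\<^esub> y \<in> wspan (gwords K) (p + q)"
  by (rule wspan_mult[OF _ assms]) (metis gwords_Br wspan_word weight.simps(2) magma.set(2) Un_least)

lemma cartan_gwords:
  assumes K: "ladder K" and h: "h \<in> carrier R"
  shows "w \<in> gwords K \<Longrightarrow> word (Br (cartan_word h) w) \<in> wspan (gwords K) (wt w)"
proof (induction w)
  case (Gen k)
  then show ?case using K h by (auto simp: ladder_def gwords_def)
next
  case (Br u v)
  then have X: "set_magma u \<subseteq> X" "set_magma v \<subseteq> X" and K': "u \<in> gwords K" "v \<in> gwords K"
    using K by (auto simp: ladder_def gwords_def)
  note m = gwords_mult[OF Br.IH(1)[OF K'(1)] wspan_word[OF X(2) K'(2)]]
    gwords_mult[OF wspan_word[OF X(1) K'(1)] Br.IH(2)[OF K'(2)]]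
  show ?case by (rule wspan_jacobi) (use X gen_mem(3)[OF h] m in \<open>auto simp: word_mult\<close>)
qed

lemma cwords_X: "w \<in> cwords \<Longrightarrow> set_magma w \<subseteq> X"
  by (auto simp: cwords_def gen_mem)
lemma cwords_wt: "w \<in> cwords \<Longrightarrow> wt w = 0"
  by (auto simp: cwords_def)

text \<open>A Cartan term can survive only for a single letter. In a longer word it is bracketed
  with the remaining factor, and by \<open>cartan_gwords\<close> the result is again in the span of
  words over \<open>K\<close>.\<close>

lemma lower_gwords:
  assumes K: "ladder K" and g: "g \<in> X"
    and gK: "\<And>k. k \<in> K \<Longrightarrow> word (Br (Gen g) (Gen k)) \<in> wspan (gwords K \<union> cwords) (gen_degree g + gen_degree k)"
  shows "w \<in> gwords K \<Longrightarrow> word (Br (Gen g) w) \<in> wspan (gwords K \<union> cwords) (gen_degree g + wt w)"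
proof (induction w)
  case (Gen k)
  then show ?case using gK by (auto simp: gwords_def)
next
  case (Br u v)
  then have X: "set_magma u \<subseteq> X" "set_magma v \<subseteq> X" and K': "u \<in> gwords K" "v \<in> gwords K"
    using K by (auto simp: ladder_def gwords_def)
  have cw: "word (Br w v) \<in> wspan (gwords K) (p + q)"
    if "w \<in> cwords" "v \<in> gwords K" "wt w = p" "wt v = q" for w v p q
    using that cartan_gwords[OF K] by (auto simp: cwords_def)
  have gw: "word (Br u v) \<in> wspan (gwords K) (p + q)"
    if "u \<in> gwords K" "v \<in> gwords K" "set_magma u \<subseteq> X" "set_magma v \<subseteq> X" "wt u = p" "wt v = q" for u v p q
    using that by (metis gwords_Br wspan_word weight.simps(2) magma.set(2) Un_least)
  have wc: "word (Br v w) \<in> wspan (gwords K) (p + q)"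
    if "w \<in> cwords" "v \<in> gwords K" "set_magma v \<subseteq> X" "wt v = p" "wt w = q" for w v p q
    using wspan_swap[OF that(3) cwords_X[OF that(1)] cw[OF that(1,2,5,4)]] by (simp add: add.commute)
  have 1: "word (Br (Gen g) u) \<otimes>\<^bsub>T\<^esub> word v \<in> wspan (gwords K) ((gen_degree g + wt u) + wt v)"
    by (rule wspan_mult[OF _ Br.IH(1)[OF K'(1)] wspan_word[OF X(2) K'(2)]]) (auto intro: cw gw)
  have 2: "word u \<otimes>\<^bsub>T\<^esub> word (Br (Gen g) v) \<in> wspan (gwords K) (wt u + (gen_degree g + wt v))"
    by (rule wspan_mult[OF _ wspan_word[OF X(1) K'(1)] Br.IH(2)[OF K'(2)]]) (auto intro: wc gw)
  have "word (Br (Gen g) (Br u v)) \<in> wspan (gwords K) (gen_degree g + wt (Br u v))"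
    by (rule wspan_jacobi) (use 1 2 X g in \<open>auto simp: word_mult algebra_simps\<close>)
  then show ?case using wspan_mono[of "gwords K" "gwords K \<union> cwords"] by blast
qed

abbreviation "KE \<equiv> EGen ` {..<n} :: 'h chevalley set"
abbreviation "KF \<equiv> FGen ` {..<n} :: 'h chevalley set"

lemma relation_EF: assumes "i < n" "j < n"
  shows "word (Br (Gen (EGen i)) (Gen (FGen j))) - (if i = j then word (cartan_word (coroot R i)) else 0) \<in> J"
proof -
  have "gen (EGen i) \<otimes>\<^bsub>T\<^esub> gen (FGen j) \<ominus>\<^bsub>T\<^esub> (if i = j then gen (CartanGen (coroot R i)) else \<zero>\<^bsub>T\<^esub>)
     \<in> chevalley_relations n par R"
    unfolding chevalley_relations_def Let_def using assms by blast
  moreover have "(if i = j then gen (CartanGen (coroot R i)) else \<zero>\<^bsub>T\<^esub>) \<in> C"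
    using assms by (auto intro!: gen_carrier gen_mem coroot_carrier)
  ultimately show ?thesis using relations_in_ideal(2)
    by (auto simp: T_minus gen_def word_mult T_simps)
qed

lemma relation_HE: assumes "h \<in> carrier R" "j < n"
  shows "word (Br (cartan_word h) (Gen (EGen j))) - Poly_Mapping.map ((*) (root R j h)) (word (Gen (EGen j))) \<in> J"
proof -
  have "gen (CartanGen h) \<otimes>\<^bsub>T\<^esub> gen (EGen j) \<ominus>\<^bsub>T\<^esub> root R j h \<odot>\<^bsub>T\<^esub> gen (EGen j) \<in> chevalley_relations n par R"
    unfolding chevalley_relations_def Let_def using assms by blast
  moreover have "root R j h \<odot>\<^bsub>T\<^esub> gen (EGen j) \<in> C"
    using assms by (auto intro!: gen_carrier gen_mem T.smult_carrier)
  ultimately show ?thesis using relations_in_ideal(2)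
    by (auto simp: T_minus gen_def word_mult) (auto simp: T_simps)
qed

lemma relation_HF: assumes "h \<in> carrier R" "j < n"
  shows "word (Br (cartan_word h) (Gen (FGen j))) + Poly_Mapping.map ((*) (root R j h)) (word (Gen (FGen j))) \<in> J"
proof -
  have "gen (CartanGen h) \<otimes>\<^bsub>T\<^esub> gen (FGen j) \<oplus>\<^bsub>T\<^esub> root R j h \<odot>\<^bsub>T\<^esub> gen (FGen j) \<in> chevalley_relations n par R"
    unfolding chevalley_relations_def Let_def using assms by blast
  then show ?thesis using relations_in_ideal(2)
    by (auto simp: gen_def word_mult) (auto simp: T_simps)
qed

lemma relation_HH: assumes "h \<in> carrier R" "h' \<in> carrier R"
  shows "word (Br (cartan_word h) (cartan_word h')) \<in> J"
proof -
  have "gen (CartanGen h) \<otimes>\<^bsub>T\<^esub> gen (CartanGen h') \<in> chevalley_relations n par R"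
    unfolding chevalley_relations_def Let_def using assms by blast
  then show ?thesis using relations_in_ideal(2) by (auto simp: gen_def word_mult)
qed

lemma relation_H_linear: assumes "h \<in> carrier R" "h' \<in> carrier R"
  shows "word (cartan_word (c \<odot>\<^bsub>R\<^esub> h \<oplus>\<^bsub>R\<^esub> h')) - (Poly_Mapping.map ((*) c) (word (cartan_word h)) + word (cartan_word h')) \<in> J"
proof -
  have "gen (CartanGen (c \<odot>\<^bsub>R\<^esub> h \<oplus>\<^bsub>R\<^esub> h')) \<ominus>\<^bsub>T\<^esub> (c \<odot>\<^bsub>T\<^esub> gen (CartanGen h) \<oplus>\<^bsub>T\<^esub> gen (CartanGen h')) \<in> chevalley_relations n par R"
    unfolding chevalley_relations_def Let_def using assms by blast
  moreover have "c \<odot>\<^bsub>T\<^esub> gen (CartanGen h) \<oplus>\<^bsub>T\<^esub> gen (CartanGen h') \<in> C"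
    using assms by (auto intro!: gen_carrier gen_mem T.smult_carrier)
  ultimately show ?thesis using relations_in_ideal(2)
    by (auto simp: T_minus gen_def word_mult) (auto simp: T_simps)
qed

lemma ladder_KE: "ladder KE"
  unfolding ladder_def
proof (intro conjI ballI)
  fix k h assume k: "k \<in> KE" and h: "h \<in> carrier R"
  then obtain j where j: "k = EGen j" "j < n" by auto
  have "word (Gen k) \<in> wspan (gwords KE) (wt (Gen k))"
    using k by (intro wspan_word) (auto simp: gwords_def generators_def)
  then show "word (Br (cartan_word h) (Gen k)) \<in> wspan (gwords KE) (gen_degree k)"
    using wspan_cong[OF relation_HE[OF h j(2)] wspan_smult] j by simp
qed (auto simp: generators_def)

lemma ladder_KF: "ladder KF"
  unfolding ladder_def
proof (intro conjI ballI)
  fix k h assume k: "k \<in> KF" and h: "h \<in> carrier R"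
  then obtain j where j: "k = FGen j" "j < n" by auto
  have "word (Gen k) \<in> wspan (gwords KF) (wt (Gen k))"
    using k by (intro wspan_word) (auto simp: gwords_def generators_def)
  from wspan_uminus[OF wspan_smult[OF this, of "root R j h"]]
  have "- Poly_Mapping.map ((*) (root R j h)) (word (Gen k)) \<in> wspan (gwords KF) (gen_degree k)"
    by simp
  then show "word (Br (cartan_word h) (Gen k)) \<in> wspan (gwords KF) (gen_degree k)"
    using wspan_cong[of "word (Br (cartan_word h) (Gen k))" "- Poly_Mapping.map ((*) (root R j h)) (word (Gen k))"]
      relation_HF[OF h j(2)] j by simp
qed (auto simp: generators_def)

lemma EF_wspan: assumes "i < n" "j < n" 
  shows "word (Br (Gen (EGen i)) (Gen (FGen j))) \<in> wspan (W \<union> cwords) (Poly_Mapping.single i 1 + Poly_Mapping.single j (- 1))"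
proof (cases "i = j")
  case True
  have "word (cartan_word (coroot R i)) \<in> wspan (W \<union> cwords) (wt (cartan_word (coroot R i)))"
    using assms by (intro wspan_word) (auto simp: cwords_def coroot_carrier gen_mem)
  then have "word (cartan_word (coroot R i)) \<in> wspan (W \<union> cwords) (Poly_Mapping.single i 1 + Poly_Mapping.single j (- 1))"
    using True by (simp add: single_add[symmetric])
  then show ?thesis using wspan_cong[OF relation_EF[OF assms]] True by simp
next
  case False
  then show ?thesis using relation_EF[OF assms] by (intro wspan_J) simp
qed

lemma FE_wspan: assumes "i < n" "j < n" 
  shows "word (Br (Gen (FGen i)) (Gen (EGen j))) \<in> wspan (W \<union> cwords) (Poly_Mapping.single i (- 1) + Poly_Mapping.single j 1)"
  using wspan_swap[OF _ _ EF_wspan[OF assms(2,1), of W]] assms by (simp add: add.commute gen_mem)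

definition "twords = gwords KE \<union> gwords KF \<union> cwords"

lemma gwords_twords: "gwords KE \<subseteq> twords" "gwords KF \<subseteq> twords" "gwords KE \<union> cwords \<subseteq> twords"
   "gwords KF \<union> cwords \<subseteq> twords"
  by (auto simp: twords_def)

text \<open>A raising letter prolongs raising words, acts on lowering words through
  \<open>lower_gwords\<close>, and is exchanged with a Cartan letter by antisymmetry; lowering
  letters behave symmetrically.\<close>

lemma gen_twords:
  assumes g: "g \<in> X" and s: "s \<in> twords"
  shows "word (Br (Gen g) s) \<in> wspan twords (gen_degree g + wt s)"
proof -
  have hs: "word (Br (cartan_word h) s) \<in> wspan twords (wt s)" if h: "h \<in> carrier R" and s: "s \<in> twords" for h s
  proof -
    have "s \<in> gwords KE \<or> s \<in> gwords KF \<or> s \<in> cwords" using s by (auto simp: twords_def)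
    then show ?thesis
  proof (elim disjE)
    assume "s \<in> gwords KE" then show ?thesis
      using cartan_gwords[OF ladder_KE h] wspan_mono[OF gwords_twords(1)] by (auto simp: twords_def)
  next
    assume "s \<in> gwords KF" then show ?thesis
      using cartan_gwords[OF ladder_KF h] wspan_mono[OF gwords_twords(2)] by (auto simp: twords_def)
  next
    assume "s \<in> cwords" then show ?thesis using h relation_HH by (auto simp: cwords_def intro: wspan_J)
  qed
  qed
  consider (h) h where "g = CartanGen h" "h \<in> carrier R" | (E) i where "g = EGen i" "i < n" | (F) i where "g = FGen i" "i < n"
    using g by (auto simp: generators_def)
  then show ?thesis
  proof cases
    case h then show ?thesis using hs[OF h(2) s] by simp
  next
    case E
    have 1: "word (Br (Gen g) s) \<in> wspan twords (gen_degree g + wt s)" if "s \<in> gwords KE"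
    proof -
      have "word (Br (Gen g) s) \<in> wspan twords (wt (Br (Gen g) s))"
      using that E g by (intro wspan_word) (auto simp: gwords_def twords_def generators_def)
      then show ?thesis by simp
    qed
    have 2: "word (Br (Gen g) s) \<in> wspan twords (gen_degree g + wt s)" if "s \<in> gwords KF"
    proof -
      have "word (Br (Gen g) s) \<in> wspan (gwords KF \<union> cwords) (gen_degree g + wt s)"
        by (rule lower_gwords[OF ladder_KF g _ that]) (use E EF_wspan in auto)
      then show ?thesis using wspan_mono[OF gwords_twords(4)] by blast
    qed
    have 3: "word (Br (Gen g) s) \<in> wspan twords (gen_degree g + wt s)" if c: "s \<in> cwords"
    proof -
      obtain h where h: "h \<in> carrier R" "s = cartan_word h" using c by (auto simp: cwords_def)
      have "Gen g \<in> twords" using E by (auto simp: twords_def gwords_def)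
      from wspan_swap[OF _ cwords_X[OF c] hs[OF h(1) this, folded h(2)]] g show ?thesis
        using cwords_wt[OF c] by simp
    qed
    show ?thesis using s 1 2 3 by (auto simp: twords_def)
  next
    case F
    have 1: "word (Br (Gen g) s) \<in> wspan twords (gen_degree g + wt s)" if "s \<in> gwords KF"
    proof -
      have "word (Br (Gen g) s) \<in> wspan twords (wt (Br (Gen g) s))"
      using that F g by (intro wspan_word) (auto simp: gwords_def twords_def generators_def)
      then show ?thesis by simp
    qed
    have 2: "word (Br (Gen g) s) \<in> wspan twords (gen_degree g + wt s)" if "s \<in> gwords KE"
    proof -
      have "word (Br (Gen g) s) \<in> wspan (gwords KE \<union> cwords) (gen_degree g + wt s)"
        by (rule lower_gwords[OF ladder_KE g _ that]) (use F FE_wspan in auto)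
      then show ?thesis using wspan_mono[OF gwords_twords(3)] by blast
    qed
    have 3: "word (Br (Gen g) s) \<in> wspan twords (gen_degree g + wt s)" if c: "s \<in> cwords"
    proof -
      obtain h where h: "h \<in> carrier R" "s = cartan_word h" using c by (auto simp: cwords_def)
      have "Gen g \<in> twords" using F by (auto simp: twords_def gwords_def)
      from wspan_swap[OF _ cwords_X[OF c] hs[OF h(1) this, folded h(2)]] g show ?thesis
        using cwords_wt[OF c] by simp
    qed
    show ?thesis using s 1 2 3 by (auto simp: twords_def)
  qed
qed

lemma twords_X: "s \<in> twords \<Longrightarrow> set_magma s \<subseteq> X"
  using cwords_X by (auto simp: twords_def gwords_def generators_def)

text \<open>Modulo the relations \<open>[[u, v], s]\<close> is a combination of
  \<open>[u, [v, s]]\<close> and \<open>[v, [u, s]]\<close>, so the words that preserve the span are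
  closed under brackets.\<close>

lemma word_twords:
  assumes "set_magma w \<subseteq> X" "s \<in> twords"
  shows "word (Br w s) \<in> wspan twords (wt w + wt s)"
  using assms
proof (induction w arbitrary: s)
  case (Gen g)
  then show ?case using gen_twords by simp
next
  case (Br u v)
  then have X: "set_magma u \<subseteq> X" "set_magma v \<subseteq> X" by auto
  have *: "word a \<otimes>\<^bsub>T\<^esub> word (Br b s) \<in> wspan twords (wt a + (wt b + wt s))"
    if a: "set_magma a \<subseteq> X" and IHa: "\<And>s. s \<in> twords \<Longrightarrow> word (Br a s) \<in> wspan twords (wt a + wt s)"
      and b: "word (Br b s) \<in> wspan twords (wt b + wt s)" for a b
    by (rule wspan_mult[of "{a}", OF _ wspan_word[OF a] b]) (auto dest: IHa)
  show ?case
    by (rule wspan_jacobi') (use *[OF X(1) Br.IH(1)[OF X(1)] Br.IH(2)[OF X(2) Br.prems(2)]]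
      *[OF X(2) Br.IH(2)[OF X(2)] Br.IH(1)[OF X(1) Br.prems(2)]] X twords_X[OF Br.prems(2)] in \<open>auto simp: word_mult algebra_simps\<close>)
qed

lemma words_spanned: "set_magma w \<subseteq> X \<Longrightarrow> word w \<in> wspan twords (wt w)"
proof (induction w)
  case (Gen g)
  then have "Gen g \<in> twords" by (auto simp: twords_def gwords_def cwords_def generators_def)
  with Gen show ?case by (intro wspan_word) auto
next
  case (Br u v)
  then have X: "set_magma u \<subseteq> X" "set_magma v \<subseteq> X" by auto
  have "word u \<otimes>\<^bsub>T\<^esub> word v \<in> wspan twords (wt u + wt v)"
    by (rule wspan_mult[of "{u}", OF _ wspan_word[OF X(1) singletonI] Br.IH(2)[OF X(2)]])
      (metis singletonD word_twords X(1))
  then show ?case by (simp add: word_mult)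
qed

section \<open>Height of a root, and the Cartan subalgebra as the part of degree 0\<close>

definition total :: "(nat \<Rightarrow>\<^sub>0 int) \<Rightarrow> int" where
  "total q = (\<Sum>i<n. Poly_Mapping.lookup q i)"

lemma total_add: "total (p + q) = total p + total q"
  by (simp add: total_def lookup_add sum.distrib)
lemma total_single: "i < n \<Longrightarrow> total (Poly_Mapping.single i a) = a"
  by (simp add: total_def lookup_single when_def)

lemma total_KE: "w \<in> gwords KE \<Longrightarrow> total (wt w) > 0"
  by (induction w) (auto simp: gwords_def total_add total_single)
lemma total_KF: "w \<in> gwords KF \<Longrightarrow> total (wt w) < 0"
  by (induction w) (auto simp: gwords_def total_add total_single)

text \<open>In the linearity relation with scalar -1 and both Cartan elements zero, the subtracted
  combination cancels and \<open>H 0\<close> remains.\<close>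

lemma cartan_zero: "word (cartan_word \<zero>\<^bsub>R\<^esub>) \<in> J"
proof -
  have "word (cartan_word \<zero>\<^bsub>R\<^esub>) - (Poly_Mapping.map ((*) (- 1)) (word (cartan_word \<zero>\<^bsub>R\<^esub>)) + word (cartan_word \<zero>\<^bsub>R\<^esub>)) \<in> J"
    using relation_H_linear[of "\<zero>\<^bsub>R\<^esub>" "\<zero>\<^bsub>R\<^esub>" "- 1"] by simp
  moreover have "word (cartan_word \<zero>\<^bsub>R\<^esub>) - (Poly_Mapping.map ((*) (- 1)) (word (cartan_word \<zero>\<^bsub>R\<^esub>)) + word (cartan_word \<zero>\<^bsub>R\<^esub>))
      = (word (cartan_word \<zero>\<^bsub>R\<^esub>) :: 'h chevalley magma \<Rightarrow>\<^sub>0 'k)"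
    by (simp add: smult_single single_uminus)
  ultimately show ?thesis by simp
qed

lemma Cartan_span:
  assumes "finite A" "A \<subseteq> cwords"
  shows "\<exists>h\<in>carrier R. (\<Sum>w\<in>A. Poly_Mapping.map ((*) (a w)) (word w)) - word (cartan_word h) \<in> J"
  using assms
proof (induction A)
  case empty
  have "word (cartan_word \<zero>\<^bsub>R\<^esub>) \<in> J" by (rule cartan_zero)
  then show ?case using J_uminus by (intro bexI[of _ "\<zero>\<^bsub>R\<^esub>"]) auto
next
  case (insert w A)
  then obtain h where h: "h \<in> carrier R" "(\<Sum>w\<in>A. Poly_Mapping.map ((*) (a w)) (word w)) - word (cartan_word h) \<in> J" by auto
  from insert obtain h' where h': "h' \<in> carrier R" "w = cartan_word h'" by (auto simp: cwords_def)
  let ?h = "a w \<odot>\<^bsub>R\<^esub> h' \<oplus>\<^bsub>R\<^esub> h"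
  from J_minus[OF h(2) relation_H_linear[OF h'(1) h(1), of "a w"]]
  have "(\<Sum>w\<in>insert w A. Poly_Mapping.map ((*) (a w)) (word w)) - word (cartan_word ?h) \<in> J"
    using insert h' by (simp add: algebra_simps)
  moreover have "?h \<in> carrier R" using h h' by simp
  ultimately show ?case by blast
qed

theorem degree_zero_is_cartan:
  assumes "x \<in> weight_space X gen_degree 0"
  shows "\<exists>h\<in>carrier R. x - gen (CartanGen h) \<in> J"
proof -
  have "x = (\<Sum>w\<in>Poly_Mapping.keys x. Poly_Mapping.map ((*) (Poly_Mapping.lookup x w)) (word w))"
    by (simp add: smult_single sum_monomials)
  also have "\<dots> \<in> wspan twords 0"
    using assms words_spanned by (intro wspan_sum wspan_smult) (force simp: weight_space_def)
  finally obtain s where s: "x - s \<in> J" "\<forall>w\<in>Poly_Mapping.keys s. w \<in> twords \<and> wt w = 0" by (auto simp: wspan_def)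
  have t0: "total 0 = 0" by (simp add: total_def)
  \<comment> \<open>Raising words have positive height and lowering words negative height, so degree
    0 leaves only Cartan words.\<close>
  have "Poly_Mapping.keys s \<subseteq> cwords"
    using s(2) total_KE total_KF t0 by (fastforce simp: twords_def)
  from Cartan_span[OF _ this, of "Poly_Mapping.lookup s"] obtain h where h: "h \<in> carrier R" "s - word (cartan_word h) \<in> J"
    by (auto simp: smult_single sum_monomials)
  from J_add[OF s(1) h(2)] h(1) show ?thesis by (auto simp: gen_def)
qed

end

section \<open>Superalgebras given by structure constants\<close>

text \<open>Vectors are functions with pointwise operations. The pointwise laws are kept out of the
  simplifier so that vector identities are not rewritten coordinate by coordinate.\<close>

lemmas fun_ops = plus_fun_apply zero_fun_apply minus_apply uminus_apply
declare fun_ops [simp del]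

definition sc_mult :: "'i set \<Rightarrow> ('i \<Rightarrow> 'i \<Rightarrow> 'i \<Rightarrow> 'k::field) \<Rightarrow> ('i \<Rightarrow> 'k) \<Rightarrow> ('i \<Rightarrow> 'k) \<Rightarrow> 'i \<Rightarrow> 'k" where
  "sc_mult I c v w = (\<lambda>k. if k \<in> I then \<Sum>i\<in>I. \<Sum>j\<in>I. v i * w j * c i j k else 0)"

text \<open>Modelled on the record returned by \<open>semisimplification\<close>, but with an
  arbitrary index set, so that the latter is equal to an instance and not merely isomorphic to
  one.\<close>

definition sc_algebra ::
  "'i set \<Rightarrow> ('i \<Rightarrow> bit) \<Rightarrow> ('i \<Rightarrow> 'i \<Rightarrow> 'i \<Rightarrow> 'k::field) \<Rightarrow> ('k, 'i \<Rightarrow> 'k) superalgebra" where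
  "sc_algebra I par c =
     \<lparr>carrier = {v. \<forall>i. i \<notin> I \<longrightarrow> v i = 0}, mult = sc_mult I c,
      one = (\<lambda>_. 0), zero = (\<lambda>_. 0), add = (\<lambda>v w i. v i + w i), smult = (\<lambda>c v i. c * v i),
      part = (\<lambda>p. {v. \<forall>i. v i \<noteq> 0 \<longrightarrow> i \<in> I \<and> par i = p})\<rparr>"

definition basis_vec :: "'i \<Rightarrow> 'i \<Rightarrow> 'k::field" where
  "basis_vec i = (\<lambda>j. if j = i then 1 else 0)"

definition scale :: "'k::field \<Rightarrow> ('i \<Rightarrow> 'k) \<Rightarrow> 'i \<Rightarrow> 'k" where
  "scale a v = (\<lambda>i. a * v i)"

text \<open>The Koszul sign as an operation on any abelian group, so that one symbol serves both
  vectors and structure constants.\<close>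

definition ssgn :: "bit \<Rightarrow> bit \<Rightarrow> 'v::ab_group_add \<Rightarrow> 'v" where
  "ssgn i j v = (if i = 1 \<and> j = 1 then - v else v)"

lemma scale_koszul: "scale (koszul i j) v = ssgn i j v"
  by (auto simp: scale_def koszul_def ssgn_def fun_eq_iff fun_ops)

lemma scale_simps: "scale a (v + w) = scale a v + scale a w" "scale a (scale b v) = scale (a * b) v"
   "scale a (- v) = - scale a v" "scale 1 v = v" "scale 0 v = 0" "scale a 0 = 0" "scale (a + b) v = scale a v + scale b v"
  by (auto simp: scale_def fun_eq_iff fun_ops algebra_simps)

lemma ssgn_simps: "ssgn i j (v + w) = ssgn i j v + ssgn i j w" "ssgn i j 0 = 0" "ssgn i j (- v) = - ssgn i j v"
   "ssgn i j (ssgn i j v) = v" "ssgn 0 j v = v" "ssgn i 0 v = v" "ssgn 1 1 v = - v"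
  by (auto simp: ssgn_def)

lemma ssgn_scale: "ssgn i j (scale a v) = scale a (ssgn i j v)"
  by (auto simp: ssgn_def scale_simps)

lemma sc_simps:
  "carrier (sc_algebra I par c) = {v. \<forall>i. i \<notin> I \<longrightarrow> v i = 0}"
  "mult (sc_algebra I par c) = sc_mult I c"
  "zero (sc_algebra I par c) = 0"
  "add (sc_algebra I par c) = (+)"
  "smult (sc_algebra I par c) = scale"
  "part (sc_algebra I par c) = (\<lambda>p. {v. \<forall>i. v i \<noteq> 0 \<longrightarrow> i \<in> I \<and> par i = p})"
  by (auto simp: sc_algebra_def scale_def fun_eq_iff fun_ops)

lemma sc_mult_add_left: "sc_mult I c (v + w) x = sc_mult I c v x + sc_mult I c w x"
  by (auto simp: sc_mult_def fun_eq_iff fun_ops algebra_simps sum.distrib)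
lemma sc_mult_add_right: "sc_mult I c x (v + w) = sc_mult I c x v + sc_mult I c x w"
  by (auto simp: sc_mult_def fun_eq_iff fun_ops algebra_simps sum.distrib)
lemma sc_mult_scale_left: "sc_mult I c (scale a v) x = scale a (sc_mult I c v x)"
  by (auto simp: sc_mult_def fun_eq_iff fun_ops algebra_simps sum_distrib_left scale_def)
lemma sc_mult_scale_right: "sc_mult I c x (scale a v) = scale a (sc_mult I c x v)"
  by (auto simp: sc_mult_def fun_eq_iff fun_ops algebra_simps sum_distrib_left scale_def)
lemma sc_mult_uminus_left: "sc_mult I c (- v) x = - sc_mult I c v x"
  by (auto simp: sc_mult_def fun_eq_iff fun_ops sum_negf)
lemma sc_mult_uminus_right: "sc_mult I c x (- v) = - sc_mult I c x v"
  by (auto simp: sc_mult_def fun_eq_iff fun_ops sum_negf)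
lemma sc_mult_zero_left: "sc_mult I c 0 x = 0" and sc_mult_zero_right: "sc_mult I c x 0 = 0"
  by (auto simp: sc_mult_def fun_eq_iff fun_ops)
lemma sc_mult_ssgn: "sc_mult I c (ssgn i j v) x = ssgn i j (sc_mult I c v x)"
  "sc_mult I c x (ssgn i j v) = ssgn i j (sc_mult I c x v)"
  by (auto simp: ssgn_def sc_mult_uminus_left sc_mult_uminus_right)

lemmas sc_mult_linear = sc_mult_add_left sc_mult_add_right sc_mult_scale_left sc_mult_scale_right
  sc_mult_uminus_left sc_mult_uminus_right sc_mult_zero_left sc_mult_zero_right sc_mult_ssgn

lemma sc_mult_sum_left: "sc_mult I c (\<Sum>a\<in>A. f a) x = (\<Sum>a\<in>A. sc_mult I c (f a) x)"
  by (induction A rule: infinite_finite_induct) (simp_all add: sc_mult_linear)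
lemma sc_mult_sum_right: "sc_mult I c x (\<Sum>a\<in>A. f a) = (\<Sum>a\<in>A. sc_mult I c x (f a))"
  by (induction A rule: infinite_finite_induct) (simp_all add: sc_mult_linear)

lemma sc_mult_unit:
  assumes "finite I" "i \<in> I" "j \<in> I"
  shows "sc_mult I c (basis_vec i) (basis_vec j) k = (if k \<in> I then c i j k else 0)"
proof -
  have "(\<Sum>a\<in>I. \<Sum>b\<in>I. basis_vec i a * basis_vec j b * c a b k) = (\<Sum>a\<in>I. if a = i then (\<Sum>b\<in>I. if b = j then c a b k else 0) else 0)"
    by (intro sum.cong refl) (auto simp: basis_vec_def intro!: sum.cong)
  then show ?thesis using assms by (simp add: sc_mult_def)
qed

lemma sum_units:
  assumes "finite I" "\<And>i. i \<notin> I \<Longrightarrow> v i = 0"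
  shows "v = (\<Sum>i\<in>I. scale (v i) (basis_vec i))"
proof
  fix j
  have "(\<Sum>i\<in>I. scale (v i) (basis_vec i)) j = (\<Sum>i\<in>I. scale (v i) (basis_vec i) j)"
    by (induction I rule: infinite_finite_induct) (auto simp: fun_ops)
  also have "\<dots> = (\<Sum>i\<in>I. if i = j then v i else 0)"
    by (intro sum.cong refl) (auto simp: scale_def basis_vec_def)
  also have "\<dots> = v j" using assms by simp
  finally show "v j = (\<Sum>i\<in>I. scale (v i) (basis_vec i)) j" by simp
qed

lemma sc_bilinear_algebra: "bilinear_algebra (sc_algebra I par c :: ('k::field, 'i \<Rightarrow> 'k) superalgebra)"
proof -
  let ?M = "sc_algebra I par c :: ('k, 'i \<Rightarrow> 'k) superalgebra"
  have "vectorspace (class_ring :: 'k ring) ?M"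
  proof (rule vs_criteria)
    show "field (class_ring :: 'k ring)" by (rule class_field.field_axioms)
    show "\<forall>v\<in>carrier ?M. \<exists>w\<in>carrier ?M. v \<oplus>\<^bsub>?M\<^esub> w = \<zero>\<^bsub>?M\<^esub>"
    proof
      fix v assume "v \<in> carrier ?M"
      then show "\<exists>w\<in>carrier ?M. v \<oplus>\<^bsub>?M\<^esub> w = \<zero>\<^bsub>?M\<^esub>"
        by (intro bexI[of _ "- v"]) (auto simp: sc_simps fun_ops)
    qed
  qed (auto simp: sc_simps fun_ops scale_def algebra_simps fun_eq_iff fun_ops)
  then show ?thesis
    unfolding bilinear_algebra_def bilinear_algebra_axioms_def class_vectorspace_def
    by (auto simp: sc_simps fun_ops sc_mult_linear) (auto simp: sc_mult_def)
qed

lemma sc_uminus: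
  assumes "v \<in> carrier (sc_algebra I par c)"
  shows "\<ominus>\<^bsub>sc_algebra I par c\<^esub> v = - v"
proof -
  interpret bilinear_algebra "sc_algebra I par c" by (rule sc_bilinear_algebra)
  show ?thesis using assms by (simp add: neg_smult) (simp add: sc_simps scale_def fun_eq_iff fun_ops)
qed

lemma sc_part_carrier: "v \<in> part (sc_algebra I par c) p \<Longrightarrow> v \<in> carrier (sc_algebra I par c)"
  by (auto simp: sc_simps fun_ops)

lemma basis_vec_part: "i \<in> I \<Longrightarrow> basis_vec i \<in> part (sc_algebra I par c) (par i)"
  by (auto simp: sc_simps fun_ops basis_vec_def)

lemma zero_part: "0 \<in> part (sc_algebra I par c) p"
  by (simp add: sc_simps fun_ops)

lemma sc_part_closed:
  assumes "v \<in> part (sc_algebra I par c) p"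
  shows "w \<in> part (sc_algebra I par c) p \<Longrightarrow> v + w \<in> part (sc_algebra I par c) p"
    "scale a v \<in> part (sc_algebra I par c) p" "- v \<in> part (sc_algebra I par c) p"
    "0 \<in> part (sc_algebra I par c) p" "ssgn i j v \<in> part (sc_algebra I par c) p"
  using assms by (auto simp: sc_simps fun_ops scale_def ssgn_def) (metis add.right_neutral)+

text \<open>Reduces statements that are linear in a homogeneous vector to basis vectors of the same
  parity; nesting it handles multilinear identities.\<close>

lemma sc_part_induct [consumes 2, case_names zero add scale unit]:
  assumes "finite I" and v: "v \<in> part (sc_algebra I par c) p"
    and "P 0"
    and add: "\<And>x y. \<lbrakk>x \<in> part (sc_algebra I par c) p; y \<in> part (sc_algebra I par c) p; P x; P y\<rbrakk> \<Longrightarrow> P (x + y)"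
    and scale: "\<And>a x. \<lbrakk>x \<in> part (sc_algebra I par c) p; P x\<rbrakk> \<Longrightarrow> P (scale a x)"
    and unit: "\<And>i. \<lbrakk>i \<in> I; par i = p\<rbrakk> \<Longrightarrow> P (basis_vec i)"
  shows "P v"
proof -
  let ?M = "sc_algebra I par c"
  have "(\<Sum>i\<in>A. scale (v i) (basis_vec i)) \<in> part ?M p \<and> P (\<Sum>i\<in>A. scale (v i) (basis_vec i))"
    if "A \<subseteq> I" for A
    using that
  proof (induction A rule: infinite_finite_induct)
    case (insert i A)
    have "scale (v i) (basis_vec i) \<in> part ?M p \<and> P (scale (v i) (basis_vec i))"
    proof (cases "v i = 0")
      case True then show ?thesis using assms(3) by (simp add: scale_simps zero_part)
    next
      case False then have "i \<in> I" "par i = p" using v by (auto simp: sc_simps fun_ops)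
      then show ?thesis using basis_vec_part[of i I par c] by (auto intro: sc_part_closed scale unit)
    qed
    then show ?case using insert by (auto intro: sc_part_closed add)
  qed (use assms(3) in \<open>auto simp: zero_part\<close>)
  then have "P (\<Sum>i\<in>I. scale (v i) (basis_vec i))" by blast
  moreover have "v = (\<Sum>i\<in>I. scale (v i) (basis_vec i))"
    by (rule sum_units[OF assms(1)]) (use v in \<open>auto simp: sc_simps\<close>)
  ultimately show ?thesis by simp
qed

text \<open>Sums are restricted to vectors of equal parity, so that all elements are homogeneous.\<close>

inductive_set gspan :: "'i set \<Rightarrow> ('i \<Rightarrow> bit) \<Rightarrow> ('i \<Rightarrow> 'i \<Rightarrow> 'i \<Rightarrow> 'k::field) \<Rightarrow> 'i set \<Rightarrow> ('i \<Rightarrow> 'k) set"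
  for I par c G where
  gspan_gen: "g \<in> G \<Longrightarrow> basis_vec g \<in> gspan I par c G"
| gspan_scale: "x \<in> gspan I par c G \<Longrightarrow> scale a x \<in> gspan I par c G"
| gspan_add: "\<lbrakk>x \<in> gspan I par c G; y \<in> gspan I par c G; x \<in> part (sc_algebra I par c) p; y \<in> part (sc_algebra I par c) p\<rbrakk>
    \<Longrightarrow> x + y \<in> gspan I par c G"
| gspan_mult: "\<lbrakk>g \<in> G; x \<in> gspan I par c G\<rbrakk> \<Longrightarrow> sc_mult I c (basis_vec g) x \<in> gspan I par c G"

text \<open>Collects the conditions that can be read off directly from structure constants. The
  Jacobi identity and the cube condition are reduced to generators and basis vectors below.\<close>

locale sc_super =
  fixes I :: "'i set" and par :: "'i \<Rightarrow> bit" and c :: "'i \<Rightarrow> 'i \<Rightarrow> 'i \<Rightarrow> 'k::field"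
  assumes fin: "finite I"
    and parity: "\<lbrakk>i \<in> I; j \<in> I; k \<in> I; c i j k \<noteq> 0\<rbrakk> \<Longrightarrow> par k = par i + par j"
    and antisym: "\<lbrakk>i \<in> I; j \<in> I; k \<in> I\<rbrakk> \<Longrightarrow> c i j k = - ssgn (par i) (par j) (c j i k)"
begin

abbreviation "M \<equiv> sc_algebra I par c"
abbreviation B (infixl "\<star>" 70) where "B \<equiv> sc_mult I c"
abbreviation "P \<equiv> part M"

lemma mult_part: assumes "v \<in> P i" "w \<in> P j" shows "v \<star> w \<in> P (i + j)"
proof -
  have "k \<in> I \<and> par k = i + j" if nz: "(v \<star> w) k \<noteq> 0" for k
  proof -
    have k: "k \<in> I" using nz by (auto simp: sc_mult_def split: if_splits)
    then have "(\<Sum>a\<in>I. \<Sum>b\<in>I. v a * w b * c a b k) \<noteq> 0" using nz by (auto simp: sc_mult_def)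
    then obtain a where a: "a \<in> I" "(\<Sum>b\<in>I. v a * w b * c a b k) \<noteq> 0" by (meson sum.not_neutral_contains_not_neutral)
    then obtain b where b: "b \<in> I" "v a * w b * c a b k \<noteq> 0" by (meson sum.not_neutral_contains_not_neutral)
    then show ?thesis using assms a k parity[of a b k] by (auto simp: sc_simps fun_ops)
  qed
  then show ?thesis by (simp add: sc_simps)
qed

lemma mult_antisym: assumes "v \<in> P i" "w \<in> P j" shows "v \<star> w = - ssgn i j (w \<star> v)"
  using fin assms(1)
proof (induction rule: sc_part_induct)
  case (unit a)
  show ?case using fin assms(2)
  proof (induction rule: sc_part_induct)
    case (unit b)
    show ?case
    proof
      fix k
      show "(basis_vec a \<star> basis_vec b) k = (- ssgn i j (basis_vec b \<star> basis_vec a)) k"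
        using fin unit \<open>a \<in> I\<close> \<open>par a = i\<close> antisym[of a b k]
        by (auto simp: sc_mult_unit ssgn_def fun_ops)
    qed
  qed (auto simp: sc_mult_linear ssgn_simps ssgn_scale scale_simps)
qed (auto simp: sc_mult_linear ssgn_simps ssgn_scale scale_simps)

section \<open>Homogeneous elements whose left multiplication is a superderivation\<close>

definition good :: "bit \<Rightarrow> ('i \<Rightarrow> 'k) \<Rightarrow> bool" where
  "good i x \<longleftrightarrow> x \<in> P i \<and> (\<forall>j k y z. y \<in> P j \<longrightarrow> z \<in> P k \<longrightarrow>
     x \<star> (y \<star> z) = (x \<star> y) \<star> z + ssgn i j (y \<star> (x \<star> z)))"

lemma goodD: "\<lbrakk>good i x; y \<in> P j; z \<in> P k\<rbrakk> \<Longrightarrow> x \<star> (y \<star> z) = (x \<star> y) \<star> z + ssgn i j (y \<star> (x \<star> z))"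
  by (simp add: good_def)

text \<open>Left multiplication by the bracket of two such elements is the supercommutator of their
  left multiplications, and a supercommutator of superderivations is a superderivation. Once the
  auxiliary equations have brought all terms to a common form, they cancel for each of the eight
  choices of parities.\<close>

lemma good_mult: assumes x: "good i x" and y: "good j y" shows "good (i + j) (x \<star> y)"
  unfolding good_def
proof (intro conjI allI impI)
  have xP: "x \<in> P i" and yP: "y \<in> P j" using x y by (auto simp: good_def)
  show "x \<star> y \<in> P (i + j)" using xP yP by (rule mult_part)
  fix k l z w assume z: "z \<in> P k" and w: "w \<in> P l"
  have xy: "(x \<star> y) \<star> t = x \<star> (y \<star> t) - ssgn i j (y \<star> (x \<star> t))" if "t \<in> P m" for t m
    using goodD[OF x yP that] by simp
  note m = mult_part
  have 1: "(x \<star> y) \<star> (z \<star> w) = x \<star> ((y \<star> z) \<star> w + ssgn j k (z \<star> (y \<star> w)))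
      - ssgn i j (y \<star> ((x \<star> z) \<star> w + ssgn i k (z \<star> (x \<star> w))))"
    using xy[OF m[OF z w]] goodD[OF y z w] goodD[OF x z w] by simp
  have 2: "x \<star> ((y \<star> z) \<star> w) = (x \<star> (y \<star> z)) \<star> w + ssgn i (j + k) ((y \<star> z) \<star> (x \<star> w))"
    by (rule goodD[OF x m[OF yP z] w])
  have 3: "x \<star> (z \<star> (y \<star> w)) = (x \<star> z) \<star> (y \<star> w) + ssgn i k (z \<star> (x \<star> (y \<star> w)))"
    by (rule goodD[OF x z m[OF yP w]])
  have 4: "y \<star> ((x \<star> z) \<star> w) = (y \<star> (x \<star> z)) \<star> w + ssgn j (i + k) ((x \<star> z) \<star> (y \<star> w))"
    by (rule goodD[OF y m[OF xP z] w])
  have 5: "y \<star> (z \<star> (x \<star> w)) = (y \<star> z) \<star> (x \<star> w) + ssgn j k (z \<star> (y \<star> (x \<star> w)))"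
    by (rule goodD[OF y z m[OF xP w]])
  have 6: "((x \<star> y) \<star> z) \<star> w = (x \<star> (y \<star> z)) \<star> w - ssgn i j ((y \<star> (x \<star> z)) \<star> w)"
    using xy[OF z] by (simp add: sc_mult_linear diff_conv_add_uminus del: add_uminus_conv_diff)
  have 7: "z \<star> ((x \<star> y) \<star> w) = z \<star> (x \<star> (y \<star> w)) - ssgn i j (z \<star> (y \<star> (x \<star> w)))"
    using xy[OF w] by (simp add: sc_mult_linear diff_conv_add_uminus del: add_uminus_conv_diff)
  show "(x \<star> y) \<star> (z \<star> w) = ((x \<star> y) \<star> z) \<star> w + ssgn (i + j) k (z \<star> ((x \<star> y) \<star> w))"
    unfolding 1 6 7 sc_mult_linear 2 3 4 5
    by (cases i; cases j; cases k) (auto simp: ssgn_def)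
qed

lemma good_scale: "good i x \<Longrightarrow> good i (scale a x)"
  by (auto simp: good_def sc_part_closed sc_mult_linear scale_simps ssgn_scale)

lemma good_add: "good i x \<Longrightarrow> good i y \<Longrightarrow> good i (x + y)"
  by (auto simp: good_def sc_part_closed sc_mult_linear ssgn_simps algebra_simps)

lemma good_zero: "good i 0"
  by (auto simp: good_def sc_mult_linear ssgn_simps) (auto simp: sc_simps fun_ops)

lemma good_unit:
  assumes g: "g \<in> I" and jac: "\<And>i j. \<lbrakk>i \<in> I; j \<in> I\<rbrakk> \<Longrightarrow> basis_vec g \<star> (basis_vec i \<star> basis_vec j) =
     (basis_vec g \<star> basis_vec i) \<star> basis_vec j + ssgn (par g) (par i) (basis_vec i \<star> (basis_vec g \<star> basis_vec j))"
  shows "good (par g) (basis_vec g)"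
  unfolding good_def
proof (intro conjI allI impI)
  show "basis_vec g \<in> P (par g)" by (rule basis_vec_part[OF g])
  fix j k y z assume y: "y \<in> P j" and z: "z \<in> P k"
  show "basis_vec g \<star> (y \<star> z) = (basis_vec g \<star> y) \<star> z + ssgn (par g) j (y \<star> (basis_vec g \<star> z))"
    using fin y
  proof (induction rule: sc_part_induct)
    case (unit a)
    show ?case using fin z
    proof (induction rule: sc_part_induct)
      case (unit b)
      show ?case using jac[OF \<open>a \<in> I\<close> \<open>b \<in> I\<close>] \<open>par a = j\<close> by simp
    qed (auto simp: sc_mult_linear ssgn_simps ssgn_scale scale_simps algebra_simps)
  qed (auto simp: sc_mult_linear ssgn_simps ssgn_scale scale_simps algebra_simps)
qed

lemma good_gspan:
  assumes G: "\<And>g. g \<in> G \<Longrightarrow> good (par g) (basis_vec g)" and x: "x \<in> gspan I par c G"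
  shows "\<exists>i. good i x"
  using x
proof induction
  case (gspan_add x y p)
  then obtain i j where ij: "good i x" "good j y" by auto
  \<comment> \<open>The parities supplied by induction could differ from \<open>p\<close>. Since a
    nonzero vector has only one parity, they agree with \<open>p\<close> unless a summand is
    zero.\<close>
  have eq: "q = p \<or> z = 0" if "z \<in> P p" "z \<in> P q" for z p q using that by (fastforce simp: sc_simps fun_ops)
  have "x \<in> P i" "y \<in> P j" using ij by (auto simp: good_def)
  then consider "x = 0" | "y = 0" | "i = p" "j = p"
    using eq[OF gspan_add(3), of i] eq[OF gspan_add(4), of j] by blast
  then show ?case
  proof cases
    case 3 then show ?thesis using ij good_add by blast
  qed (use ij in auto)
qed (use G good_scale good_mult in blast)+

theorem lie_superalgebra_from_generators:
  assumes G: "\<And>g. g \<in> G \<Longrightarrow> good (par g) (basis_vec g)"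
    and span: "\<And>i. i \<in> I \<Longrightarrow> basis_vec i \<in> gspan I par c G"
    and cube: "\<And>i. \<lbrakk>i \<in> I; par i = 1\<rbrakk> \<Longrightarrow> basis_vec i \<star> (basis_vec i \<star> basis_vec i) = 0"
  shows "lie_superalgebra M"
proof -
  interpret M: bilinear_algebra M by (rule sc_bilinear_algebra)
  have all_good: "good i x" if x: "x \<in> P i" for i x
    using fin x
  proof (induction rule: sc_part_induct)
    case (unit a)
    obtain j where j: "good j (basis_vec a)" using good_gspan[OF G span[OF unit(1)]] by blast
    then have "basis_vec a \<in> P j" by (simp add: good_def)
    then have "par a = j" by (auto simp: sc_simps fun_ops basis_vec_def)
    with j unit show ?case by simp
  qed (auto intro: good_zero good_add good_scale)
  have jac: "x \<star> (y \<star> z) = (x \<star> y) \<star> z + ssgn i j (y \<star> (x \<star> z))" if "x \<in> P i" "y \<in> P j" "z \<in> P k" for x y z i j k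
    using goodD[OF all_good[OF that(1)] that(2,3)] .
  \<comment> \<open>Polarization: the part of \<open>[x + y, [x + y, x + y]]\<close> that is
    quadratic in \<open>x\<close> and linear in \<open>y\<close> vanishes by the Jacobi identity
    alone. Hence the cube is additive on odd vectors, and the axiom specific to characteristic 3 has
    to be tested on basis vectors only.\<close>
  have mixed: "x \<star> (x \<star> y) + x \<star> (y \<star> x) + y \<star> (x \<star> x) = 0" if x: "x \<in> P 1" and y: "y \<in> P 1" for x y
  proof -
    have "x \<star> y = y \<star> x" using mult_antisym[OF x y] by (simp add: ssgn_simps)
    moreover have "y \<star> (x \<star> x) = - ((x \<star> x) \<star> y)"
      using mult_antisym[OF y mult_part[OF x x]] by (simp add: ssgn_simps)
    moreover have "x \<star> (x \<star> y) = (x \<star> x) \<star> y - x \<star> (x \<star> y)"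
      using jac[OF x x y] by (simp add: ssgn_simps)
    ultimately show ?thesis by (metis add.commute add.right_inverse diff_add_cancel)
  qed
  have odd_cube: "x \<star> (x \<star> x) = 0" if x: "x \<in> P 1" for x
    using fin x
  proof (induction rule: sc_part_induct)
    case (add x y)
    have "(x + y) \<star> ((x + y) \<star> (x + y)) = x \<star> (x \<star> x) + y \<star> (y \<star> y)
       + (x \<star> (x \<star> y) + x \<star> (y \<star> x) + y \<star> (x \<star> x)) + (y \<star> (y \<star> x) + y \<star> (x \<star> y) + x \<star> (y \<star> y))"
      by (simp add: sc_mult_linear algebra_simps)
    also have "\<dots> = 0" using add mixed[OF add(1,2)] mixed[OF add(2,1)] by simp
    finally show ?case .
  qed (auto simp: sc_mult_linear scale_simps cube)
  show ?thesis
  proof (intro lie_superalgebra.intro lie_superalgebra_axioms.intro M.vectorspace_axioms)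
    fix i
    show "VectorSpace.subspace class_ring (part M i) M"
      by (rule M.subspaceI)
        (auto simp: sc_simps(3-5) zero_part simp del: sc_simps(6) intro: sc_part_closed dest: sc_part_carrier)
  next
    show "part M 0 \<inter> part M 1 = {\<zero>\<^bsub>M\<^esub>}" by (fastforce simp: sc_simps fun_ops fun_eq_iff fun_ops)
  next
    show "carrier M = part M 0 <+>\<^bsub>M\<^esub> part M 1"
    proof (intro equalityI subsetI)
      fix v assume v: "v \<in> carrier M"
      have bit: "par i \<noteq> 0 \<longleftrightarrow> par i = 1" for i by (cases "par i") auto
      have "v = (\<lambda>i. if par i = 0 then v i else 0) + (\<lambda>i. if par i = 1 then v i else 0)"
        by (auto simp: fun_eq_iff fun_ops bit)
      moreover have "(\<lambda>i. if par i = 0 then v i else 0) \<in> part M 0" "(\<lambda>i. if par i = 1 then v i else 0) \<in> part M 1"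
        using v by (auto simp: sc_simps fun_ops)
      ultimately show "v \<in> part M 0 <+>\<^bsub>M\<^esub> part M 1" unfolding set_add_def' sc_simps(4) by blast
    next
      fix v assume "v \<in> part M 0 <+>\<^bsub>M\<^esub> part M 1"
      then obtain a b where "a \<in> part M 0" "b \<in> part M 1" "v = a \<oplus>\<^bsub>M\<^esub> b" by (auto simp: set_add_def')
      then show "v \<in> carrier M" using M.a_closed sc_part_carrier by metis
    qed
  next
    fix x y i j assume xy: "x \<in> part M i" "y \<in> part M j"
    show "x \<otimes>\<^bsub>M\<^esub> y \<in> part M (i + j)" using mult_part[OF xy] by (simp add: sc_simps(2))
    have "y \<star> x \<in> carrier M" using mult_part[OF xy(2,1)] by (rule sc_part_carrier)
    then have "ssgn i j (y \<star> x) \<in> carrier M" by (auto simp: ssgn_def sc_simps fun_ops)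
    then show "x \<otimes>\<^bsub>M\<^esub> y = \<ominus>\<^bsub>M\<^esub> (koszul i j \<odot>\<^bsub>M\<^esub> (y \<otimes>\<^bsub>M\<^esub> x))"
      using mult_antisym[OF xy] by (simp add: sc_simps(2,5) scale_koszul sc_uminus)
  next
    fix x y z i j k assume xyz: "x \<in> part M i" "y \<in> part M j" "z \<in> part M k"
    show "x \<otimes>\<^bsub>M\<^esub> (y \<otimes>\<^bsub>M\<^esub> z) = (x \<otimes>\<^bsub>M\<^esub> y) \<otimes>\<^bsub>M\<^esub> z \<oplus>\<^bsub>M\<^esub> koszul i j \<odot>\<^bsub>M\<^esub> (y \<otimes>\<^bsub>M\<^esub> (x \<otimes>\<^bsub>M\<^esub> z))"
      using jac[OF xyz] by (simp add: sc_simps(2,4,5) scale_koszul)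
  next
    fix x assume "x \<in> part M 1"
    then show "x \<otimes>\<^bsub>M\<^esub> (x \<otimes>\<^bsub>M\<^esub> x) = \<zero>\<^bsub>M\<^esub>" using odd_cube by (simp add: sc_simps(2,3))
  qed (simp_all add: M.mult_add_left M.mult_add_right M.mult_smult_left M.mult_smult_right)
qed

end

section \<open>Recognizing contragredient superalgebras\<close>

definition lie_iso :: "('k::field, 'v, 'm) superalgebra_scheme \<Rightarrow> ('k, 'w, 'n) superalgebra_scheme \<Rightarrow> ('v \<Rightarrow> 'w) \<Rightarrow> bool" where
  "lie_iso L M \<phi> \<longleftrightarrow> linear_map class_ring L M \<phi> \<and> bij_betw \<phi> (carrier L) (carrier M) \<and>
     (\<forall>x\<in>carrier L. \<forall>y\<in>carrier L. \<phi> (x \<otimes>\<^bsub>L\<^esub> y) = \<phi> x \<otimes>\<^bsub>M\<^esub> \<phi> y) \<and> (\<forall>i. \<phi> ` part L i = part M i)"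

text \<open>The locale locates brackets of homogeneous elements; closure of the whole carrier
  follows by splitting both factors into even and odd parts.\<close>

lemma lie_superalgebra_bilinear: "lie_superalgebra M \<Longrightarrow> bilinear_algebra M"
proof -
  assume "lie_superalgebra M"
  then interpret lie_superalgebra M .
  have part: "x \<in> part M i \<Longrightarrow> x \<in> carrier M" for x i
    using part_subspace[of i] by (auto simp: VectorSpace.subspace_def submodule_def)
  have closed: "x \<otimes>\<^bsub>M\<^esub> y \<in> carrier M" if x: "x \<in> carrier M" and y: "y \<in> carrier M" for x y
  proof -
    from x obtain x0 x1 where x: "x0 \<in> part M 0" "x1 \<in> part M 1" "x = x0 \<oplus>\<^bsub>M\<^esub> x1"
      using part_sum by (auto simp: set_add_def')
    from y obtain y0 y1 where y: "y0 \<in> part M 0" "y1 \<in> part M 1" "y = y0 \<oplus>\<^bsub>M\<^esub> y1"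
      using part_sum by (auto simp: set_add_def')
    note p = bracket_part[OF x(1) y(1), THEN part] bracket_part[OF x(1) y(2), THEN part]
      bracket_part[OF x(2) y(1), THEN part] bracket_part[OF x(2) y(2), THEN part]
    show ?thesis using x y p by (simp add: bracket_add_left bracket_add_right part)
  qed
  show ?thesis
    by (intro bilinear_algebra.intro bilinear_algebra_axioms.intro class_vectorspace.intro vectorspace_axioms closed
        bracket_add_left bracket_add_right bracket_smult_left bracket_smult_right)
qed

text \<open>Each axiom for \<open>L\<close> is an equation or a membership, which can be tested
  after applying the injective map \<open>\<phi>\<close>.\<close>

lemma lie_superalgebra_iso:
  assumes M: "lie_superalgebra M" and L: "bilinear_algebra L" and iso: "lie_iso L M \<phi>"
    and part_carrier: "\<And>i. part L i \<subseteq> carrier L"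
  shows "lie_superalgebra L"
proof -
  interpret M: lie_superalgebra M by (rule M)
  interpret L: bilinear_algebra L by (rule L)
  interpret MB: bilinear_algebra M by (rule lie_superalgebra_bilinear[OF M])
  interpret phi: linear_map class_ring L M \<phi> using iso by (simp add: lie_iso_def)
  have bij: "bij_betw \<phi> (carrier L) (carrier M)" and part: "\<phi> ` part L i = part M i" for i
    using iso by (auto simp: lie_iso_def)
  have mult: "\<phi> (x \<otimes>\<^bsub>L\<^esub> y) = \<phi> x \<otimes>\<^bsub>M\<^esub> \<phi> y" if "x \<in> carrier L" "y \<in> carrier L" for x y
    using iso that by (auto simp: lie_iso_def)
  have eqI: "x = y" if "\<phi> x = \<phi> y" "x \<in> carrier L" "y \<in> carrier L" for x y
    using bij that by (auto simp: bij_betw_def inj_on_def)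
  have smult: "\<phi> (a \<odot>\<^bsub>L\<^esub> x) = a \<odot>\<^bsub>M\<^esub> \<phi> x" if "x \<in> carrier L" for a x
    using that by (intro phi.T_smult) auto
  have pc: "x \<in> carrier L" if "x \<in> part L i" for x i using part_carrier that by blast
  have partI: "x \<in> part L i" if "\<phi> x \<in> part M i" "x \<in> carrier L" for x i
  proof -
    have "\<phi> x \<in> \<phi> ` part L i" using that(1) part[of i] by simp
    then obtain y where "y \<in> part L i" "\<phi> x = \<phi> y" by (elim imageE)
    then show ?thesis using eqI[of y x] pc[of y i] that(2) by simp
  qed
  have partD: "\<phi> x \<in> part M i" if "x \<in> part L i" for x i using part that by blast
  have subM: "submodule class_ring (part M i) M" for i
    using M.part_subspace[of i] by (simp add: VectorSpace.subspace_def)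
  have zero: "\<phi> \<zero>\<^bsub>L\<^esub> = \<zero>\<^bsub>M\<^esub>" by simp
  show ?thesis
  proof (intro lie_superalgebra.intro lie_superalgebra_axioms.intro L.vectorspace_axioms)
    fix i
    show "VectorSpace.subspace class_ring (part L i) L"
    proof (rule L.subspaceI)
      show "\<zero>\<^bsub>L\<^esub> \<in> part L i" using submodule.zero_closed[OF subM] by (intro partI) auto
      show "x \<oplus>\<^bsub>L\<^esub> y \<in> part L i" if "x \<in> part L i" "y \<in> part L i" for x y
        using submodule.m_closed[OF subM partD[OF that(1)] partD[OF that(2)]] that pc by (intro partI) auto
      show "a \<odot>\<^bsub>L\<^esub> x \<in> part L i" if "x \<in> part L i" for a x
        using submodule.smult_closed[OF subM _ partD[OF that], of a] that pc by (intro partI) (auto simp: smult L.smult_carrier)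
    qed (rule part_carrier)
  next
    show "part L 0 \<inter> part L 1 = {\<zero>\<^bsub>L\<^esub>}"
    proof (intro equalityI subsetI)
      fix x assume x: "x \<in> part L 0 \<inter> part L 1"
      then have "\<phi> x \<in> {\<zero>\<^bsub>M\<^esub>}" using partD M.part_Int by blast
      then show "x \<in> {\<zero>\<^bsub>L\<^esub>}" using eqI[of x "\<zero>\<^bsub>L\<^esub>"] x pc by auto
    next
      fix x assume "x \<in> {\<zero>\<^bsub>L\<^esub>}"
      then show "x \<in> part L 0 \<inter> part L 1" using submodule.zero_closed[OF subM] by (auto intro!: partI)
    qed
  next
    show "carrier L = part L 0 <+>\<^bsub>L\<^esub> part L 1"
    proof (intro equalityI subsetI)
      fix x assume x: "x \<in> carrier L"
      then have "\<phi> x \<in> part M 0 <+>\<^bsub>M\<^esub> part M 1" using M.part_sum phi.T_im by blast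
      then obtain a b where ab: "a \<in> part M 0" "b \<in> part M 1" "\<phi> x = a \<oplus>\<^bsub>M\<^esub> b" by (auto simp: set_add_def')
      then obtain a' b' where ab': "a' \<in> part L 0" "b' \<in> part L 1" "a = \<phi> a'" "b = \<phi> b'"
        unfolding part[symmetric] by (auto elim!: imageE)
      then have "x = a' \<oplus>\<^bsub>L\<^esub> b'" using ab x pc by (intro eqI) auto
      then show "x \<in> part L 0 <+>\<^bsub>L\<^esub> part L 1" using ab' by (auto simp: set_add_def')
    next
      fix x assume "x \<in> part L 0 <+>\<^bsub>L\<^esub> part L 1"
      then obtain a b where "a \<in> part L 0" "b \<in> part L 1" "x = a \<oplus>\<^bsub>L\<^esub> b" by (auto simp: set_add_def')
      then show "x \<in> carrier L" using pc by auto
    qed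
  next
    fix x y i j assume xy: "x \<in> part L i" "y \<in> part L j"
    show "x \<otimes>\<^bsub>L\<^esub> y \<in> part L (i + j)"
      using M.bracket_part[OF partD[OF xy(1)] partD[OF xy(2)]] xy pc by (intro partI) (auto simp: mult L.mult_closed)
    show "x \<otimes>\<^bsub>L\<^esub> y = \<ominus>\<^bsub>L\<^esub> (koszul i j \<odot>\<^bsub>L\<^esub> (y \<otimes>\<^bsub>L\<^esub> x))"
      using M.antisymmetry[OF partD[OF xy(1)] partD[OF xy(2)]] xy[THEN pc]
      by (intro eqI) (simp_all add: mult smult L.mult_closed L.smult_carrier)
  next
    fix x y z i j k assume xyz: "x \<in> part L i" "y \<in> part L j" "z \<in> part L k"
    show "x \<otimes>\<^bsub>L\<^esub> (y \<otimes>\<^bsub>L\<^esub> z) = (x \<otimes>\<^bsub>L\<^esub> y) \<otimes>\<^bsub>L\<^esub> z \<oplus>\<^bsub>L\<^esub> koszul i j \<odot>\<^bsub>L\<^esub> (y \<otimes>\<^bsub>L\<^esub> (x \<otimes>\<^bsub>L\<^esub> z))"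
      using M.jacobi[OF xyz(1)[THEN partD] xyz(2)[THEN partD] xyz(3)[THEN partD]] xyz[THEN pc]
      by (intro eqI) (simp_all add: mult smult L.mult_closed L.smult_carrier)
  next
    fix x assume x: "x \<in> part L 1"
    show "x \<otimes>\<^bsub>L\<^esub> (x \<otimes>\<^bsub>L\<^esub> x) = \<zero>\<^bsub>L\<^esub>"
      using M.odd_cube[OF partD[OF x]] pc[OF x] by (intro eqI) (simp_all add: mult L.mult_closed)
  qed (simp_all add: L.mult_add_left L.mult_add_right L.mult_smult_left L.mult_smult_right)
qed

text \<open>An intermediate step must end in a nonzero multiple of a single basis vector, so that
  the chain can be continued. Only the last bracket, which lands in degree 0, may be an arbitrary
  nonzero vector.\<close>

inductive_set descent :: "'i set \<Rightarrow> ('i \<Rightarrow> 'i \<Rightarrow> 'i \<Rightarrow> 'k::field) \<Rightarrow> 'i set \<Rightarrow> ('i \<Rightarrow> 'd::ab_group_add) \<Rightarrow> 'i set"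
  for I c G deg where
  descent_base: "\<lbrakk>g \<in> G; i \<in> I; sc_mult I c (basis_vec g) (basis_vec i) \<noteq> 0; deg g + deg i = 0\<rbrakk> \<Longrightarrow> i \<in> descent I c G deg"
| descent_step: "\<lbrakk>g \<in> G; i \<in> I; a \<noteq> 0; sc_mult I c (basis_vec g) (basis_vec i) = scale a (basis_vec k);
    k \<in> descent I c G deg\<rbrakk> \<Longrightarrow> i \<in> descent I c G deg"

text \<open>Homogeneity of brackets is asked for only when the first factor is a generator or has
  degree 0, which keeps the table check small; \<open>ev_Gd\<close> recovers what is needed beyond
  that. The map \<open>\<eta>\<close> places the abstract Cartan space inside the model.\<close>

locale contragredient_model = contragredient_presentation n par R
  for n par and R :: "('k::field, 'h) realization" +
  fixes I :: "'i set" and pm :: "'i \<Rightarrow> bit" and c :: "'i \<Rightarrow> 'i \<Rightarrow> 'i \<Rightarrow> 'k" and e f :: "nat \<Rightarrow> 'i"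
    and deg :: "'i \<Rightarrow> (nat \<Rightarrow>\<^sub>0 int)" and \<eta> :: "'h \<Rightarrow> 'i \<Rightarrow> 'k"
  assumes fin: "finite I" and lie: "lie_superalgebra (sc_algebra I pm c)"
    and e_mem: "m < n \<Longrightarrow> e m \<in> I \<and> pm (e m) = par m \<and> deg (e m) = Poly_Mapping.single m 1"
    and f_mem: "m < n \<Longrightarrow> f m \<in> I \<and> pm (f m) = par m \<and> deg (f m) = Poly_Mapping.single m (- 1)"
    and graded: "\<lbrakk>i \<in> I; j \<in> I; k \<in> I; c i j k \<noteq> 0; i \<in> e ` {..<n} \<union> f ` {..<n} \<or> deg i = 0\<rbrakk> \<Longrightarrow> deg k = deg i + deg j"
    and deg_inj: "\<lbrakk>i \<in> I; k \<in> I; deg i = deg k; deg i \<noteq> 0\<rbrakk> \<Longrightarrow> i = k"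
    and generated: "i \<in> I \<Longrightarrow> basis_vec i \<in> gspan I pm c (e ` {..<n} \<union> f ` {..<n})"
    and descends: "\<lbrakk>i \<in> I; deg i \<noteq> 0\<rbrakk> \<Longrightarrow> i \<in> descent I c (e ` {..<n} \<union> f ` {..<n}) deg"
    and eta_mem: "h \<in> carrier R \<Longrightarrow> \<eta> h \<in> part (sc_algebra I pm c) 0 \<and> (\<forall>i. \<eta> h i \<noteq> 0 \<longrightarrow> deg i = 0)"
    and eta_linear: "\<lbrakk>h \<in> carrier R; h' \<in> carrier R\<rbrakk> \<Longrightarrow> \<eta> (a \<odot>\<^bsub>R\<^esub> h \<oplus>\<^bsub>R\<^esub> h') = scale a (\<eta> h) + \<eta> h'"
    and eta_inj: "\<lbrakk>h \<in> carrier R; \<eta> h = 0\<rbrakk> \<Longrightarrow> h = \<zero>\<^bsub>R\<^esub>"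
    and EF: "\<lbrakk>l < n; m < n\<rbrakk> \<Longrightarrow> sc_mult I c (basis_vec (e l)) (basis_vec (f m)) = (if l = m then \<eta> (coroot R l) else 0)"
    and HE: "\<lbrakk>h \<in> carrier R; m < n\<rbrakk> \<Longrightarrow> sc_mult I c (\<eta> h) (basis_vec (e m)) = scale (root R m h) (basis_vec (e m))"
    and HF: "\<lbrakk>h \<in> carrier R; m < n\<rbrakk> \<Longrightarrow> sc_mult I c (\<eta> h) (basis_vec (f m)) = - scale (root R m h) (basis_vec (f m))"
    and HH: "\<lbrakk>h \<in> carrier R; h' \<in> carrier R\<rbrakk> \<Longrightarrow> sc_mult I c (\<eta> h) (\<eta> h') = 0"
begin

abbreviation "M \<equiv> sc_algebra I pm c"
abbreviation B (infixl "\<star>" 70) where "B \<equiv> sc_mult I c"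
abbreviation "P \<equiv> part M"
abbreviation "G \<equiv> e ` {..<n} \<union> f ` {..<n}"

sublocale M: lie_superalgebra M by (rule lie)

lemma MB: "bilinear_algebra M" by (rule sc_bilinear_algebra)

lemma mult_part: "x \<in> P i \<Longrightarrow> y \<in> P j \<Longrightarrow> x \<star> y \<in> P (i + j)"
  using M.bracket_part[of x i y j] by (simp add: sc_simps(2))

lemma mult_antisym: assumes "x \<in> P i" "y \<in> P j" shows "x \<star> y = - ssgn i j (y \<star> x)"
proof -
  have "ssgn i j (y \<star> x) \<in> carrier M" using mult_part[OF assms(2,1)] by (auto intro: sc_part_closed sc_part_carrier)
  then show ?thesis using M.antisymmetry[OF assms] by (simp add: sc_simps(2,5) scale_koszul sc_uminus)
qed

lemma mult_jacobi: assumes "x \<in> P i" "y \<in> P j" "z \<in> P k" 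
  shows "x \<star> (y \<star> z) = (x \<star> y) \<star> z + ssgn i j (y \<star> (x \<star> z))"
  using M.jacobi[OF assms] by (simp add: sc_simps(2,4,5) scale_koszul)

lemma mult_cube: assumes "x \<in> P 1" shows "x \<star> (x \<star> x) = 0"
  using M.odd_cube[OF assms] by (simp add: sc_simps(2,3))

section \<open>Evaluation of the free superalgebra in the model; the defining relations evaluate to
  zero\<close>

fun ev_gen :: "'h chevalley \<Rightarrow> 'i \<Rightarrow> 'k" where
  "ev_gen (CartanGen h) = \<eta> h"
| "ev_gen (EGen m) = basis_vec (e m)"
| "ev_gen (FGen m) = basis_vec (f m)"

primrec ev :: "'h chevalley magma \<Rightarrow> 'i \<Rightarrow> 'k" where
  "ev (Gen g) = ev_gen g"
| "ev (Br u v) = ev u \<star> ev v"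

definition Phi :: "('h chevalley magma \<Rightarrow>\<^sub>0 'k) \<Rightarrow> 'i \<Rightarrow> 'k" where
  "Phi p = (\<Sum>w\<in>Poly_Mapping.keys p. scale (Poly_Mapping.lookup p w) (ev w))"

lemma Phi_superset: 
  assumes "finite A" "Poly_Mapping.keys p \<subseteq> A"
  shows "Phi p = (\<Sum>w\<in>A. scale (Poly_Mapping.lookup p w) (ev w))"
  unfolding Phi_def using assms
  by (intro sum.mono_neutral_left) (auto simp: in_keys_iff scale_simps)

lemma Phi_add: "Phi (p + q) = Phi p + Phi q"
proof -
  let ?A = "Poly_Mapping.keys p \<union> Poly_Mapping.keys q"
  show ?thesis using keys_add[of p q]
    by (simp add: Phi_superset[of ?A] lookup_add scale_simps sum.distrib)
qed

lemma scale_sum: "scale a (\<Sum>x\<in>A. g x) = (\<Sum>x\<in>A. scale a (g x))"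
  by (induction A rule: infinite_finite_induct) (simp_all add: scale_simps)

lemma Phi_smult: "Phi (Poly_Mapping.map ((*) a) p) = scale a (Phi p)"
  using keys_smult[of a p]
  by (simp add: Phi_superset[of "Poly_Mapping.keys p"] lookup_smult scale_sum scale_simps)

lemma Phi_zero: "Phi 0 = 0" by (simp add: Phi_def)

lemma Phi_uminus: "Phi (- p) = - Phi p"
  using Phi_add[of p "- p"] by (simp add: Phi_zero eq_neg_iff_add_eq_0 add.commute)

lemma Phi_minus: "Phi (p - q) = Phi p - Phi q"
  using Phi_add[of p "- q"] by (simp add: Phi_uminus)

lemma Phi_single: "Phi (Poly_Mapping.single w a) = scale a (ev w)"
  by (simp add: Phi_superset[of "{w}"])

lemma Phi_sum: "Phi (\<Sum>x\<in>A. g x) = (\<Sum>x\<in>A. Phi (g x))"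
  by (induction A rule: infinite_finite_induct) (simp_all add: Phi_add Phi_zero)

lemma Phi_mult: "Phi (x \<otimes>\<^bsub>T\<^esub> y) = Phi x \<star> Phi y"
proof -
  have "x \<otimes>\<^bsub>T\<^esub> y = (\<Sum>u\<in>Poly_Mapping.keys x. \<Sum>v\<in>Poly_Mapping.keys y.
     Poly_Mapping.single (Br u v) (Poly_Mapping.lookup x u * Poly_Mapping.lookup y v))"
    by (simp add: free_contragredient_def free_mult[of "Poly_Mapping.keys x" _ "Poly_Mapping.keys y"])
  then show ?thesis
    by (simp add: Phi_sum Phi_single, simp only: Phi_def sc_mult_sum_left, simp only: sc_mult_sum_right)
      (simp add: sc_mult_linear scale_simps mult.commute)
qed

lemma ev_gen_part: "g \<in> X \<Longrightarrow> ev_gen g \<in> P (gen_parity par g)"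
  using e_mem f_mem eta_mem basis_vec_part[of _ I pm c] by (fastforce simp: generators_def)

lemma ev_part: "set_magma w \<subseteq> X \<Longrightarrow> ev w \<in> P (weight (gen_parity par) w)"
proof (induction w)
  case (Br u v)
  then show ?case using mult_part[of "ev u" _ "ev v"] by auto
qed (simp add: ev_gen_part)

lemma P_sum: "(\<And>x. x \<in> A \<Longrightarrow> g x \<in> P i) \<Longrightarrow> (\<Sum>x\<in>A. g x) \<in> P i"
  by (induction A rule: infinite_finite_induct) (auto simp: zero_part intro: sc_part_closed)

lemma Phi_part: "x \<in> part T i \<Longrightarrow> Phi x \<in> P i"
  unfolding Phi_def using ev_part by (intro P_sum sc_part_closed) (auto simp: T_simps weight_space_def)

lemma carrier_M_closed: "v \<in> carrier M \<Longrightarrow> w \<in> carrier M \<Longrightarrow> v + w \<in> carrier M"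
  "v \<in> carrier M \<Longrightarrow> scale a v \<in> carrier M" "0 \<in> carrier M"
  by (auto simp: sc_simps fun_ops scale_def)

lemma Phi_carrier: "x \<in> C \<Longrightarrow> Phi x \<in> carrier M"
proof -
  have "(\<Sum>w\<in>A. scale (Poly_Mapping.lookup x w) (ev w)) \<in> carrier M" if "\<And>w. w \<in> A \<Longrightarrow> set_magma w \<subseteq> X" for A
    using that
    by (induction A rule: infinite_finite_induct) 
      (auto intro!: carrier_M_closed intro: sc_part_carrier ev_part)
  then show "x \<in> C \<Longrightarrow> Phi x \<in> carrier M" unfolding Phi_def by (auto simp: T_carrier)
qed

lemma kernel_ideal: "alg_ideal T {x \<in> C. Phi x = 0}"
proof (rule T.alg_idealI)
  show "\<zero>\<^bsub>T\<^esub> \<in> {x \<in> C. Phi x = 0}" using C_zero by (simp add: T_simps Phi_zero)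
  fix x y assume x: "x \<in> {x \<in> C. Phi x = 0}" 
  show "x \<oplus>\<^bsub>T\<^esub> y \<in> {x \<in> C. Phi x = 0}" if "y \<in> {x \<in> C. Phi x = 0}"
    using x that C_add by (simp add: T_simps Phi_add)
  show "a \<odot>\<^bsub>T\<^esub> x \<in> {x \<in> C. Phi x = 0}" for a
    using x C_smult by (simp add: T_simps Phi_smult scale_simps)
next
  fix x y assume "x \<in> C" "y \<in> {x \<in> C. Phi x = 0}" 
  then show "x \<otimes>\<^bsub>T\<^esub> y \<in> {x \<in> C. Phi x = 0}" "y \<otimes>\<^bsub>T\<^esub> x \<in> {x \<in> C. Phi x = 0}"
    by (auto simp: T.mult_closed Phi_mult sc_mult_linear)
qed auto

lemma Phi_lie_relations: "x \<in> lie_relations T \<Longrightarrow> Phi x = 0"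
  unfolding lie_relations_def
proof (elim UnE CollectE exE conjE)
  fix i j x' y assume *: "x = x' \<otimes>\<^bsub>T\<^esub> y \<oplus>\<^bsub>T\<^esub> koszul i j \<odot>\<^bsub>T\<^esub> (y \<otimes>\<^bsub>T\<^esub> x')" and p: "x' \<in> part T i" "y \<in> part T j"
  have "Phi x = Phi x' \<star> Phi y + scale (koszul i j) (Phi y \<star> Phi x')"
    unfolding * T_simps(1,3) Phi_add Phi_smult Phi_mult ..
  then show "Phi x = 0" using mult_antisym[OF p[THEN Phi_part]] by (simp add: scale_koszul)
next
  fix i j k x' y z
  assume *: "x = x' \<otimes>\<^bsub>T\<^esub> (y \<otimes>\<^bsub>T\<^esub> z) \<ominus>\<^bsub>T\<^esub> ((x' \<otimes>\<^bsub>T\<^esub> y) \<otimes>\<^bsub>T\<^esub> z \<oplus>\<^bsub>T\<^esub> koszul i j \<odot>\<^bsub>T\<^esub> (y \<otimes>\<^bsub>T\<^esub> (x' \<otimes>\<^bsub>T\<^esub> z)))"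
    and p: "x' \<in> part T i" "y \<in> part T j" "z \<in> part T k"
  have "(x' \<otimes>\<^bsub>T\<^esub> y) \<otimes>\<^bsub>T\<^esub> z \<oplus>\<^bsub>T\<^esub> koszul i j \<odot>\<^bsub>T\<^esub> (y \<otimes>\<^bsub>T\<^esub> (x' \<otimes>\<^bsub>T\<^esub> z)) \<in> C"
    using p[THEN part_carrier] by (intro T.a_closed T.smult_carrier T.mult_closed)
  then have "Phi x = Phi x' \<star> (Phi y \<star> Phi z) - ((Phi x' \<star> Phi y) \<star> Phi z + scale (koszul i j) (Phi y \<star> (Phi x' \<star> Phi z)))"
    unfolding * by (simp add: T_minus Phi_minus) (simp add: T_simps(1,3) Phi_add Phi_smult Phi_mult)
  then show "Phi x = 0" using mult_jacobi[OF p[THEN Phi_part]] by (simp add: scale_koszul)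
next
  fix x' assume "x = x' \<otimes>\<^bsub>T\<^esub> (x' \<otimes>\<^bsub>T\<^esub> x')" "x' \<in> part T 1"
  then show "Phi x = 0" using mult_cube[OF Phi_part] by (simp add: Phi_mult)
qed

lemma Phi_gen: "Phi (gen g) = ev_gen g"
  by (simp add: gen_def Phi_single scale_simps)

lemma Phi_chevalley_relations: "x \<in> chevalley_relations n par R \<Longrightarrow> Phi x = 0"
proof -
  have m: "Phi (x \<ominus>\<^bsub>T\<^esub> y) = Phi x - Phi y" if "y \<in> C" for x y
    using that by (simp add: T_minus Phi_minus)
  have a: "Phi (x \<oplus>\<^bsub>T\<^esub> y) = Phi x + Phi y" "Phi (s \<odot>\<^bsub>T\<^esub> x) = scale s (Phi x)" "Phi \<zero>\<^bsub>T\<^esub> = 0" for x y s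
    by (simp_all add: T_simps Phi_add Phi_smult Phi_zero)
  have g: "gen (EGen i) \<in> C" "gen (FGen i) \<in> C" if "i < n" for i
    using that by (auto intro: gen_carrier gen_mem)
  have g': "gen (CartanGen h) \<in> C" if "h \<in> carrier R" for h
    using that by (auto intro: gen_carrier gen_mem)
  assume "x \<in> chevalley_relations n par R"
  then show "Phi x = 0"
    unfolding chevalley_relations_def Let_def
  proof (elim UnE CollectE exE conjE)
    fix s h h'
    assume x: "x = gen (CartanGen (s \<odot>\<^bsub>R\<^esub> h \<oplus>\<^bsub>R\<^esub> h')) \<ominus>\<^bsub>T\<^esub> (s \<odot>\<^bsub>T\<^esub> gen (CartanGen h) \<oplus>\<^bsub>T\<^esub> gen (CartanGen h'))"
      and h: "h \<in> carrier R" "h' \<in> carrier R"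
    have "s \<odot>\<^bsub>T\<^esub> gen (CartanGen h) \<oplus>\<^bsub>T\<^esub> gen (CartanGen h') \<in> C" using h g' by (intro T.a_closed T.smult_carrier)
    then show "Phi x = 0" unfolding x using h by (simp add: m a Phi_gen eta_linear)
  next
    fix i j
    assume x: "x = gen (EGen i) \<otimes>\<^bsub>T\<^esub> gen (FGen j) \<ominus>\<^bsub>T\<^esub> (if i = j then gen (CartanGen (coroot R i)) else \<zero>\<^bsub>T\<^esub>)"
      and ij: "i < n" "j < n"
    have "(if i = j then gen (CartanGen (coroot R i)) else \<zero>\<^bsub>T\<^esub>) \<in> C" using ij g' coroot_carrier by simp
    then show "Phi x = 0" unfolding x using ij by (simp add: m a Phi_gen EF Phi_mult)
  next
    fix h j assume x: "x = gen (CartanGen h) \<otimes>\<^bsub>T\<^esub> gen (EGen j) \<ominus>\<^bsub>T\<^esub> root R j h \<odot>\<^bsub>T\<^esub> gen (EGen j)" and h: "h \<in> carrier R" "j < n"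
    have "root R j h \<odot>\<^bsub>T\<^esub> gen (EGen j) \<in> C" using h g by (intro T.smult_carrier)
    then show "Phi x = 0" unfolding x using h by (simp add: m a Phi_gen HE Phi_mult)
  next
    fix h j assume x: "x = gen (CartanGen h) \<otimes>\<^bsub>T\<^esub> gen (FGen j) \<oplus>\<^bsub>T\<^esub> root R j h \<odot>\<^bsub>T\<^esub> gen (FGen j)" and h: "h \<in> carrier R" "j < n"
    then show "Phi x = 0" unfolding x using h by (simp add: a Phi_gen HF Phi_mult)
  next
    fix h h' assume x: "x = gen (CartanGen h) \<otimes>\<^bsub>T\<^esub> gen (CartanGen h')" and h: "h \<in> carrier R" "h' \<in> carrier R"
    then show "Phi x = 0" by (simp add: Phi_gen HH Phi_mult)
  qed
qed

lemma Phi_J: "x \<in> J \<Longrightarrow> Phi x = 0"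
proof -
  have "J \<subseteq> {x \<in> C. Phi x = 0}"
    unfolding tilde_ideal_def
    using lie_relations_carrier chevalley_relations_carrier Phi_lie_relations Phi_chevalley_relations
    by (intro hull_minimal kernel_ideal) blast
  then show "x \<in> J \<Longrightarrow> Phi x = 0" by blast
qed

section \<open>Compatibility of the evaluation with the root grading\<close>

definition "Gd q = {v \<in> carrier M. \<forall>i. v i \<noteq> 0 \<longrightarrow> deg i = q}"

lemma Gd_closed: "v \<in> Gd q \<Longrightarrow> w \<in> Gd q \<Longrightarrow> v + w \<in> Gd q" "v \<in> Gd q \<Longrightarrow> - v \<in> Gd q" "0 \<in> Gd q"
  "v \<in> Gd q \<Longrightarrow> ssgn i j v \<in> Gd q" "v \<in> Gd q \<Longrightarrow> scale a v \<in> Gd q"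
  by (auto simp: Gd_def sc_simps fun_ops ssgn_def scale_def) (metis add.right_neutral add_0)

lemma Gd_mult:
  assumes v: "v \<in> carrier M" "\<And>i. v i \<noteq> 0 \<Longrightarrow> deg i = p \<and> (i \<in> G \<or> deg i = 0)" and w: "w \<in> Gd q"
  shows "v \<star> w \<in> Gd (p + q)"
  unfolding Gd_def
proof (intro CollectI conjI allI impI)
  show "v \<star> w \<in> carrier M" by (simp add: sc_simps sc_mult_def)
  fix k assume nz: "(v \<star> w) k \<noteq> 0"
  then have k: "k \<in> I" by (auto simp: sc_mult_def split: if_splits)
  then have "(\<Sum>a\<in>I. \<Sum>b\<in>I. v a * w b * c a b k) \<noteq> 0" using nz by (auto simp: sc_mult_def)
  then obtain a where a: "a \<in> I" "(\<Sum>b\<in>I. v a * w b * c a b k) \<noteq> 0" by (meson sum.not_neutral_contains_not_neutral)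
  then obtain b where b: "b \<in> I" "v a * w b * c a b k \<noteq> 0" by (meson sum.not_neutral_contains_not_neutral)
  then show "deg k = p + q" using graded[of a b k] a k v(2)[of a] w by (auto simp: Gd_def)
qed

text \<open>The induction has to carry the statement about left multiplications, because homogeneity
  of the structure constants is known only with a generator in first position. The Jacobi identity
  passes it on to brackets.\<close>

lemma ev_Gd:
  assumes "set_magma w \<subseteq> X"
  shows "ev w \<in> Gd (wt w) \<and> (\<forall>q. \<forall>v\<in>Gd q. ev w \<star> v \<in> Gd (wt w + q))"
  using assms
proof (induction w)
  case (Gen g)
  have nz: "ev_gen g \<in> carrier M \<and> (\<forall>i. ev_gen g i \<noteq> 0 \<longrightarrow> deg i = gen_degree g \<and> (i \<in> G \<or> deg i = 0))"
  proof -
    have "ev_gen g \<in> carrier M" using Gen by (intro sc_part_carrier[OF ev_gen_part]) auto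
    then show ?thesis using Gen e_mem f_mem eta_mem
      by (auto simp: generators_def basis_vec_def split: if_splits)
  qed
  then have "ev_gen g \<in> Gd (gen_degree g)" by (auto simp: Gd_def)
  moreover have "ev_gen g \<star> v \<in> Gd (gen_degree g + q)" if "v \<in> Gd q" for v q
    by (rule Gd_mult[OF _ _ that]) (use nz in blast)+
  ultimately show ?case by simp
next
  case (Br u v)
  then have X: "set_magma u \<subseteq> X" "set_magma v \<subseteq> X"
    and u: "ev u \<in> Gd (wt u)" "\<And>q x. x \<in> Gd q \<Longrightarrow> ev u \<star> x \<in> Gd (wt u + q)"
    and v: "ev v \<in> Gd (wt v)" "\<And>q x. x \<in> Gd q \<Longrightarrow> ev v \<star> x \<in> Gd (wt v + q)" by auto
  let ?i = "weight (gen_parity par) u" and ?j = "weight (gen_parity par) v"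
  have "(ev u \<star> ev v) \<star> x \<in> Gd (wt u + wt v + q)" if x: "x \<in> Gd q" for x q
  proof -
    have hom: "(ev u \<star> ev v) \<star> y = ev u \<star> (ev v \<star> y) - ssgn ?i ?j (ev v \<star> (ev u \<star> y))" if "y \<in> P k" for y k
      using mult_jacobi[OF ev_part[OF X(1)] ev_part[OF X(2)] that] by simp
    \<comment> \<open>A vector homogeneous for the root grading may mix parities, while the Jacobi
      identity speaks of vectors of one parity; so it is applied to the two parts
      separately.\<close>
    obtain y z where yz: "y \<in> P 0" "z \<in> P 1" "x = y + z"
      using x M.part_sum by (auto simp: Gd_def set_add_def' sc_simps(4))
    have "(ev u \<star> ev v) \<star> x = ev u \<star> (ev v \<star> x) - ssgn ?i ?j (ev v \<star> (ev u \<star> x))"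
      using hom[OF yz(1)] hom[OF yz(2)] by (simp add: yz(3) sc_mult_linear ssgn_simps)
    moreover have "ev u \<star> (ev v \<star> x) \<in> Gd (wt u + wt v + q)" using u(2)[OF v(2)[OF x]] by (simp add: add.assoc)
    moreover have "ev v \<star> (ev u \<star> x) \<in> Gd (wt u + wt v + q)" using v(2)[OF u(2)[OF x]] by (simp add: add_ac)
    ultimately show ?thesis using Gd_closed(1)[OF _ Gd_closed(2)[OF Gd_closed(4)]] by simp
  qed
  then show ?case using u(2)[OF v(1)] by simp
qed

lemma Gd_sum: "(\<And>x. x \<in> A \<Longrightarrow> g x \<in> Gd q) \<Longrightarrow> (\<Sum>x\<in>A. g x) \<in> Gd q"
  by (induction A rule: infinite_finite_induct) (auto intro: Gd_closed)

lemma Phi_Gd: "x \<in> weight_space X gen_degree q \<Longrightarrow> Phi x \<in> Gd q"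
  unfolding Phi_def using ev_Gd by (intro Gd_sum Gd_closed) (fastforce simp: weight_space_def)

abbreviation "W \<equiv> weight_space X gen_degree"

lemma W_carrier: "x \<in> W q \<Longrightarrow> x \<in> C" by (auto simp: weight_space_def T_carrier)

lemma W_mult: "g \<in> X \<Longrightarrow> x \<in> W q \<Longrightarrow> gen g \<otimes>\<^bsub>T\<^esub> x \<in> W (gen_degree g + q)"
  using keys_free_mult[of X "gen_parity par" "gen g" x]
  by (fastforce simp: free_contragredient_def weight_space_def gen_def split: if_splits)

lemma G_gen: assumes "g \<in> G"
  obtains g' where "g' \<in> X" "ev_gen g' = basis_vec g" "gen_degree g' = deg g"
proof -
  from assms consider m where "g = e m" "m < n" | m where "g = f m" "m < n" by auto
  then show thesis
  proof cases
    case 1 then show ?thesis using e_mem[of m] gen_mem(1)[of m] by (intro that[of "EGen m"]) auto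
  next
    case 2 then show ?thesis using f_mem[of m] gen_mem(2)[of m] by (intro that[of "FGen m"]) auto
  qed
qed

text \<open>Lifts a descent chain of the model to the free superalgebra. In the application
  \<open>S\<close> is the preimage of an ideal, so the element of degree 0 that is reached still
  represents a member of that ideal.\<close>

lemma descent_vector:
  assumes "i \<in> descent I c G deg" "x \<in> W (deg i)" "Phi x = scale a (basis_vec i)" "a \<noteq> 0"
    and S: "x \<in> S" "\<And>g y. g \<in> X \<Longrightarrow> y \<in> S \<Longrightarrow> gen g \<otimes>\<^bsub>T\<^esub> y \<in> S"
  shows "\<exists>y\<in>S. y \<in> W 0 \<and> Phi y \<noteq> 0"
  using assms(1-5)
proof (induction arbitrary: x a)
  case (descent_base g i)
  obtain g' where g': "g' \<in> X" "ev_gen g' = basis_vec g" "gen_degree g' = deg g"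
    using G_gen[OF descent_base(1)] .
  have "gen g' \<otimes>\<^bsub>T\<^esub> x \<in> W 0" using W_mult[OF g'(1) descent_base(5)] descent_base(4) g'(3) by simp
  moreover have "Phi (gen g' \<otimes>\<^bsub>T\<^esub> x) = scale a (basis_vec g \<star> basis_vec i)"
    using descent_base(6) g'(2) by (simp add: Phi_mult Phi_gen sc_mult_linear)
  moreover have "scale a v \<noteq> 0" if "v \<noteq> 0" for v :: "'i \<Rightarrow> 'k"
    using that descent_base(7) by (auto simp: scale_def fun_eq_iff fun_ops)
  ultimately show ?case using S(2)[OF g'(1) descent_base(8)] descent_base(3) by auto
next
  case (descent_step g i b k)
  obtain g' where g': "g' \<in> X" "ev_gen g' = basis_vec g" "gen_degree g' = deg g"
    using G_gen[OF descent_step(1)] .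
  have g: "g \<in> I" using descent_step(1) e_mem f_mem by auto
  have k: "k \<in> I" using descent_step(5) by (cases) auto
  have "(basis_vec g \<star> basis_vec i) k \<noteq> 0" using descent_step(3,4) by (simp add: scale_def basis_vec_def)
  then have "c g i k \<noteq> 0" using k by (simp add: sc_mult_unit fin g descent_step(2))
  then have deg: "deg k = deg g + deg i" using graded[OF g descent_step(2) k] descent_step(1) by auto
  show ?case
  proof (rule descent_step.IH)
    show "gen g' \<otimes>\<^bsub>T\<^esub> x \<in> W (deg k)" using W_mult[OF g'(1) descent_step(7)] deg g'(3) by simp
    show "Phi (gen g' \<otimes>\<^bsub>T\<^esub> x) = scale (a * b) (basis_vec k)"
      using descent_step(8) descent_step(4) g'(2) by (simp add: Phi_mult Phi_gen sc_mult_linear scale_simps)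
    show "a * b \<noteq> 0" using descent_step by simp
    show "gen g' \<otimes>\<^bsub>T\<^esub> x \<in> S" using S(2)[OF g'(1)] descent_step by blast
  qed
qed

section \<open>The kernel of the evaluation is the largest graded ideal that avoids the Cartan
  subalgebra\<close>

abbreviation "Q \<equiv> contragredient_tilde n par R"
abbreviation cos where "cos x \<equiv> J +>\<^bsub>T\<^esub> x"

lemma Q_eq: "Q = quot_superalgebra T J" by (simp add: contragredient_tilde_def)

sublocale Q: bilinear_algebra Q unfolding Q_eq by (rule tilde.quot.bilinear_algebra_axioms)

lemmas Q_carrier = tilde.quot_carrier[folded Q_eq]
lemmas Q_zero = tilde.quot_zero[folded Q_eq]
lemmas Q_add = tilde.quot_add[folded Q_eq]
lemmas Q_smult = tilde.quot_smult[folded Q_eq]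
lemmas Q_mult = tilde.quot_mult[folded Q_eq]
lemmas Q_part = tilde.quot_part[folded Q_eq]

lemma cos_eq: "\<lbrakk>x \<in> C; y \<in> C\<rbrakk> \<Longrightarrow> cos x = cos y \<longleftrightarrow> x - y \<in> J"
  using tilde.coset_eq_iff[of x y] by (simp add: T_minus)

lemma cos_eq_Phi: "\<lbrakk>x \<in> C; y \<in> C; cos x = cos y\<rbrakk> \<Longrightarrow> Phi x = Phi y"
  using Phi_J[of "x - y"] by (simp add: cos_eq Phi_minus)

lemma cos_carrier: "x \<in> C \<Longrightarrow> cos x \<in> carrier Q" by (simp add: Q_carrier)

definition "K = {cos x | x. x \<in> C \<and> Phi x = 0}"

lemma cos_in_K: assumes x: "x \<in> C" shows "cos x \<in> K \<longleftrightarrow> Phi x = 0"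
proof
  assume "cos x \<in> K"
  then obtain y where y: "cos x = cos y" "y \<in> C" "Phi y = 0" unfolding K_def by blast
  from cos_eq_Phi[OF x y(2,1)] y(3) show "Phi x = 0" by simp
next
  assume "Phi x = 0"
  with x show "cos x \<in> K" unfolding K_def by blast
qed

lemma K_ideal: "alg_ideal Q K"
proof (rule Q.alg_idealI)
  show "K \<subseteq> carrier Q" by (auto simp: K_def cos_carrier)
  show "\<zero>\<^bsub>Q\<^esub> \<in> K" unfolding Q_zero using C_zero by (subst cos_in_K) (auto simp: T_simps Phi_zero)
next
  fix x y assume "x \<in> K" "y \<in> K"
  then obtain x' y' where xy: "x = cos x'" "x' \<in> C" "Phi x' = 0" "y = cos y'" "y' \<in> C" "Phi y' = 0"
    unfolding K_def by blast
  have "cos (x' + y') \<in> K" using xy by (simp add: cos_in_K C_add Phi_add)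
  then show "x \<oplus>\<^bsub>Q\<^esub> y \<in> K" using xy by (simp add: Q_add) (simp add: T_simps)
next
  fix a x assume "x \<in> K"
  then obtain x' where x: "x = cos x'" "x' \<in> C" "Phi x' = 0" unfolding K_def by blast
  have "cos (Poly_Mapping.map ((*) a) x') \<in> K" using x by (simp add: cos_in_K C_smult Phi_smult scale_simps)
  then show "a \<odot>\<^bsub>Q\<^esub> x \<in> K" using x by (simp add: Q_smult) (simp add: T_simps)
next
  fix x y assume "x \<in> carrier Q" "y \<in> K"
  then obtain x' y' where xy: "x = cos x'" "x' \<in> C" "y = cos y'" "y' \<in> C" "Phi y' = 0" by (auto simp: K_def Q_carrier)
  have "cos (x' \<otimes>\<^bsub>T\<^esub> y') \<in> K" "cos (y' \<otimes>\<^bsub>T\<^esub> x') \<in> K"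
    using xy by (auto simp: cos_in_K T.mult_closed Phi_mult sc_mult_linear)
  then show "x \<otimes>\<^bsub>Q\<^esub> y \<in> K" "y \<otimes>\<^bsub>Q\<^esub> x \<in> K" using xy by (auto simp: Q_mult)
qed

lemma subspace_submodule: "VectorSpace.subspace class_ring N V \<Longrightarrow> submodule class_ring N V"
  by (simp add: VectorSpace.subspace_def)

lemma ideal_submodule: "alg_ideal V N \<Longrightarrow> submodule class_ring N V"
  by (simp add: alg_ideal_def subspace_submodule)

lemma root_space_eq: "tilde_root_space n par R q = cos ` W q"
  by (auto simp: tilde_root_space_def tilde_coset_def)

text \<open>The component of degree \<open>q\<close> of \<open>Phi x\<close> is the value of the
  component \<open>xq q\<close> of \<open>x\<close>. So if \<open>x\<close> evaluates to zero, each
  of its homogeneous components does.\<close>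

lemma K_graded: "graded_ideal n par R K"
  unfolding graded_ideal_def
proof (intro conjI K_ideal subsetI)
  let ?S = "\<Union>q. K \<inter> tilde_root_space n par R q"
  have S: "?S \<subseteq> carrier Q" by (auto simp: K_def cos_carrier)
  have sub: "submodule class_ring (Q.span ?S) Q" by (rule Q.span_is_submodule[OF S])
  fix y assume "y \<in> K"
  then obtain x where x: "y = cos x" "x \<in> C" "Phi x = 0" by (auto simp: K_def)
  define xq where "xq q = (\<Sum>w\<in>{w\<in>Poly_Mapping.keys x. wt w = q}. Poly_Mapping.single w (Poly_Mapping.lookup x w))" for q
  have lookup_xq: "Poly_Mapping.lookup (xq q) w = (if wt w = q then Poly_Mapping.lookup x w else 0)" for q w
    by (auto simp: xq_def lookup_sum lookup_single when_def sum.delta in_keys_iff)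
  have xq_W: "xq q \<in> W q" for q
    using x(2) by (auto simp: weight_space_def T_carrier in_keys_iff lookup_xq split: if_splits)
  have "Phi (xq q) = 0" for q
  proof
    fix i
    have sum_app: "(\<Sum>w\<in>A. scale (h w) (g w)) i = (\<Sum>w\<in>A. h w * g w i)" for A :: "'h chevalley magma set" and h :: "_ \<Rightarrow> 'k" and g :: "_ \<Rightarrow> 'i \<Rightarrow> 'k" and i
      by (induction A rule: infinite_finite_induct) (auto simp: fun_ops scale_def)
    have keys: "Poly_Mapping.keys (xq q) \<subseteq> Poly_Mapping.keys x"
      by (auto simp: in_keys_iff lookup_xq split: if_splits)
    have van: "ev w i = 0" if "w \<in> Poly_Mapping.keys x" "wt w \<noteq> deg i" for w
      using ev_Gd[of w] x(2) that by (auto simp: T_carrier Gd_def)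
    have "Phi (xq q) i = (\<Sum>w\<in>Poly_Mapping.keys x. Poly_Mapping.lookup (xq q) w * ev w i)"
      using keys by (simp add: Phi_superset[of "Poly_Mapping.keys x"] sum_app)
    also have "\<dots> = (if deg i = q then \<Sum>w\<in>Poly_Mapping.keys x. Poly_Mapping.lookup x w * ev w i else 0)"
      using van by (auto simp: lookup_xq intro!: sum.cong sum.neutral)
    also have "\<dots> = (if deg i = q then Phi x i else 0)" by (simp add: Phi_def sum_app)
    finally show "Phi (xq q) i = 0 i" using x(3) by (simp add: fun_ops)
  qed
  then have xq_S: "cos (xq q) \<in> Q.span ?S" for q
    using xq_W[of q] by (intro subsetD[OF Q.in_own_span[OF S]]) (auto simp: root_space_eq cos_in_K W_carrier)
  have "x = (\<Sum>q\<in>wt ` Poly_Mapping.keys x. xq q)"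
  proof (rule poly_mapping_eqI)
    fix w
    have "Poly_Mapping.lookup (\<Sum>q\<in>wt ` Poly_Mapping.keys x. xq q) w = (\<Sum>q\<in>wt ` Poly_Mapping.keys x. if q = wt w then Poly_Mapping.lookup x w else 0)"
      by (auto simp: lookup_sum lookup_xq intro!: sum.cong)
    also have "\<dots> = Poly_Mapping.lookup x w" by (auto simp: sum.delta in_keys_iff)
    finally show "Poly_Mapping.lookup x w = Poly_Mapping.lookup (\<Sum>q\<in>wt ` Poly_Mapping.keys x. xq q) w" by simp
  qed
  moreover have "(\<Sum>q\<in>A. xq q) \<in> C \<and> cos (\<Sum>q\<in>A. xq q) \<in> Q.span ?S" if "finite A" for A
    using that
  proof (induction A)
    case empty
    then show ?case using submodule.zero_closed[OF sub] by (simp add: C_zero Q_zero T_simps)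
  next
    case (insert q A)
    have "cos (xq q) \<oplus>\<^bsub>Q\<^esub> cos (\<Sum>q\<in>A. xq q) \<in> Q.span ?S"
      using insert xq_S submodule.m_closed[OF sub] by blast
    then show ?case using insert W_carrier[OF xq_W] by (simp add: Q_add C_add) (simp add: T_simps)
  qed
  ultimately show "y \<in> Q.span ?S" using x(1) by (metis finite_imageI finite_keys)
qed

lemma K_cartan: "K \<inter> tilde_cartan n par R = {\<zero>\<^bsub>Q\<^esub>}"
proof (intro equalityI subsetI)
  fix y assume "y \<in> K \<inter> tilde_cartan n par R"
  then obtain h where h: "h \<in> carrier R" "y = cos (gen (CartanGen h))" "y \<in> K" by (auto simp: tilde_cartan_def tilde_coset_def)
  then have "\<eta> h = 0" using gen_carrier[OF gen_mem(3)[OF h(1)]] by (simp add: cos_in_K Phi_gen)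
  then have "h = \<zero>\<^bsub>R\<^esub>" by (rule eta_inj[OF h(1)])
  then have "gen (CartanGen h) \<in> J" using cartan_zero by (simp add: gen_def)
  then have "y = cos 0" using h(2) J_carrier C_zero by (simp add: cos_eq)
  then show "y \<in> {\<zero>\<^bsub>Q\<^esub>}" by (simp add: Q_zero T_simps)
next
  fix y assume "y \<in> {\<zero>\<^bsub>Q\<^esub>}"
  then have y: "y = cos 0" by (simp add: Q_zero T_simps)
  then have "y \<in> K" using C_zero by (simp add: cos_in_K Phi_zero)
  moreover have "y = cos (gen (CartanGen \<zero>\<^bsub>R\<^esub>))" using y
    using cartan_zero J_uminus[OF cartan_zero] J_carrier C_zero by (auto simp: cos_eq gen_def)
  ultimately show "y \<in> K \<inter> tilde_cartan n par R"
    by (auto simp: tilde_cartan_def tilde_coset_def)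
qed

text \<open>A homogeneous element of \<open>N\<close> with nonzero value could be moved, within
  \<open>N\<close>, to an element of degree 0 with nonzero value. The latter represents an element
  of the Cartan subalgebra, hence is zero by the assumption on \<open>N\<close>, a
  contradiction.\<close>

lemma K_maximal:
  assumes gr: "graded_ideal n par R N" and N0: "N \<inter> tilde_cartan n par R = {\<zero>\<^bsub>Q\<^esub>}"
  shows "N \<subseteq> K"
proof -
  have N: "alg_ideal Q N" and Nspan: "N \<subseteq> Q.span (\<Union>q. N \<inter> tilde_root_space n par R q)"
    using gr by (auto simp: graded_ideal_def)
  have "N \<inter> tilde_root_space n par R q \<subseteq> K" for q
  proof
    fix Y assume Y: "Y \<in> N \<inter> tilde_root_space n par R q"
    then obtain x where x: "x \<in> W q" "Y = cos x" by (auto simp: root_space_eq)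
    let ?S = "{y \<in> C. cos y \<in> N}"
    have xS: "x \<in> ?S" using Y x W_carrier by auto
    have S: "gen g \<otimes>\<^bsub>T\<^esub> y \<in> ?S" if "g \<in> X" "y \<in> ?S" for g y
    proof -
      have "cos (gen g) \<otimes>\<^bsub>Q\<^esub> cos y \<in> N" using N that by (auto simp: alg_ideal_def cos_carrier gen_carrier)
      then show ?thesis using that by (simp add: Q_mult gen_carrier T.mult_closed)
    qed
    have "Phi x = 0"
    proof (rule ccontr)
      assume nz: "Phi x \<noteq> 0"
      have "\<exists>y\<in>?S. y \<in> W 0 \<and> Phi y \<noteq> 0"
      proof (cases "q = 0")
        case True then show ?thesis using x xS nz by blast
      next
        case False
        have G: "Phi x \<in> Gd q" by (rule Phi_Gd[OF x(1)])
        obtain i where i: "Phi x i \<noteq> 0" using nz by (auto simp: fun_eq_iff fun_ops)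
        then have iI: "i \<in> I" "deg i = q" using G by (auto simp: Gd_def sc_simps)
        \<comment> \<open>In nonzero degree the model has at most one basis vector, so a nonzero
          homogeneous value is a multiple of it and the descent can start.\<close>
        have "Phi x = scale (Phi x i) (basis_vec i)"
        proof
          fix j
          have "j = i" if "Phi x j \<noteq> 0"
          proof -
            have "j \<in> I" "deg j = q" using G that by (auto simp: Gd_def sc_simps)
            then show ?thesis using deg_inj[OF iI(1), of j] iI(2) False by simp
          qed
          then show "Phi x j = scale (Phi x i) (basis_vec i) j"
            by (cases "j = i") (auto simp: scale_def basis_vec_def)
        qed
        note eq = this
        show ?thesis
          by (rule descent_vector[OF descends[OF iI(1)] _ eq i xS]) (use iI False x(1) S in auto)
      qed
      then obtain y where y: "y \<in> C" "cos y \<in> N" "y \<in> W 0" "Phi y \<noteq> 0" by blast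
      obtain h where h: "h \<in> carrier R" "y - gen (CartanGen h) \<in> J" using degree_zero_is_cartan[OF y(3)] by blast
      then have "cos y = cos (gen (CartanGen h))" using y(1) by (simp add: cos_eq gen_carrier gen_mem)
      then have "cos y \<in> tilde_cartan n par R" using h by (auto simp: tilde_cartan_def tilde_coset_def)
      then have "cos y = cos 0" using y(2) N0 by (auto simp: Q_zero T_simps)
      then show False using cos_eq_Phi[OF y(1) C_zero] y(4) by (simp add: Phi_zero)
    qed
    then show "Y \<in> K" using x by (simp add: cos_in_K W_carrier)
  qed
  then have "(\<Union>q. N \<inter> tilde_root_space n par R q) \<subseteq> K" by blast
  then have "Q.span (\<Union>q. N \<inter> tilde_root_space n par R q) \<subseteq> K"
    by (rule Q.span_is_subset[OF _ ideal_submodule[OF K_ideal]])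
  with Nspan show ?thesis by blast
qed

lemma max_ideal_eq: "max_ideal n par R = K"
  unfolding max_ideal_def
  by (rule Greatest_equality) (use K_graded K_cartan K_maximal in auto)

sublocale Kid: algebra_ideal Q K by unfold_locales (rule K_ideal)

section \<open>The contragredient superalgebra as the image of the free one, and its isomorphism
  with the model\<close>

abbreviation "L \<equiv> contragredient n par R"

lemma L_eq: "L = quot_superalgebra Q K" by (simp add: contragredient_def max_ideal_eq)

lemma L_bilinear: "bilinear_algebra L" unfolding L_eq by (rule Kid.quot.bilinear_algebra_axioms)

definition proj :: "('h chevalley magma \<Rightarrow>\<^sub>0 'k) \<Rightarrow> ('h chevalley magma \<Rightarrow>\<^sub>0 'k) set set" where
  "proj x = K +>\<^bsub>Q\<^esub> cos x"

lemma L_carrier: "carrier L = proj ` C"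
  by (auto simp: L_eq Kid.quot_carrier Q_carrier proj_def)

lemma L_add: "\<lbrakk>x \<in> C; y \<in> C\<rbrakk> \<Longrightarrow> proj x \<oplus>\<^bsub>L\<^esub> proj y = proj (x + y)"
  by (simp add: L_eq Kid.quot_add cos_carrier Q_add proj_def) (simp add: T_simps)

lemma L_smult: "x \<in> C \<Longrightarrow> a \<odot>\<^bsub>L\<^esub> proj x = proj (Poly_Mapping.map ((*) a) x)"
  by (simp add: L_eq Kid.quot_smult cos_carrier Q_smult proj_def) (simp add: T_simps)

lemma L_mult: "\<lbrakk>x \<in> C; y \<in> C\<rbrakk> \<Longrightarrow> proj x \<otimes>\<^bsub>L\<^esub> proj y = proj (x \<otimes>\<^bsub>T\<^esub> y)"
  by (simp add: L_eq Kid.quot_mult cos_carrier Q_mult proj_def)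

lemma L_part: "part L i = proj ` part T i"
  by (auto simp: L_eq Kid.quot_part Q_part proj_def)

lemma proj_eq: assumes "x \<in> C" "y \<in> C" shows "proj x = proj y \<longleftrightarrow> Phi x = Phi y"
proof -
  have "cos x \<ominus>\<^bsub>Q\<^esub> cos y = cos (x - y)"
  proof -
    have "Poly_Mapping.map ((*) (- 1)) y = - y" by (rule poly_mapping_eqI) (simp add: lookup_smult)
    then show ?thesis using assms C_smult[of y "- 1"]
      by (simp add: a_minus_def Q.neg_smult cos_carrier Q_smult) (simp add: T_simps Q_add)
  qed
  then show ?thesis using assms C_minus[OF assms]
    by (simp add: proj_def Kid.coset_eq_iff cos_carrier cos_in_K Phi_minus)
qed

text \<open>Surjectivity is proved separately for each parity, because the isomorphism has to match
  the homogeneous parts.\<close>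

lemma Phi_onto_part:
  assumes "v \<in> P p" shows "\<exists>x\<in>part T p. Phi x = v"
proof -
  have z: "0 \<in> part T p" for p by (simp add: T_simps weight_space_def)
  have part_add: "x + y \<in> part T p" if "x \<in> part T p" "y \<in> part T p" for x y p
    using that keys_add[of x y] by (auto simp: T_simps weight_space_def)
  have sm: "Poly_Mapping.map ((*) a) x \<in> part T p" if "x \<in> part T p" for x a p
    using that keys_smult[of a x] by (auto simp: T_simps weight_space_def)
  \<comment> \<open>If the parity of a preimage disagrees with the expected one, the vector is zero
    and can be represented by 0, which belongs to both parts.\<close>
  have uniq: "q = p \<or> v = 0" if "v \<in> P p" "v \<in> P q" for v p q using that by (fastforce simp: sc_simps fun_eq_iff fun_ops)
  have gmul: "\<exists>x'\<in>part T p. Phi x' = basis_vec g \<star> y" if g: "g \<in> G" and y: "y = Phi x" "x \<in> part T q" and p: "basis_vec g \<star> y \<in> P p" for g y x q p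
  proof -
    obtain g' where g': "g' \<in> X" "ev_gen g' = basis_vec g"
      using G_gen[OF g] by metis
    have "gen g' \<in> part T (gen_parity par g')" using g' by (auto simp: T_simps weight_space_def gen_def)
    then have zr: "gen g' \<otimes>\<^bsub>T\<^esub> x \<in> part T (gen_parity par g' + q)"
      using y(2) keys_free_mult[of X "gen_parity par" "gen g'" x]
      by (fastforce simp: free_contragredient_def free_simps(5) weight_space_def)
    have eq: "Phi (gen g' \<otimes>\<^bsub>T\<^esub> x) = basis_vec g \<star> y" using g' y by (simp add: Phi_mult Phi_gen)
    have "gen_parity par g' + q = p \<or> basis_vec g \<star> y = 0" using uniq[OF p] Phi_part[OF zr] eq by simp
    then show ?thesis using zr eq z Phi_zero by metis
  qed
  have gs: "\<exists>p. v \<in> P p \<and> (\<exists>x\<in>part T p. Phi x = v)" if "v \<in> gspan I pm c G" for v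
    using that
  proof induction
    case (gspan_gen g)
    then obtain g' where g': "g' \<in> X" "ev_gen g' = basis_vec g"
      using G_gen by metis
    have "gen g' \<in> part T (gen_parity par g')" using g' by (auto simp: T_simps weight_space_def gen_def)
    then show ?case using Phi_part g' Phi_gen by metis
  next
    case (gspan_scale x a)
    then show ?case using sm Phi_smult sc_part_closed(2) by metis
  next
    case (gspan_add x y p)
    then obtain i j where ij: "x \<in> P i" "\<exists>a\<in>part T i. Phi a = x" "y \<in> P j" "\<exists>b\<in>part T j. Phi b = y" by blast
    have "\<exists>a\<in>part T p. Phi a = x" using uniq[OF gspan_add(3) ij(1)] ij(2) z Phi_zero by metis
    moreover have "\<exists>a\<in>part T p. Phi a = y" using uniq[OF gspan_add(4) ij(3)] ij(4) z Phi_zero by metis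
    ultimately show ?case using part_add Phi_add Phi_part by metis
  next
    case (gspan_mult g x)
    then obtain q y where y: "x \<in> P q" "y \<in> part T q" "Phi y = x" by blast
    have "g \<in> I" using gspan_mult e_mem f_mem by auto
    then have "basis_vec g \<star> x \<in> P (pm g + q)" using mult_part[OF basis_vec_part[of g I pm c] y(1)] by simp
    then show ?case using gmul[OF gspan_mult(1) y(3)[symmetric] y(2)] by blast
  qed
  show ?thesis using fin assms
  proof (induction rule: sc_part_induct)
    case zero show ?case using z Phi_zero by blast
  next
    case (add x y) then show ?case using part_add Phi_add by metis
  next
    case (scale a x) then show ?case using sm Phi_smult by metis
  next
    case (unit i)
    from gs[OF generated[OF unit(1)]] obtain q where q: "basis_vec i \<in> P q" "\<exists>x\<in>part T q. Phi x = basis_vec i" by blast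
    then have "q = p" using unit by (auto simp: sc_simps basis_vec_def)
    then show ?case using q by simp
  qed
qed

lemma Phi_onto: assumes "v \<in> carrier M" shows "\<exists>x\<in>C. Phi x = v"
proof -
  obtain a b where ab: "a \<in> P 0" "b \<in> P 1" "v = a + b"
    using assms M.part_sum by (auto simp: set_add_def' sc_simps(4))
  obtain x y where "x \<in> part T 0" "Phi x = a" "y \<in> part T 1" "Phi y = b" using Phi_onto_part ab by metis
  then show ?thesis using ab by (intro bexI[of _ "x + y"]) (auto simp: Phi_add intro: C_add part_carrier)
qed

theorem contragredient_iso:
  "\<exists>\<phi>. lie_iso L M \<phi> \<and> (\<forall>m<n. \<phi> (contragredient_e n par R m) = basis_vec (e m))"
proof -
  \<comment> \<open>Two representatives of a class have the same value by \<open>proj_eq\<close>, so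
    the choice is harmless.\<close>
  define \<phi> where "\<phi> Y = Phi (SOME x. x \<in> C \<and> proj x = Y)" for Y
  have phi: "\<phi> (proj x) = Phi x" if "x \<in> C" for x
  proof -
    have "(SOME y. y \<in> C \<and> proj y = proj x) \<in> C \<and> proj (SOME y. y \<in> C \<and> proj y = proj x) = proj x"
      by (rule someI[of "\<lambda>y. y \<in> C \<and> proj y = proj x" x]) (use that in auto)
    then show ?thesis using proj_eq that unfolding \<phi>_def by blast
  qed
  interpret L: bilinear_algebra L by (rule L_bilinear)
  interpret MB: bilinear_algebra M by (rule MB)
  have hom: "\<phi> \<in> LinearCombinations.module_hom class_ring L M"
    unfolding LinearCombinations.module_hom_def
    by (auto simp: L_carrier phi Phi_carrier L_add L_smult C_add C_smult Phi_add Phi_smult sc_simps(4,5))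
  then have "linear_map class_ring L M \<phi>" by unfold_locales
  moreover have "bij_betw \<phi> (carrier L) (carrier M)"
    unfolding bij_betw_def
  proof
    show "inj_on \<phi> (carrier L)" by (auto simp: inj_on_def L_carrier phi proj_eq)
    show "\<phi> ` carrier L = carrier M"
      using Phi_onto Phi_carrier by (auto simp: L_carrier image_image phi cong: image_cong)
  qed
  moreover have "\<forall>x\<in>carrier L. \<forall>y\<in>carrier L. \<phi> (x \<otimes>\<^bsub>L\<^esub> y) = \<phi> x \<otimes>\<^bsub>M\<^esub> \<phi> y"
    by (auto simp: L_carrier L_mult phi T.mult_closed Phi_mult sc_simps(2))
  moreover have "\<phi> ` part L i = part M i" for i
  proof -
    have "\<phi> ` part L i = Phi ` part T i" by (auto simp: L_part image_image phi part_carrier cong: image_cong)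
    also have "\<dots> = part M i" using Phi_onto_part Phi_part by blast
    finally show ?thesis .
  qed
  moreover have "\<phi> (contragredient_e n par R m) = basis_vec (e m)" if "m < n" for m
  proof -
    have "contragredient_e n par R m = proj (gen (EGen m))"
      by (simp add: contragredient_e_def max_ideal_eq proj_def tilde_coset_def)
    then show ?thesis using that by (simp add: phi gen_carrier gen_mem Phi_gen)
  qed
  ultimately show ?thesis unfolding lie_iso_def by blast
qed

theorem contragredient_lie: "lie_superalgebra L"
proof -
  obtain \<phi> where "lie_iso L M \<phi>" using contragredient_iso by blast
  then show ?thesis
    by (rule lie_superalgebra_iso[OF lie L_bilinear]) (auto simp: L_part L_carrier part_carrier)
qed

end

section \<open>Independence of the Jordan decomposition\<close>

context class_vectorspace
begin

section \<open>Linear functionals and coordinates with respect to a finite basis\<close>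

definition lin_fun :: "('v \<Rightarrow> 'k) \<Rightarrow> bool" where
  "lin_fun F \<longleftrightarrow> (\<forall>x\<in>carrier V. \<forall>y\<in>carrier V. F (x \<oplus> y) = F x + F y) \<and> (\<forall>a. \<forall>x\<in>carrier V. F (a \<odot>\<^bsub>V\<^esub> x) = a * F x)"

lemma lin_funD:
  assumes "lin_fun F" "x \<in> carrier V"
  shows "y \<in> carrier V \<Longrightarrow> F (x \<oplus> y) = F x + F y" "F (a \<odot>\<^bsub>V\<^esub> x) = a * F x" "F (\<ominus> x) = - F x"
    "y \<in> carrier V \<Longrightarrow> F (x \<ominus> y) = F x - F y" "F \<zero> = 0"
proof -
  show 1: "F (x \<oplus> y) = F x + F y" if "y \<in> carrier V" for y using assms that by (simp add: lin_fun_def)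
  show 2: "F (a \<odot>\<^bsub>V\<^esub> x) = a * F x" for a using assms by (simp add: lin_fun_def)
  have 3: "F (\<ominus> y) = - F y" if "y \<in> carrier V" for y using assms that by (simp add: neg_smult lin_fun_def)
  show "F (\<ominus> x) = - F x" using 3 assms by simp
  show "F (x \<ominus> y) = F x - F y" if "y \<in> carrier V" using 1 3 that by (simp add: a_minus_def)
  show "F \<zero> = 0" using 2[of 0] assms by (simp add: zero_smult)
qed

lemma lin_fun_finsum:
  assumes F: "lin_fun F" and "finite S" "S \<subseteq> carrier V"
  shows "F (lincomb a S) = (\<Sum>b\<in>S. a b * F b)"
  using assms(2,3) unfolding lincomb_def
proof (induction S)
  case empty
  then show ?case using lin_funD(5)[OF F] by (simp add: lin_funD(5)[OF F zero_closed])
next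
  case (insert b S)
  then have "(\<Oplus>\<^bsub>V\<^esub>v\<in>insert b S. a v \<odot>\<^bsub>V\<^esub> v) = a b \<odot>\<^bsub>V\<^esub> b \<oplus> (\<Oplus>\<^bsub>V\<^esub>v\<in>S. a v \<odot>\<^bsub>V\<^esub> v)"
    by (intro finsum_insert) (auto simp: smult_carrier)
  moreover have "(\<Oplus>\<^bsub>V\<^esub>v\<in>S. a v \<odot>\<^bsub>V\<^esub> v) \<in> carrier V" using insert by (intro finsum_closed) (auto simp: smult_carrier)
  ultimately show ?case using insert by (simp add: lin_funD[OF F] smult_carrier)
qed

context
  fixes S assumes basis: "basis S" and fin: "finite S"
begin

lemma basis_carrier: "S \<subseteq> carrier V" using basis by (simp add: basis_def)

lemma coeff_unique: assumes "v \<in> carrier V" shows "\<exists>!a. a \<in> extensional S \<and> lincomb a S = v"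
proof -
  have "\<forall>v\<in>carrier V. \<exists>!a. a \<in> S \<rightarrow>\<^sub>E carrier class_ring \<and> lincomb a S = v"
    using basis_criterion[OF fin basis_carrier] basis by simp
  then show ?thesis using assms by (simp add: PiE_def)
qed

lemma lincomb_coeff: assumes "v \<in> carrier V" shows "lincomb (basis_coeff V S v) S = v"
proof -
  let ?a = "THE a. a \<in> extensional S \<and> lincomb a S = v"
  have "?a \<in> extensional S \<and> lincomb ?a S = v" by (rule theI'[OF coeff_unique[OF assms]])
  moreover have "basis_coeff V S v = ?a" by (simp add: basis_coeff_def fun_eq_iff)
  ultimately show ?thesis by simp
qed

lemma coeff_eqI: assumes "lincomb a S = v" "b \<in> S" shows "basis_coeff V S v b = a b"
proof -
  have 1: "lincomb (restrict a S) S = v"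
    using assms(1) basis_carrier by (subst lincomb_cong[of _ S _ a]) auto
  have v: "v \<in> carrier V" using assms(1) basis_carrier by (auto intro!: lincomb_closed)
  have "(THE a. a \<in> extensional S \<and> lincomb a S = v) = restrict a S"
    by (rule the1_equality[OF coeff_unique[OF v]]) (use 1 in auto)
  then show ?thesis using assms(2) by (simp add: basis_coeff_def)
qed

lemma lin_fun_expand: assumes "lin_fun F" "v \<in> carrier V" shows "F v = (\<Sum>b\<in>S. basis_coeff V S v b * F b)"
  using lin_fun_finsum[OF assms(1) fin basis_carrier, of "basis_coeff V S v"] lincomb_coeff[OF assms(2)] by simp

lemma lin_fun_coeff: assumes b: "b \<in> S" shows "lin_fun (\<lambda>v. basis_coeff V S v b)"
  unfolding lin_fun_def
proof (intro conjI ballI allI)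
  fix x y assume x: "x \<in> carrier V" and y: "y \<in> carrier V"
  have "lincomb (\<lambda>b. basis_coeff V S x b + basis_coeff V S y b) S = x \<oplus> y"
    using lincomb_sum[OF fin basis_carrier, of "basis_coeff V S x" "basis_coeff V S y"] lincomb_coeff x y by simp
  from coeff_eqI[OF this b] show "basis_coeff V S (x \<oplus> y) b = basis_coeff V S x b + basis_coeff V S y b" .
next
  fix s x assume x: "x \<in> carrier V"
  have "lincomb (\<lambda>b. s * basis_coeff V S x b) S = s \<odot>\<^bsub>V\<^esub> x"
    using lincomb_smult[OF basis_carrier, of "basis_coeff V S x" s] lincomb_coeff x by simp
  from coeff_eqI[OF this b] show "basis_coeff V S (s \<odot>\<^bsub>V\<^esub> x) b = s * basis_coeff V S x b" .
qed

lemma coeff_basis: assumes "b \<in> S" "b' \<in> S" shows "basis_coeff V S b' b = (if b = b' then 1 else 0)"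
proof -
  have b': "b' \<in> carrier V" using assms basis_carrier by auto
  have "lincomb (\<lambda>b. if b = b' then 1 else 0) S = b'"
  proof -
    have "(\<Oplus>\<^bsub>V\<^esub>v\<in>S. (if v = b' then 1 else 0) \<odot>\<^bsub>V\<^esub> v) = (\<Oplus>\<^bsub>V\<^esub>v\<in>S. if b' = v then v else \<zero>)"
      using basis_carrier by (intro finsum_cong) (auto simp: one_smult zero_smult smult_carrier simp_implies_def)
    also have "\<dots> = b'" using finsum_singleton[OF assms(2) fin, of "\<lambda>v. v"] basis_carrier by auto
    finally show ?thesis by (simp add: lincomb_def)
  qed
  from coeff_eqI[OF this assms(1)] show ?thesis .
qed

end

end

text \<open>Invertibility of 2 allows an equation to be halved in \<open>kills_left\<close>.\<close>

locale alpha3_lie_algebra =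
  fixes L :: "('k::field, 'v, 'm) superalgebra_scheme" (structure) and d :: "'v \<Rightarrow> 'v"
  assumes alpha3: "rep_alpha3_lie_algebra L d" and two: "(2::'k) \<noteq> 0"
begin

sublocale lie_superalgebra L using alpha3 by (simp add: rep_alpha3_lie_algebra_def)
sublocale bilinear_algebra L by (rule lie_superalgebra_bilinear[OF lie_superalgebra_axioms])

lemma d_linear: "linear_map class_ring L L d" using alpha3 by (simp add: rep_alpha3_lie_algebra_def)

sublocale d: linear_map class_ring L L d by (rule d_linear)

lemma d_closed: "x \<in> carrier L \<Longrightarrow> d x \<in> carrier L" by (rule d.T_im)
lemma d_smult: "x \<in> carrier L \<Longrightarrow> d (a \<odot>\<^bsub>L\<^esub> x) = a \<odot>\<^bsub>L\<^esub> d x" by (rule d.T_smult) auto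
lemma d_mult: "x \<in> carrier L \<Longrightarrow> y \<in> carrier L \<Longrightarrow> d (x \<otimes> y) = d x \<otimes> y \<oplus> x \<otimes> d y"
  using alpha3 by (simp add: rep_alpha3_lie_algebra_def)
lemma d_cube: "x \<in> carrier L \<Longrightarrow> d (d (d x)) = \<zero>"
  using alpha3 by (simp add: rep_alpha3_lie_algebra_def)

lemma carrier_even: "carrier L = part L 0"
proof -
  have "part L 1 = {\<zero>}" using alpha3 by (simp add: rep_alpha3_lie_algebra_def)
  moreover have sub: "part L 0 \<subseteq> carrier L"
    using part_subspace[of 0] by (simp add: VectorSpace.subspace_def submodule_def)
  ultimately have "part L 0 <+>\<^bsub>L\<^esub> part L 1 = (\<lambda>x. x \<oplus> \<zero>) ` part L 0"
    by (auto simp: set_add_def')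
  also have "\<dots> = part L 0" using sub by (auto simp: subset_iff)
  finally show ?thesis using part_sum by simp
qed

lemma bracket_antisym: "x \<in> carrier L \<Longrightarrow> y \<in> carrier L \<Longrightarrow> x \<otimes> y = \<ominus> (y \<otimes> x)"
  using antisymmetry[of x 0 y 0] by (simp add: carrier_even[symmetric] koszul_def one_smult mult_closed)

lemma mult_zero: "x \<in> carrier L \<Longrightarrow> x \<otimes> \<zero> = \<zero>" "x \<in> carrier L \<Longrightarrow> \<zero> \<otimes> x = \<zero>"
  using mult_smult_right[of x \<zero> 0] mult_smult_left[of \<zero> x 0] by (simp_all add: zero_smult mult_closed)

section \<open>The brackets of the semisimplification and the quotients on which they are well
  defined\<close>

definition brk :: "bit \<Rightarrow> bit \<Rightarrow> 'v \<Rightarrow> 'v \<Rightarrow> 'v" where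
  "brk p q u v = (if p = 1 \<and> q = 1 then \<ominus> (u \<otimes> d v) \<oplus> d u \<otimes> v else u \<otimes> v)"

definition ker :: "bit \<Rightarrow> 'v set" where
  "ker p = {v \<in> carrier L. if p = 0 then d v = \<zero> else d (d v) = \<zero>}"

text \<open>Functionals that descend to the quotient of \<open>ker p\<close> attached to parity
  \<open>p\<close>. For even parity this is vanishing on the intersection of the kernel and the
  image of \<open>d\<close>; for odd parity vanishing on all of the image is demanded, which the
  coordinate functionals of blocks of size 2 satisfy.\<close>

definition kills :: "bit \<Rightarrow> ('v \<Rightarrow> 'k) \<Rightarrow> bool" where
  "kills p F \<longleftrightarrow> (if p = 0 then \<forall>x\<in>carrier L. d (d x) = \<zero> \<longrightarrow> F (d x) = 0
     else (\<forall>x\<in>carrier L. d x = \<zero> \<longrightarrow> F x = 0) \<and> (\<forall>x\<in>carrier L. F (d x) = 0))"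

lemma brk_carrier: "u \<in> carrier L \<Longrightarrow> v \<in> carrier L \<Longrightarrow> brk p q u v \<in> carrier L"
  by (simp add: brk_def mult_closed d_closed)

lemma brk_swap: "u \<in> carrier L \<Longrightarrow> v \<in> carrier L \<Longrightarrow>
    brk p q u v = (if p = 1 \<and> q = 1 then brk q p v u else \<ominus> brk q p v u)"
  using bracket_antisym[of u v] bracket_antisym[of u "d v"] bracket_antisym[of "d u" v]
  by (auto simp: brk_def mult_closed d_closed a_comm)

text \<open>If both parities are odd, the two terms \<open>[d u, d v]\<close> of the derivative
  cancel and the remaining ones contain a second derivative.\<close>

lemma brk_ker: assumes "u \<in> ker p" "v \<in> ker q" shows "brk p q u v \<in> ker (p + q)"
  using assms
  by (cases p; cases q)
    (auto simp: ker_def brk_def mult_closed d_closed d_mult mult_zero l_neg)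

lemma brk_linear_left: assumes F: "lin_fun F" and v: "v \<in> carrier L" shows "lin_fun (\<lambda>u. F (brk p q u v))"
  unfolding lin_fun_def
proof (intro conjI ballI allI)
  fix x y assume "x \<in> carrier L" "y \<in> carrier L"
  then show "F (brk p q (x \<oplus> y) v) = F (brk p q x v) + F (brk p q y v)"
    using v by (simp add: brk_def lin_funD[OF F] mult_closed d_closed mult_add_left minus_add)
next
  fix a x assume "x \<in> carrier L"
  then show "F (brk p q (a \<odot>\<^bsub>L\<^esub> x) v) = a * F (brk p q x v)"
    using v by (simp add: brk_def lin_funD[OF F] mult_closed d_closed d_smult mult_smult_left smult_carrier algebra_simps)
qed

text \<open>This is well-definedness in the first argument. \<open>F\<close> has to vanish on the
  whole image of \<open>d\<close>, because the elements \<open>d [x, v]\<close> used in the proof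
  are derivatives of arbitrary brackets.\<close>

lemma kills_left:
  assumes F: "lin_fun F" and k: "\<And>x. x \<in> carrier L \<Longrightarrow> F (d x) = 0"
    and k1: "\<And>x. p + q = 1 \<Longrightarrow> x \<in> carrier L \<Longrightarrow> d x = \<zero> \<Longrightarrow> F x = 0" and v: "v \<in> ker q"
  shows "kills p (\<lambda>u. F (brk p q u v))"
proof -
  have vc: "v \<in> carrier L" using v by (simp add: ker_def)
  note cl = mult_closed d_closed smult_carrier
  consider "p = 0" "q = 0" | "p = 0" "q = 1" | "p = 1" "q = 0" | "p = 1" "q = 1"
    by (metis bit_not_zero_iff)
  then show ?thesis
  proof cases
    case 1
    have "F (d x \<otimes> v) = 0" if x: "x \<in> carrier L" for x
      using k[of "x \<otimes> v"] x v 1 by (simp add: d_mult ker_def mult_zero cl)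
    then show ?thesis using 1 by (simp add: kills_def brk_def)
  next
    case 2
    have "F (d x \<otimes> v) = 0" if x: "x \<in> carrier L" and dd: "d (d x) = \<zero>" for x
    proof -
      have ddv: "d (d v) = \<zero>" using v 2 by (simp add: ker_def)
      \<comment> \<open>By the Leibniz rule \<open>?w\<close> is \<open>[d x, v] - [x, d v]\<close>,
        which \<open>d\<close> annihilates since both second derivatives vanish. As \<open>F\<close>
        kills \<open>?w\<close> and \<open>d [x, v]\<close>, it kills their sum
        \<open>2 [d x, v]\<close>.\<close>
      let ?y = "x \<otimes> v" and ?w = "2 \<odot>\<^bsub>L\<^esub> (d x \<otimes> v) \<ominus> d (x \<otimes> v)"
      have 1: "d (d x \<otimes> v) = d x \<otimes> d v" using x vc dd by (simp add: d_mult cl mult_zero)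
      have 2: "d (d (x \<otimes> v)) = d x \<otimes> d v \<oplus> d x \<otimes> d v" using x vc dd ddv by (simp add: d_mult cl mult_zero)
      have s: "2 \<odot>\<^bsub>L\<^esub> y = y \<oplus> y" if "y \<in> carrier L" for y
        using add_smult[OF that, of 1 1] that by (simp add: one_smult)
      have "d ?w = \<zero>" using x vc by (simp add: d_smult cl 1 2 s)
      then have "F ?w = 0" using x vc \<open>p = 0\<close> \<open>q = 1\<close> by (intro k1) (auto simp: cl)
      moreover have "F ?w = 2 * F (d x \<otimes> v)" using x vc k[of ?y] by (simp add: lin_funD[OF F] cl)
      ultimately show ?thesis using two by simp
    qed
    then show ?thesis using 2 by (simp add: kills_def brk_def)
  next
    case 3
    have dv: "d v = \<zero>" using v 3 by (simp add: ker_def)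
    have "F (x \<otimes> v) = 0" if "x \<in> carrier L" "d x = \<zero>" for x
      using that vc dv 3 by (intro k1) (simp_all add: d_mult cl mult_zero)
    moreover have "F (d x \<otimes> v) = 0" if x: "x \<in> carrier L" for x
      using k[of "x \<otimes> v"] x vc dv by (simp add: d_mult mult_zero cl)
    ultimately show ?thesis using 3 by (simp add: kills_def brk_def)
  next
    case 4
    have ddv: "d (d v) = \<zero>" using v 4 by (simp add: ker_def)
    have "F (x \<otimes> d v) = 0" if "x \<in> carrier L" "d x = \<zero>" for x
      using k[of "x \<otimes> v"] that vc by (simp add: d_mult mult_zero cl)
    \<comment> \<open>The derivatives of \<open>[x, d v]\<close> and of \<open>[d x, v]\<close> show
      that \<open>F\<close> vanishes on each of the two summands.\<close>
    moreover have "F (\<ominus> (d x \<otimes> d v) \<oplus> d (d x) \<otimes> v) = 0" if x: "x \<in> carrier L" for x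
    proof -
      have "F (d x \<otimes> d v) = 0" using k[of "x \<otimes> d v"] x vc ddv by (simp add: d_mult mult_zero cl)
      moreover have "F (d (d x) \<otimes> v) + F (d x \<otimes> d v) = 0"
        using k[of "d x \<otimes> v"] x vc by (simp add: d_mult cl lin_funD[OF F])
      ultimately show ?thesis using x vc by (simp add: lin_funD[OF F] cl)
    qed
    ultimately show ?thesis using 4 vc by (simp add: kills_def brk_def lin_funD[OF F] cl mult_zero)
  qed
qed

lemma F_swap: assumes F: "lin_fun F" and u: "u \<in> carrier L" and v: "v \<in> carrier L"
  shows "F (brk p q u v) = (if p = 1 \<and> q = 1 then F (brk q p v u) else - F (brk q p v u))"
  unfolding brk_swap[OF u v, of p q] using u v by (simp add: lin_funD(3)[OF F] brk_carrier)

lemma brk_linear_right: assumes F: "lin_fun F" and u: "u \<in> carrier L" shows "lin_fun (\<lambda>v. F (brk p q u v))"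
  using brk_linear_left[OF F u, of q p] u by (auto simp: lin_fun_def F_swap[OF F u, of _ p q] smult_carrier)

lemma kills_right:
  assumes F: "lin_fun F" and k: "\<And>x. x \<in> carrier L \<Longrightarrow> F (d x) = 0"
    and k1: "\<And>x. p + q = 1 \<Longrightarrow> x \<in> carrier L \<Longrightarrow> d x = \<zero> \<Longrightarrow> F x = 0" and u: "u \<in> ker p"
  shows "kills q (\<lambda>v. F (brk p q u v))"
proof -
  have "kills q (\<lambda>v. F (brk q p v u))" 
  proof (intro kills_left F k u)
    fix x assume "q + p = 1" "x \<in> carrier L" "d x = \<zero>"
    then show "F x = 0" using k1[of x] by (simp add: add.commute)
  qed
  moreover have "F (brk p q u v) = 0" if "F (brk q p v u) = 0" "v \<in> carrier L" for v
    using that u F_swap[OF F _ that(2), of u p q] by (auto simp: ker_def)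
  ultimately show ?thesis unfolding kills_def using d_closed by (cases "q = 0") auto
qed

text \<open>What a Jordan decomposition provides for the semisimplification: the tops \<open>\<sigma> j\<close> of the blocks of
  size 1 (even) and 2 (odd), and the corresponding coordinate functionals \<open>\<pi> j\<close>.\<close>

definition frame :: "'j set \<Rightarrow> ('j \<Rightarrow> bit) \<Rightarrow> ('j \<Rightarrow> 'v) \<Rightarrow> ('j \<Rightarrow> 'v \<Rightarrow> 'k) \<Rightarrow> bool" where
  "frame J p \<sigma> \<pi> \<longleftrightarrow> finite J \<and>
     (\<forall>j\<in>J. \<sigma> j \<in> ker (p j) \<and> lin_fun (\<pi> j) \<and> (\<forall>x\<in>carrier L. \<pi> j (d x) = 0) \<and>
        (p j = 1 \<longrightarrow> (\<forall>x\<in>carrier L. d x = \<zero> \<longrightarrow> \<pi> j x = 0))) \<and>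
     (\<forall>j\<in>J. \<forall>k\<in>J. p j = p k \<longrightarrow> \<pi> j (\<sigma> k) = (if j = k then 1 else 0)) \<and>
     (\<forall>q F v. lin_fun F \<longrightarrow> kills q F \<longrightarrow> v \<in> ker q \<longrightarrow> F v = (\<Sum>j\<in>{j\<in>J. p j = q}. \<pi> j v * F (\<sigma> j)))"

definition frame_coeff :: "('j \<Rightarrow> bit) \<Rightarrow> ('j \<Rightarrow> 'v) \<Rightarrow> ('j \<Rightarrow> 'v \<Rightarrow> 'k) \<Rightarrow> 'j \<Rightarrow> 'j \<Rightarrow> 'j \<Rightarrow> 'k" where
  "frame_coeff p \<sigma> \<pi> i j k = (if p i + p j \<noteq> p k then 0 else \<pi> k (brk (p i) (p j) (\<sigma> i) (\<sigma> j)))"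

lemma frame_kills: assumes "frame J p \<sigma> \<pi>" "j \<in> J" shows "kills (p j) (\<pi> j)"
proof -
  have "p j = 0 \<or> p j = 1" by (metis bit_not_zero_iff)
  then show ?thesis using assms by (auto simp: frame_def kills_def)
qed

lemma frameD:
  assumes "frame J p \<sigma> \<pi>" "j \<in> J"
  shows "\<sigma> j \<in> ker (p j)" "\<sigma> j \<in> carrier L" "lin_fun (\<pi> j)" "x \<in> carrier L \<Longrightarrow> \<pi> j (d x) = 0"
    "p j = 1 \<Longrightarrow> x \<in> carrier L \<Longrightarrow> d x = \<zero> \<Longrightarrow> \<pi> j x = 0"
  using assms by (auto simp: frame_def ker_def)

lemma frame_expand:
  assumes "frame J p \<sigma> \<pi>" "lin_fun F" "kills q F" "v \<in> ker q"
  shows "(\<Sum>j\<in>{j\<in>J. p j = q}. \<pi> j v * F (\<sigma> j)) = F v"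
  using assms by (simp add: frame_def)

section \<open>Transition matrices between two frames\<close>

definition change :: "('i \<Rightarrow> bit) \<Rightarrow> ('i \<Rightarrow> 'v) \<Rightarrow> 'j set \<Rightarrow> ('j \<Rightarrow> bit) \<Rightarrow> ('j \<Rightarrow> 'v \<Rightarrow> 'k) \<Rightarrow> 'i \<Rightarrow> 'j \<Rightarrow> 'k" where
  "change p \<sigma> J q \<pi> i = (\<lambda>l. if l \<in> J \<and> q l = p i then \<pi> l (\<sigma> i) else 0)"

definition change_map :: "'i set \<Rightarrow> ('i \<Rightarrow> bit) \<Rightarrow> ('i \<Rightarrow> 'v) \<Rightarrow> 'j set \<Rightarrow> ('j \<Rightarrow> bit) \<Rightarrow> ('j \<Rightarrow> 'v \<Rightarrow> 'k) \<Rightarrow> ('i \<Rightarrow> 'k) \<Rightarrow> 'j \<Rightarrow> 'k" where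
  "change_map I p \<sigma> J q \<pi> u = (\<Sum>i\<in>I. scale (u i) (change p \<sigma> J q \<pi> i))"

lemma sum_apply: "(\<Sum>i\<in>I. scale (u i) (g i)) l = (\<Sum>i\<in>I. u i * g i l)" for g :: "'i \<Rightarrow> 'j \<Rightarrow> 'k"
  by (induction I rule: infinite_finite_induct) (auto simp: fun_ops scale_def)

lemma scale_apply: "scale a v l = a * v l"
  by (simp add: scale_def)

lemma change_map_linear:
  "change_map I p \<sigma> J q \<pi> (u + v) = change_map I p \<sigma> J q \<pi> u + change_map I p \<sigma> J q \<pi> v"
  "change_map I p \<sigma> J q \<pi> (scale a u) = scale a (change_map I p \<sigma> J q \<pi> u)"
  by (simp_all add: change_map_def fun_eq_iff fun_ops sum_apply scale_apply sum_distrib_left algebra_simps sum.distrib)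

lemma change_map_inverse:
  assumes f1: "frame I p \<sigma> \<pi>" and f2: "frame J q \<sigma>' \<pi>'" and u: "u \<in> carrier (sc_algebra I p c)"
  shows "change_map J q \<sigma>' I p \<pi> (change_map I p \<sigma> J q \<pi>' u) = u"
proof
  fix k
  have fin: "finite I" "finite J" using f1 f2 by (auto simp: frame_def)
  show "change_map J q \<sigma>' I p \<pi> (change_map I p \<sigma> J q \<pi>' u) k = u k"
  proof (cases "k \<in> I")
    case False
    then show ?thesis using u by (simp add: change_map_def sum_apply change_def sc_simps)
  next
    case k: True
    \<comment> \<open>The product of the two transition matrices appears when the functional
      \<open>\<pi> k\<close> is expanded in the second frame and evaluated at
      \<open>\<sigma> i\<close>.\<close>
    have inner: "(\<Sum>l\<in>J. change p \<sigma> J q \<pi>' i l * change q \<sigma>' I p \<pi> l k) = (if i = k then 1 else 0)" if i: "i \<in> I" for i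
    proof -
      have "(\<Sum>l\<in>J. change p \<sigma> J q \<pi>' i l * change q \<sigma>' I p \<pi> l k) =
          (\<Sum>l\<in>{l\<in>J. q l = p i}. if p k = p i then \<pi>' l (\<sigma> i) * \<pi> k (\<sigma>' l) else 0)"
        using fin k by (auto simp: change_def intro!: sum.mono_neutral_cong_right split: if_splits)
      also have "\<dots> = (if p k = p i then \<pi> k (\<sigma> i) else 0)"
        using frame_expand[OF f2 frameD(3)[OF f1 k] _ frameD(1)[OF f1 i]] frame_kills[OF f1 k] by auto
      also have "\<dots> = (if i = k then 1 else 0)" using f1 i k by (auto simp: frame_def)
      finally show ?thesis .
    qed
    have "change_map J q \<sigma>' I p \<pi> (change_map I p \<sigma> J q \<pi>' u) k =
      (\<Sum>l\<in>J. (\<Sum>i\<in>I. u i * change p \<sigma> J q \<pi>' i l) * change q \<sigma>' I p \<pi> l k)"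
      by (simp add: change_map_def sum_apply)
    also have "\<dots> = (\<Sum>i\<in>I. u i * (\<Sum>l\<in>J. change p \<sigma> J q \<pi>' i l * change q \<sigma>' I p \<pi> l k))"
      by (simp add: sum_distrib_left sum_distrib_right mult.assoc) (rule sum.swap)
    also have "\<dots> = (\<Sum>i\<in>I. if i = k then u i else 0)" using inner by (intro sum.cong) auto
    also have "\<dots> = u k" using k fin by simp
    finally show ?thesis .
  qed
qed

lemma change_map_part:
  assumes "v \<in> part (sc_algebra I p c) r" "finite I"
  shows "change_map I p \<sigma> J q \<pi> v \<in> part (sc_algebra J q c') r"
proof -
  have "l \<in> J \<and> q l = r" if nz: "change_map I p \<sigma> J q \<pi> v l \<noteq> 0" for l
  proof -
    obtain i where i: "i \<in> I" "v i * change p \<sigma> J q \<pi> i l \<noteq> 0"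
      using nz by (auto simp: change_map_def sum_apply elim: sum.not_neutral_contains_not_neutral)
    then have "p i = r" using assms(1) by (auto simp: sc_simps)
    then show ?thesis using i by (auto simp: change_def split: if_splits)
  qed
  then show ?thesis by (simp add: sc_simps)
qed

lemma change_map_carrier: "change_map I p \<sigma> J q \<pi> v \<in> carrier (sc_algebra J q c')"
  by (auto simp: sc_simps change_map_def sum_apply change_def)

text \<open>Both sides compute \<open>\<pi>' l\<close> of the bracket of \<open>\<sigma> i\<close>
  and \<open>\<sigma> j\<close>: the left one expands the bracket in the first frame, the right one
  expands both arguments in the second frame, which is legitimate by \<open>kills_left\<close> and
  \<open>kills_right\<close>.\<close>

lemma change_mult:
  assumes f1: "frame I p \<sigma> \<pi>" and f2: "frame J q \<sigma>' \<pi>'" and i: "i \<in> I" and j: "j \<in> I" and l: "l \<in> J"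
  shows "(\<Sum>k\<in>I. frame_coeff p \<sigma> \<pi> i j k * change p \<sigma> J q \<pi>' k l) =
     (\<Sum>a\<in>J. \<Sum>b\<in>J. change p \<sigma> J q \<pi>' i a * change p \<sigma> J q \<pi>' j b * frame_coeff q \<sigma>' \<pi>' a b l)"
proof -
  have fin: "finite I" "finite J" using f1 f2 by (auto simp: frame_def)
  let ?w = "brk (p i) (p j) (\<sigma> i) (\<sigma> j)"
  have F: "lin_fun (\<pi>' l)" by (rule frameD(3)[OF f2 l])
  have Fd: "\<And>x. x \<in> carrier L \<Longrightarrow> \<pi>' l (d x) = 0" by (rule frameD(4)[OF f2 l])
  have "(\<Sum>k\<in>I. frame_coeff p \<sigma> \<pi> i j k * change p \<sigma> J q \<pi>' k l) =
     (\<Sum>k\<in>{k\<in>I. p k = q l}. if p i + p j = q l then \<pi> k ?w * \<pi>' l (\<sigma> k) else 0)"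
    using fin l by (intro sum.mono_neutral_cong_right) (auto simp: frame_coeff_def change_def)
  also have "\<dots> = (if p i + p j = q l then \<pi>' l ?w else 0)"
    using frame_expand[OF f1 F, of "q l" ?w] frame_kills[OF f2 l] brk_ker[OF frameD(1)[OF f1 i] frameD(1)[OF f1 j]] by auto
  finally have lhs: "(\<Sum>k\<in>I. frame_coeff p \<sigma> \<pi> i j k * change p \<sigma> J q \<pi>' k l) = (if p i + p j = q l then \<pi>' l ?w else 0)" .
  let ?A = "{a\<in>J. q a = p i}" and ?B = "{b\<in>J. q b = p j}"
  have "(\<Sum>a\<in>J. \<Sum>b\<in>J. change p \<sigma> J q \<pi>' i a * change p \<sigma> J q \<pi>' j b * frame_coeff q \<sigma>' \<pi>' a b l) =
     (\<Sum>a\<in>?A. \<Sum>b\<in>J. change p \<sigma> J q \<pi>' i a * change p \<sigma> J q \<pi>' j b * frame_coeff q \<sigma>' \<pi>' a b l)"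
    using fin by (intro sum.mono_neutral_right) (auto simp: change_def)
  also have "\<dots> = (\<Sum>a\<in>?A. \<Sum>b\<in>?B. if p i + p j = q l then
      \<pi>' a (\<sigma> i) * (\<pi>' b (\<sigma> j) * \<pi>' l (brk (p i) (p j) (\<sigma>' a) (\<sigma>' b))) else 0)"
    using fin by (intro sum.cong refl sum.mono_neutral_cong_right) (auto simp: change_def frame_coeff_def)
  also have "\<dots> = (if p i + p j = q l then \<pi>' l ?w else 0)"
  proof (cases "p i + p j = q l")
    case True
    have k1: "\<And>x. p i + p j = 1 \<Longrightarrow> x \<in> carrier L \<Longrightarrow> d x = \<zero> \<Longrightarrow> \<pi>' l x = 0"
      using frameD(5)[OF f2 l] True by simp
    have right: "(\<Sum>b\<in>?B. \<pi>' b (\<sigma> j) * \<pi>' l (brk (p i) (p j) (\<sigma>' a) (\<sigma>' b))) = \<pi>' l (brk (p i) (p j) (\<sigma>' a) (\<sigma> j))"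
      if a: "a \<in> ?A" for a
    proof -
      have "\<sigma>' a \<in> ker (p i)" "\<sigma>' a \<in> carrier L" using a frameD(1,2)[OF f2, of a] by auto
      then show ?thesis
        by (intro frame_expand[OF f2] brk_linear_right F kills_right Fd k1 frameD(1)[OF f1 j])
    qed
    have left: "(\<Sum>a\<in>?A. \<pi>' a (\<sigma> i) * \<pi>' l (brk (p i) (p j) (\<sigma>' a) (\<sigma> j))) = \<pi>' l ?w"
      by (rule frame_expand[OF f2 brk_linear_left[OF F frameD(2)[OF f1 j]] kills_left[OF F Fd k1 frameD(1)[OF f1 j]] frameD(1)[OF f1 i]])
    have "(\<Sum>a\<in>?A. \<Sum>b\<in>?B. if p i + p j = q l then
      \<pi>' a (\<sigma> i) * (\<pi>' b (\<sigma> j) * \<pi>' l (brk (p i) (p j) (\<sigma>' a) (\<sigma>' b))) else 0) =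
      (\<Sum>a\<in>?A. \<pi>' a (\<sigma> i) * (\<Sum>b\<in>?B. \<pi>' b (\<sigma> j) * \<pi>' l (brk (p i) (p j) (\<sigma>' a) (\<sigma>' b))))"
      using True by (simp add: sum_distrib_left)
    also have "\<dots> = \<pi>' l ?w" using right left by simp
    finally show ?thesis using True by simp
  qed auto
  finally show ?thesis using lhs by simp
qed

theorem frame_independence:
  assumes f1: "frame I p \<sigma> \<pi>" and f2: "frame J q \<sigma>' \<pi>'"
  shows "\<exists>\<phi>. lie_iso (sc_algebra I p (frame_coeff p \<sigma> \<pi>)) (sc_algebra J q (frame_coeff q \<sigma>' \<pi>')) \<phi>"
proof -
  let ?c = "frame_coeff p \<sigma> \<pi>" and ?c' = "frame_coeff q \<sigma>' \<pi>'"
  let ?M = "sc_algebra I p ?c" and ?N = "sc_algebra J q ?c'"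
  let ?f = "change_map I p \<sigma> J q \<pi>'" and ?g = "change_map J q \<sigma>' I p \<pi>"
  have fin: "finite I" "finite J" using f1 f2 by (auto simp: frame_def)
  interpret M: bilinear_algebra ?M by (rule sc_bilinear_algebra)
  interpret N: bilinear_algebra ?N by (rule sc_bilinear_algebra)
  have "?f \<in> LinearCombinations.module_hom class_ring ?M ?N"
    unfolding LinearCombinations.module_hom_def
    using change_map_carrier by (auto simp: change_map_linear sc_simps(4,5))
  then have "linear_map class_ring ?M ?N ?f" by unfold_locales
  moreover have "bij_betw ?f (carrier ?M) (carrier ?N)"
    by (rule bij_betw_byWitness[of _ ?g])
      (auto simp: change_map_inverse[OF f1 f2] change_map_inverse[OF f2 f1] change_map_carrier)
  moreover have "?f (u \<otimes>\<^bsub>?M\<^esub> v) = ?f u \<otimes>\<^bsub>?N\<^esub> ?f v" if "u \<in> carrier ?M" "v \<in> carrier ?M" for u v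
  proof
    fix l
    show "?f (u \<otimes>\<^bsub>?M\<^esub> v) l = (?f u \<otimes>\<^bsub>?N\<^esub> ?f v) l"
    proof (cases "l \<in> J")
      case False
      then show ?thesis using change_map_carrier[of I p \<sigma> J q \<pi>' "u \<otimes>\<^bsub>?M\<^esub> v" ?c'] by (simp add: sc_simps sc_mult_def)
    next
      case l: True
      let ?t = "change p \<sigma> J q \<pi>'"
      have "?f (u \<otimes>\<^bsub>?M\<^esub> v) l = (\<Sum>k\<in>I. (\<Sum>i\<in>I. \<Sum>j\<in>I. u i * v j * ?c i j k) * ?t k l)"
        by (simp add: change_map_def sum_apply sc_simps(2) sc_mult_def)
      also have "\<dots> = (\<Sum>i\<in>I. \<Sum>j\<in>I. \<Sum>k\<in>I. u i * v j * (?c i j k * ?t k l))"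
        unfolding sum_distrib_right
        by (subst sum.swap, rule sum.cong[OF refl], subst sum.swap) (simp add: mult.assoc)
      also have "\<dots> = (\<Sum>i\<in>I. \<Sum>j\<in>I. u i * v j * (\<Sum>k\<in>I. ?c i j k * ?t k l))"
        by (simp add: sum_distrib_left)
      also have "\<dots> = (\<Sum>i\<in>I. \<Sum>j\<in>I. u i * v j * (\<Sum>a\<in>J. \<Sum>b\<in>J. ?t i a * ?t j b * ?c' a b l))"
        using change_mult[OF f1 f2 _ _ l] by simp
      also have "\<dots> = (\<Sum>i\<in>I. \<Sum>a\<in>J. \<Sum>j\<in>I. \<Sum>b\<in>J. u i * ?t i a * (v j * ?t j b) * ?c' a b l)"
        by (rule sum.cong[OF refl], subst sum.swap) (simp add: sum_distrib_left mult_ac)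
      also have "\<dots> = (\<Sum>a\<in>J. \<Sum>i\<in>I. \<Sum>b\<in>J. \<Sum>j\<in>I. u i * ?t i a * (v j * ?t j b) * ?c' a b l)"
        by (subst sum.swap, intro sum.cong refl, rule sum.swap)
      also have "\<dots> = (\<Sum>a\<in>J. \<Sum>b\<in>J. \<Sum>i\<in>I. \<Sum>j\<in>I. u i * ?t i a * (v j * ?t j b) * ?c' a b l)"
        by (rule sum.cong[OF refl], rule sum.swap)
      also have "\<dots> = (\<Sum>a\<in>J. \<Sum>b\<in>J. (\<Sum>i\<in>I. u i * ?t i a) * (\<Sum>j\<in>I. v j * ?t j b) * ?c' a b l)"
        by (simp add: sum_distrib_left sum_distrib_right,
            rule sum.cong[OF refl], rule sum.cong[OF refl], rule sum.swap)
      also have "\<dots> = (?f u \<otimes>\<^bsub>?N\<^esub> ?f v) l"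
        using l by (simp add: sc_simps(2) sc_mult_def change_map_def sum_apply)
      finally show ?thesis .
    qed
  qed
  moreover have "?f ` part ?M i = part ?N i" for i
  proof
    show "?f ` part ?M i \<subseteq> part ?N i" using change_map_part fin by blast
    show "part ?N i \<subseteq> ?f ` part ?M i"
    proof
      fix v assume v: "v \<in> part ?N i"
      then have "v = ?f (?g v)" using change_map_inverse[OF f2 f1, of v ?c'] sc_part_carrier by metis
      moreover have "?g v \<in> part ?M i" using change_map_part[OF v fin(2)] .
      ultimately show "v \<in> ?f ` part ?M i" by blast
    qed
  qed
  ultimately show ?thesis unfolding lie_iso_def by blast
qed

section \<open>The frame defined by a Jordan decomposition\<close>

context
  fixes n1 n2 n3 x assumes jd: "jordan_decomposition L d n1 n2 n3 x"
begin

abbreviation "JI \<equiv> jordan_indices n1 n2 n3"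
abbreviation "JB \<equiv> jordan_vector d x ` JI"
abbreviation \<kappa> :: "'v \<Rightarrow> nat \<times> nat \<Rightarrow> 'k" where "\<kappa> v ik \<equiv> basis_coeff L JB v (jordan_vector d x ik)"

lemma JI_finite: "finite JI" by (auto simp: jordan_indices_def)
lemma JB_finite: "finite JB" using JI_finite by simp
lemma JB_basis: "basis JB" and JB_inj: "inj_on (jordan_vector d x) JI"
  and block_zero: "i < n1 + n2 + n3 \<Longrightarrow> (d ^^ block_size n1 n2 i) (x i) = \<zero>"
  using jd by (auto simp: jordan_decomposition_def)

lemma block_size_pos: "block_size n1 n2 i > 0" by (simp add: block_size_def)

lemma x_carrier: "i < n1 + n2 + n3 \<Longrightarrow> x i \<in> carrier L"
proof -
  assume "i < n1 + n2 + n3"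
  then have "(i, 0) \<in> JI" using block_size_pos by (auto simp: jordan_indices_def)
  then have "jordan_vector d x (i, 0) \<in> JB" by blast
  then show ?thesis using basis_carrier[OF JB_basis JB_finite] by (auto simp: jordan_vector_def)
qed

lemma kappa_lin: "ik \<in> JI \<Longrightarrow> lin_fun (\<lambda>v. \<kappa> v ik)"
  by (rule lin_fun_coeff[OF JB_basis JB_finite]) simp

lemma kappa_basis: "ik \<in> JI \<Longrightarrow> jl \<in> JI \<Longrightarrow> \<kappa> (jordan_vector d x jl) ik = (if ik = jl then 1 else 0)"
  using JB_inj by (auto simp: coeff_basis[OF JB_basis JB_finite] inj_on_eq_iff)

lemma F_expand: "lin_fun F \<Longrightarrow> v \<in> carrier L \<Longrightarrow> F v = (\<Sum>ik\<in>JI. \<kappa> v ik * F (jordan_vector d x ik))"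
  using lin_fun_expand[OF JB_basis JB_finite, of F v] by (simp add: sum.reindex[OF JB_inj])

lemma d_jordan: "(i, k) \<in> JI \<Longrightarrow> d (jordan_vector d x (i, k)) =
    (if (i, Suc k) \<in> JI then jordan_vector d x (i, Suc k) else \<zero>)"
proof -
  assume ik: "(i, k) \<in> JI"
  show ?thesis
  proof (cases "(i, Suc k) \<in> JI")
    case False
    then have "Suc k = block_size n1 n2 i" "i < n1 + n2 + n3" using ik by (auto simp: jordan_indices_def)
    then have "(d ^^ Suc k) (x i) = \<zero>" using block_zero[of i] by metis
    then show ?thesis using False by (simp add: jordan_vector_def)
  qed (simp add: jordan_vector_def)
qed

text \<open>Within a block \<open>d\<close> sends each basis vector to the next one, so it shifts
  the coordinates by one place.\<close>

lemma kappa_d: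
  assumes v: "v \<in> carrier L" and ik: "(i, k) \<in> JI"
  shows "\<kappa> (d v) (i, k) = (if k = 0 then 0 else \<kappa> v (i, k - 1))"
proof -
  have lin: "lin_fun (\<lambda>v. \<kappa> (d v) (i, k))"
    using kappa_lin[OF ik] by (simp add: lin_fun_def d_smult d_closed)
  have "\<kappa> (d v) (i, k) = (\<Sum>jl\<in>JI. \<kappa> v jl * \<kappa> (d (jordan_vector d x jl)) (i, k))"
    using F_expand[OF lin v] .
  also have "\<dots> = (\<Sum>jl\<in>JI. if jl = (i, k - 1) \<and> k \<noteq> 0 then \<kappa> v jl else 0)"
  proof (rule sum.cong[OF refl])
    fix jl assume jl: "jl \<in> JI"
    obtain j l where [simp]: "jl = (j, l)" by (cases jl)
    show "\<kappa> v jl * \<kappa> (d (jordan_vector d x jl)) (i, k) = (if jl = (i, k - 1) \<and> k \<noteq> 0 then \<kappa> v jl else 0)"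
    proof (cases "(j, Suc l) \<in> JI")
      case True
      then show ?thesis using d_jordan[of j l] jl kappa_basis[OF ik True] by (cases k) auto
    next
      case False
      then have "\<not> (jl = (i, k - 1) \<and> k \<noteq> 0)" using ik by (cases k) auto
      then show ?thesis using False d_jordan[of j l] jl lin_funD(5)[OF kappa_lin[OF ik] v] by auto
    qed
  qed
  also have "\<dots> = (if k = 0 then 0 else \<kappa> v (i, k - 1))"
  proof (cases "k = 0")
    case False
    then have "(i, k - 1) \<in> JI" using ik by (auto simp: jordan_indices_def)
    then show ?thesis using False JI_finite by simp
  qed simp
  finally show ?thesis .
qed

lemma jordan_frame: "frame {..<n1 + n2} (block_parity n1) x (\<lambda>k v. \<kappa> v (k, 0))"
  unfolding frame_def
proof (intro conjI ballI allI impI)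
  show "finite {..<n1 + n2}" by simp
next
  fix j assume j: "j \<in> {..<n1 + n2}"
  have j0: "(j, 0) \<in> JI" using j block_size_pos by (auto simp: jordan_indices_def)
  show "x j \<in> ker (block_parity n1 j)"
    using j x_carrier[of j] block_zero[of j]
    by (auto simp: ker_def block_parity_def block_size_def numeral_2_eq_2 split: if_splits)
  show "lin_fun (\<lambda>v. \<kappa> v (j, 0))" by (rule kappa_lin[OF j0])
  show "\<kappa> (d v) (j, 0) = 0" if "v \<in> carrier L" for v using kappa_d[OF that j0] by simp
  show "\<kappa> v (j, 0) = 0" if "block_parity n1 j = 1" "v \<in> carrier L" "d v = \<zero>" for v
  proof -
    have j1: "(j, 1) \<in> JI" using j that(1) by (auto simp: jordan_indices_def block_parity_def block_size_def split: if_splits)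
    show ?thesis using kappa_d[OF that(2) j1] that(3) lin_funD(5)[OF kappa_lin[OF j1] that(2)] by simp
  qed
next
  fix j k assume "j \<in> {..<n1 + n2}" "k \<in> {..<n1 + n2}" 
  then have "(j, 0) \<in> JI" "(k, 0) \<in> JI" using block_size_pos by (auto simp: jordan_indices_def)
  from kappa_basis[OF this] show "\<kappa> (x k) (j, 0) = (if j = k then 1 else 0)" by (simp add: jordan_vector_def)
next
  fix q F v assume F: "lin_fun F" "kills q F" and v: "v \<in> ker q"
  let ?N = "{..<n1 + n2 + n3}" and ?J = "{j \<in> {..<n1 + n2}. block_parity n1 j = q}"
  let ?h = "\<lambda>i k. \<kappa> v (i, k) * F ((d ^^ k) (x i))"
  have vc: "v \<in> carrier L" using v by (simp add: ker_def)
  have zero: "\<kappa> \<zero> ik = 0" if "ik \<in> JI" for ik using lin_funD(5)[OF kappa_lin[OF that] vc] .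
  have "F v = (\<Sum>i\<in>?N. \<Sum>k<block_size n1 n2 i. ?h i k)"
  proof -
    have "F v = (\<Sum>(i, k)\<in>JI. ?h i k)"
      unfolding F_expand[OF F(1) vc] by (rule sum.cong) (auto simp: jordan_vector_def)
    also have "\<dots> = (\<Sum>i\<in>?N. \<Sum>k<block_size n1 n2 i. ?h i k)"
      unfolding jordan_indices_def[of n1 n2 n3] by (rule sum.Sigma[symmetric]) auto
    finally show ?thesis .
  qed
  also have "\<dots> = (\<Sum>i\<in>?J. ?h i 0)"
  proof (rule sum.mono_neutral_cong_right)
    show "\<forall>i\<in>?N - ?J. (\<Sum>k<block_size n1 n2 i. ?h i k) = 0"
    proof
      fix i assume i: "i \<in> ?N - ?J"
      have xc: "x i \<in> carrier L" using i x_carrier by simp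
      have idx: "(i, k) \<in> JI" if "k < block_size n1 n2 i" for k using i that by (auto simp: jordan_indices_def)
      \<comment> \<open>Each product vanishes either because the coordinate of \<open>v\<close>
        does, \<open>v\<close> being in \<open>ker q\<close>, or because \<open>F\<close> kills the
        basis vector.\<close>
      have "?h i k = 0" if k: "k < block_size n1 n2 i" for k
      proof (cases "q = 0")
        case True
        then have n1: "\<not> i < n1" using i by (auto simp: block_parity_def)
        have dv: "d v = \<zero>" using v True by (simp add: ker_def)
        show ?thesis
        proof (cases "Suc k < block_size n1 n2 i")
          case True
          then show ?thesis using kappa_d[OF vc idx[OF True]] dv zero[OF idx[OF True]] by simp
        next
          \<comment> \<open>At the end of a block of size at least 2 the coordinate may survive, but
            the vector is then a \<open>d\<close>-image annihilated by \<open>d\<close>, which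
            \<open>F\<close> kills.\<close>
          case False
          then have k2: "Suc k = block_size n1 n2 i" using k by simp
          then obtain k' where k': "k = Suc k'" using n1 by (cases k) (auto simp: block_size_def split: if_splits)
          have c: "(d ^^ m) (x i) \<in> carrier L" for m using xc by (induction m) (auto simp: d_closed)
          have "(d ^^ Suc (Suc k')) (x i) = \<zero>" using block_zero[of i] i k2 k' by simp
          then have "d (d ((d ^^ k') (x i))) = \<zero>" by simp
          then have "F (d ((d ^^ k') (x i))) = 0" using F(2) \<open>q = 0\<close> c by (simp add: kills_def)
          then show ?thesis using k' by simp
        qed
      next
        case False
        then have q: "q = 1" by simp
        have ddv: "d (d v) = \<zero>" using v False by (simp add: ker_def)
        have Fd: "F (d y) = 0" if "y \<in> carrier L" for y using F(2) False that by (simp add: kills_def)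
        have c: "(d ^^ m) (x i) \<in> carrier L" for m using xc by (induction m) (auto simp: d_closed)
        show ?thesis
        proof (cases k)
          case (Suc k') then show ?thesis using Fd[OF c] by simp
        next
          case 0
          consider "i < n1" | "n1 + n2 \<le> i" using i q by (auto simp: block_parity_def split: if_splits)
          then show ?thesis
          proof cases
            case 1
            then have "d (x i) = \<zero>" using block_zero[of i] by (simp add: block_size_def)
            then have "F (x i) = 0" using F(2) False xc by (simp add: kills_def)
            then show ?thesis using 0 by simp
          next
            case 2
            then have i12: "(i, 1) \<in> JI" "(i, 2) \<in> JI" using idx by (auto simp: block_size_def)
            \<comment> \<open>Applying \<open>d\<close> twice moves the coordinate at the top of a
              block of size 3 to its bottom, where it is read off from
              \<open>d (d v) = 0\<close>.\<close>
            have "\<kappa> v (i, 0) = \<kappa> (d (d v)) (i, 2)"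
              using kappa_d[OF vc i12(1)] kappa_d[OF d_closed[OF vc] i12(2)] by simp
            then show ?thesis using 0 ddv zero[OF i12(2)] by simp
          qed
        qed
      qed
      then show "(\<Sum>k<block_size n1 n2 i. ?h i k) = 0" by (intro sum.neutral) auto
    qed
    fix i assume i: "i \<in> ?J"
    show "(\<Sum>k<block_size n1 n2 i. ?h i k) = ?h i 0"
    proof (cases "i < n1")
      case True then show ?thesis by (simp add: block_size_def)
    next
      case False
      then have q: "q = 1" and bs: "block_size n1 n2 i = 2" using i by (auto simp: block_parity_def block_size_def)
      have "F (d (x i)) = 0" using F(2) q x_carrier[of i] i by (simp add: kills_def)
      then show ?thesis by (simp add: bs numeral_2_eq_2)
    qed
  qed auto
  also have "\<dots> = (\<Sum>j\<in>?J. \<kappa> v (j, 0) * F (x j))" by simp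
  finally show "F v = (\<Sum>j\<in>?J. \<kappa> v (j, 0) * F (x j))" .
qed

lemma semisimplification_frame:
  "semisimplification L d n1 n2 n3 x = sc_algebra {..<n1 + n2} (block_parity n1) (frame_coeff (block_parity n1) x (\<lambda>k v. \<kappa> v (k, 0)))"
proof -
  have c: "semisimplification_coeff L d n1 n2 n3 x = frame_coeff (block_parity n1) x (\<lambda>k v. \<kappa> v (k, 0))"
    by (intro ext) (auto simp: semisimplification_coeff_def frame_coeff_def Let_def brk_def jordan_vector_def)
  have mult: "(\<lambda>v w k. if k < n1 + n2 then \<Sum>i<n1 + n2. \<Sum>j<n1 + n2. v i * w j * semisimplification_coeff L d n1 n2 n3 x i j k else 0) =
     sc_mult {..<n1 + n2} (semisimplification_coeff L d n1 n2 n3 x)"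
    by (intro ext) (simp add: sc_mult_def)
  show ?thesis unfolding semisimplification_def unfolding mult unfolding c by (auto simp: sc_algebra_def not_less)
qed

end

end

section \<open>Structure constants in tables\<close>

text \<open>Keys are read bit by bit, least significant bit first, so a look-up takes as many
  rewriting steps as the key has binary digits.\<close>

datatype 'a trie = Leaf | Node 'a "'a trie" "'a trie"

fun look :: "'a \<Rightarrow> 'a trie \<Rightarrow> num \<Rightarrow> 'a" where
  "look d Leaf n = d"
| "look d (Node a l r) num.One = a"
| "look d (Node a l r) (num.Bit0 n) = look d l n"
| "look d (Node a l r) (num.Bit1 n) = look d r n"

fun ins :: "'a \<Rightarrow> num \<Rightarrow> 'a \<Rightarrow> 'a trie \<Rightarrow> 'a trie" where
  "ins d num.One x Leaf = Node x Leaf Leaf"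
| "ins d (num.Bit0 n) x Leaf = Node d (ins d n x Leaf) Leaf"
| "ins d (num.Bit1 n) x Leaf = Node d Leaf (ins d n x Leaf)"
| "ins d num.One x (Node a l r) = Node x l r"
| "ins d (num.Bit0 n) x (Node a l r) = Node a (ins d n x l) r"
| "ins d (num.Bit1 n) x (Node a l r) = Node a l (ins d n x r)"

lemma look_ins: "look d (ins d i x t) j = (if i = j then x else look d t j)"
  by (induction d i x t arbitrary: j rule: ins.induct; case_tac j; simp)

text \<open>Basis vectors are indexed by \<^typ>\<open>num\<close> so that table lookup is pattern matching; \<open>trow T i\<close> lists the
  brackets with the \<open>i\<close>-th basis vector, as integer linear combinations.\<close>

type_synonym lin = "(num \<times> int) list"
type_synonym tab = "lin trie trie"

definition trow :: "tab \<Rightarrow> num \<Rightarrow> lin trie" where "trow T i = look Leaf T i"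
definition ent :: "lin trie \<Rightarrow> num \<Rightarrow> lin" where "ent R i = look [] R i"

primrec neg :: "lin \<Rightarrow> lin" where "neg [] = []" | "neg (x # l) = (fst x, - snd x) # neg l"

primrec scl :: "int \<Rightarrow> lin \<Rightarrow> lin \<Rightarrow> lin" where
  "scl c [] acc = acc"
| "scl c (x # l) acc = (fst x, c * snd x) # scl c l acc"

text \<open>Adds to \<open>acc\<close> the bracket of the basis vector with row \<open>R\<close> and
  the given combination, scaled by \<open>s\<close>. \<open>lapp\<close> is the mirror image, with
  the combination on the left and its rows fetched in advance.\<close>

primrec app :: "lin trie \<Rightarrow> int \<Rightarrow> lin \<Rightarrow> lin \<Rightarrow> lin" where
  "app R s [] acc = acc"
| "app R s (x # l) acc = scl (s * snd x) (ent R (fst x)) (app R s l acc)"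

primrec rows :: "tab \<Rightarrow> lin \<Rightarrow> (lin trie \<times> int) list" where
  "rows T [] = []" | "rows T (x # l) = (trow T (fst x), snd x) # rows T l"

primrec lapp :: "(lin trie \<times> int) list \<Rightarrow> int \<Rightarrow> num \<Rightarrow> lin \<Rightarrow> lin" where
  "lapp [] s i acc = acc"
| "lapp (x # rs) s i acc = scl (s * snd x) (ent (fst x) i) (lapp rs s i acc)"

primrec lapps :: "(lin trie \<times> int) list \<Rightarrow> lin \<Rightarrow> lin" where
  "lapps rs [] = []" | "lapps rs (x # l) = lapp rs (snd x) (fst x) (lapps rs l)"

text \<open>Combinations are never normalized and may list an index several times; its actual
  coefficient is this sum.\<close>

primrec sumk :: "num \<Rightarrow> lin \<Rightarrow> int" where
  "sumk k [] = 0" | "sumk k (x # l) = (if fst x = k then snd x + sumk k l else sumk k l)"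

primrec delk :: "num \<Rightarrow> lin \<Rightarrow> lin" where
  "delk k [] = []" | "delk k (x # l) = (if fst x = k then delk k l else x # delk k l)"

lemma length_delk: "length (delk k l) \<le> length l" by (induction l) auto

text \<open>The coefficients stand for elements of a field of characteristic 3. Only small ones occur, so the tests
  \<open>zerob\<close> and \<open>unitb\<close> list the relevant residues instead of reducing modulo 3.\<close>

function zerob :: "lin \<Rightarrow> bool" where
  "zerob [] = True"
| "zerob (x # l) = (let s = snd x + sumk (fst x) l in
     if s = 0 \<or> s = 3 \<or> s = -3 \<or> s = 6 \<or> s = -6 then zerob (delk (fst x) l) else False)"
  by pat_completeness auto
termination by (relation "measure length") (auto simp: le_imp_less_Suc length_delk)

primrec is_mem :: "num \<Rightarrow> num list \<Rightarrow> bool" where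
  "is_mem k [] = False" | "is_mem k (x # xs) = (if k = x then True else is_mem k xs)"

lemma is_mem_iff: "is_mem k xs \<longleftrightarrow> k \<in> set xs" by (induction xs) auto

definition mem_all :: "num list \<Rightarrow> num list \<Rightarrow> bool" where "mem_all xs ys = list_all (\<lambda>x. is_mem x ys) xs"

lemma mem_all_iff: "mem_all xs ys \<longleftrightarrow> set xs \<subseteq> set ys"
  by (auto simp: mem_all_def list_all_iff is_mem_iff)

primrec check_row :: "(num \<Rightarrow> lin \<Rightarrow> bool) \<Rightarrow> lin trie \<Rightarrow> num list \<Rightarrow> bool" where
  "check_row P R [] = True"
| "check_row P R (j # js) = (if P j (ent R j) then check_row P R js else False)"

primrec check_tab :: "(num \<Rightarrow> num \<Rightarrow> lin \<Rightarrow> bool) \<Rightarrow> tab \<Rightarrow> num list \<Rightarrow> num list \<Rightarrow> bool" where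
  "check_tab P T js [] = True"
| "check_tab P T js (i # is) = (if check_row (P i) (trow T i) js then check_tab P T js is else False)"

lemma check_tabD: "check_tab P T js is \<Longrightarrow> i \<in> set is \<Longrightarrow> j \<in> set js \<Longrightarrow> P i j (ent (trow T i) j)"
proof (induction "is")
  case (Cons i' "is")
  have "check_row Q R js \<Longrightarrow> j \<in> set js \<Longrightarrow> Q j (ent R j)" for Q R js by (induction js) (auto split: if_splits)
  with Cons show ?case by (auto split: if_splits)
qed simp

text \<open>The loops below receive single rows instead of the whole table because each rewriting step of the
  simplifier costs time proportional to the size of the term at hand.\<close>

primrec jac_i :: "lin trie \<Rightarrow> lin trie \<Rightarrow> (lin trie \<times> int) list \<Rightarrow> int \<Rightarrow> num list \<Rightarrow> bool" where
  "jac_i Rg Rj rs s [] = True"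
| "jac_i Rg Rj rs s (i # is) =
    (if zerob (app Rg 1 (ent Rj i) (lapp rs (-1) i (app Rj s (ent Rg i) []))) then jac_i Rg Rj rs s is else False)"

primrec jac_j :: "tab \<Rightarrow> num list \<Rightarrow> (num \<Rightarrow> bool) \<Rightarrow> bool \<Rightarrow> lin trie \<Rightarrow> num list \<Rightarrow> bool" where
  "jac_j T idx od b Rg [] = True"
| "jac_j T idx od b Rg (j # js) =
    (if jac_i Rg (trow T j) (rows T (ent Rg j)) (if b \<and> od j then 1 else -1) idx
     then jac_j T idx od b Rg js else False)"

primrec jac_g :: "tab \<Rightarrow> num list \<Rightarrow> (num \<Rightarrow> bool) \<Rightarrow> num list \<Rightarrow> bool" where
  "jac_g T idx od [] = True"
| "jac_g T idx od (g # gs) = (if jac_j T idx od (od g) (trow T g) idx then jac_g T idx od gs else False)"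

definition cube_check :: "tab \<Rightarrow> num list \<Rightarrow> bool" where
  "cube_check T js = list_all (\<lambda>i. let R = trow T i in zerob (app R 1 (ent R i) [])) js"

primrec combo :: "tab \<Rightarrow> (int \<times> num \<times> num) list \<Rightarrow> lin \<Rightarrow> lin" where
  "combo T [] acc = acc"
| "combo T (x # xs) acc = scl (fst x) (ent (trow T (fst (snd x))) (snd (snd x))) (combo T xs acc)"

primrec gen_check :: "tab \<Rightarrow> (num \<Rightarrow> bool) \<Rightarrow> num list \<Rightarrow> num list \<Rightarrow> (num \<times> (int \<times> num \<times> num) list) list \<Rightarrow> bool" where
  "gen_check T od gs known [] = True"
| "gen_check T od gs known (y # st) =
    (if list_all (\<lambda>x. is_mem (fst (snd x)) gs \<and> is_mem (snd (snd x)) known \<and>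
          (od (fst (snd x)) \<noteq> od (snd (snd x))) = od (fst y)) (snd y) \<and>
        zerob (combo T (snd y) [(fst y, -1)])
     then gen_check T od gs (fst y # known) st else False)"

text \<open>Truncates to the shorter argument; \<open>degree_check\<close> guarantees equal lengths
  for the degrees of basis vectors.\<close>

primrec ladd :: "int list \<Rightarrow> int list \<Rightarrow> int list" where
  "ladd [] ys = []" | "ladd (x # xs) ys = (case ys of [] \<Rightarrow> [] | y # ys' \<Rightarrow> (x + y) # ladd xs ys')"

definition graded_check :: "tab \<Rightarrow> (num \<Rightarrow> int list) \<Rightarrow> num list \<Rightarrow> num list \<Rightarrow> bool" where
  "graded_check T dl idx gs = check_tab (\<lambda>i j l. list_all (\<lambda>x. ladd (dl i) (dl j) = dl (fst x)) l) T idx gs"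

definition unitb :: "int \<Rightarrow> bool" where "unitb a \<longleftrightarrow> a = 1 \<or> a = -1 \<or> a = 2 \<or> a = -2 \<or> a = 4 \<or> a = -4"

definition base_check :: "tab \<Rightarrow> (num \<Rightarrow> int list) \<Rightarrow> num list \<Rightarrow> int list \<Rightarrow> (num \<times> num) list \<Rightarrow> bool" where
  "base_check T dl gs z bs = list_all (\<lambda>y. is_mem (snd y) gs \<and> ladd (dl (snd y)) (dl (fst y)) = z \<and>
     (let l = ent (trow T (snd y)) (fst y) in list_ex (\<lambda>x. unitb (sumk (fst x) l)) l)) bs"

primrec step_check :: "tab \<Rightarrow> num list \<Rightarrow> num list \<Rightarrow> (num \<times> num) list \<Rightarrow> bool" where
  "step_check T gs known [] = True"
| "step_check T gs known (y # st) =
    (if is_mem (snd y) gs \<and> (let l = ent (trow T (snd y)) (fst y) in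
        list_ex (\<lambda>x. unitb (sumk (fst x) l) \<and> zerob (delk (fst x) l) \<and> is_mem (fst x) known) l)
     then step_check T gs (fst y # known) st else False)"

text \<open>Coroots are not entered anywhere: each is computed as the bracket of its two generators,
  and the Cartan matrix is then tested against it.\<close>

definition rel_check :: "tab \<Rightarrow> nat \<Rightarrow> num list \<Rightarrow> num list \<Rightarrow> int list list \<Rightarrow> bool" where
  "rel_check T n es fs A = list_all (\<lambda>i. let rs = rows T (ent (trow T (es ! i)) (fs ! i)) in
     list_all (\<lambda>m. zerob (lapp rs 1 (es ! m) [(es ! m, - (A ! i ! m))]) \<and>
       zerob (lapp rs 1 (fs ! m) [(fs ! m, A ! i ! m)]) \<and>
       (i = m \<or> zerob (ent (trow T (es ! i)) (fs ! m))) \<and>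
       zerob (lapps rs (ent (trow T (es ! m)) (fs ! m)))) [0..<n]) [0..<n]"

section \<open>Interpretation of the tables over a field of characteristic 3, and soundness of the
  checks\<close>

primrec lvec :: "lin \<Rightarrow> num \<Rightarrow> 'k::field" where
  "lvec [] = 0" | "lvec (x # l) = scale (of_int (snd x)) (basis_vec (fst x)) + lvec l"

definition tc :: "tab \<Rightarrow> num \<Rightarrow> num \<Rightarrow> num \<Rightarrow> 'k::field" where
  "tc T i j k = lvec (ent (trow T i) j) k"

definition bpar :: "(num \<Rightarrow> bool) \<Rightarrow> num \<Rightarrow> bit" where "bpar od i = (if od i then 1 else 0)"

lemma scale_minus_one: "scale (- 1) v = - v"
  by (simp add: scale_def fun_eq_iff fun_ops)

lemma vec_scl: "lvec (scl a l acc) = scale (of_int a) (lvec l) + lvec acc"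
  by (induction l) (auto simp: scale_simps)

lemma vec_neg: "lvec (neg l) = - lvec l"
  by (induction l) (auto simp: scale_def fun_eq_iff fun_ops)

lemma vec_outside: "k \<notin> fst ` set l \<Longrightarrow> lvec l k = 0"
  by (induction l) (auto simp: fun_ops scale_def basis_vec_def)

lemma vec_split: "lvec l = scale (of_int (sumk k l)) (basis_vec k) + lvec (delk k l)"
  by (induction l) (auto simp: scale_simps)

lemma vec_delk: "lvec (delk k l) k = 0"
  by (induction l) (auto simp: fun_ops scale_def basis_vec_def)

lemma neg_neg: "neg (neg l) = l" by (induction l) auto

locale char3 =
  fixes K :: "'k::field itself"
  assumes three: "(3::'k) = 0"
begin

lemma of_int_multiples: "of_int s = (0::'k)" if "s = 0 \<or> s = 3 \<or> s = -3 \<or> s = 6 \<or> s = -6"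
proof -
  have "(6::'k) = 3 + 3" by simp
  then show ?thesis using that three by auto
qed

lemma vec_zerob: "zerob l \<Longrightarrow> (lvec l :: num \<Rightarrow> 'k) = 0"
proof (induction l rule: zerob.induct)
  case (2 x l)
  then have s: "of_int (snd x + sumk (fst x) l) = (0::'k)" and IH: "(lvec (delk (fst x) l) :: num \<Rightarrow> 'k) = 0"
    by (auto simp: Let_def of_int_multiples simp del: of_int_add split: if_splits)
  have "(lvec (x # l) :: num \<Rightarrow> 'k) = scale (of_int (snd x + sumk (fst x) l)) (basis_vec (fst x)) + lvec (delk (fst x) l)"
    using vec_split[of l "fst x"] by (simp add: scale_simps add.assoc)
  then show ?case unfolding s IH by (simp add: scale_simps)
qed simp

text \<open>From 3 = 0 follows 4 = 1, and 2 = 0 would give 1 = 3 - 2 = 0.\<close>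

lemma unitb_nz: assumes "unitb a" shows "of_int a \<noteq> (0::'k)"
proof -
  have "(1::'k) = 3 - 2" "(4::'k) = 3 + 1" by simp_all
  then have "(2::'k) \<noteq> 0" "(4::'k) = 1" using three by (metis diff_0_right zero_neq_one, simp)
  then show ?thesis using assms by (auto simp: unitb_def)
qed

end

locale table = char3 K for K :: "'k::field itself" +
  fixes T :: tab and idx :: "num list" and od :: "num \<Rightarrow> bool"
  assumes closed: "\<lbrakk>i \<in> set idx; j \<in> set idx; x \<in> set (ent (trow T i) j)\<rbrakk> \<Longrightarrow> fst x \<in> set idx"
begin

abbreviation "I \<equiv> set idx"
abbreviation c :: "num \<Rightarrow> num \<Rightarrow> num \<Rightarrow> 'k" where "c \<equiv> tc T"
abbreviation B (infixl "\<star>" 70) where "B \<equiv> sc_mult I c"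
abbreviation bv :: "num \<Rightarrow> num \<Rightarrow> 'k" where "bv \<equiv> basis_vec"
abbreviation "p \<equiv> bpar od"
abbreviation "M \<equiv> sc_algebra I p c"

lemma closed': "i \<in> I \<Longrightarrow> j \<in> I \<Longrightarrow> fst ` set (ent (trow T i) j) \<subseteq> I"
  using closed by auto

lemma mult_bv: assumes "i \<in> I" "j \<in> I" shows "bv i \<star> bv j = lvec (ent (trow T i) j)"
proof
  fix k show "(bv i \<star> bv j) k = lvec (ent (trow T i) j) k"
    using vec_outside[of k "ent (trow T i) j"] closed'[OF assms]
    by (cases "k \<in> I") (auto simp: sc_mult_unit assms tc_def subset_iff)
qed

lemma vec_app: "i \<in> I \<Longrightarrow> fst ` set l \<subseteq> I \<Longrightarrow> lvec (app (trow T i) s l acc) = scale (of_int s) (bv i \<star> lvec l) + lvec acc"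
  by (induction l) (auto simp: vec_scl mult_bv[symmetric] sc_mult_linear scale_simps algebra_simps)

lemma vec_lapp: "i \<in> I \<Longrightarrow> fst ` set l \<subseteq> I \<Longrightarrow> lvec (lapp (rows T l) s i acc) = scale (of_int s) (lvec l \<star> bv i) + lvec acc"
  by (induction l) (auto simp: vec_scl mult_bv[symmetric] sc_mult_linear scale_simps algebra_simps)

lemma vec_lapps: "fst ` set l \<subseteq> I \<Longrightarrow> fst ` set m \<subseteq> I \<Longrightarrow> lvec (lapps (rows T l) m) = lvec l \<star> lvec m"
  by (induction m) (auto simp: vec_lapp sc_mult_linear)

lemma jac_gD:
  assumes "jac_g T idx od gs" "g \<in> set gs" "set gs \<subseteq> I" and ij: "i \<in> I" "j \<in> I"
  shows "bv g \<star> (bv i \<star> bv j) = (bv g \<star> bv i) \<star> bv j + ssgn (p g) (p i) (bv i \<star> (bv g \<star> bv j))"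
proof -
  have g: "g \<in> I" using assms by auto
  have i: "jac_i Rg Rj rs s is \<Longrightarrow> a \<in> set is \<Longrightarrow> zerob (app Rg 1 (ent Rj a) (lapp rs (-1) a (app Rj s (ent Rg a) [])))" for Rg Rj rs s "is" a
    by (induction "is") (auto split: if_splits)
  have j: "jac_j T idx od b Rg js \<Longrightarrow> a \<in> set js \<Longrightarrow> jac_i Rg (trow T a) (rows T (ent Rg a)) (if b \<and> od a then 1 else -1) idx" for b Rg js a
    by (induction js) (auto split: if_splits)
  have gg: "jac_g T idx od gs \<Longrightarrow> a \<in> set gs \<Longrightarrow> jac_j T idx od (od a) (trow T a) idx" for gs a
    by (induction gs) (auto split: if_splits)
  \<comment> \<open>The loop tests that a single sum vanishes, so the last term of the Jacobi
    identity enters with the opposite of the Koszul sign.\<close>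
  let ?s = "if od g \<and> od i then 1 else - 1 :: int"
  from vec_zerob[OF i[OF j[OF gg[OF assms(1,2)] ij(1)] ij(2)]]
  have "scale (of_int 1) (bv g \<star> lvec (ent (trow T i) j)) + (scale (of_int (- 1)) (lvec (ent (trow T g) i) \<star> bv j) +
      (scale (of_int ?s) (bv i \<star> lvec (ent (trow T g) j)) + lvec [])) = 0"
    using ij g closed' by (simp add: vec_app vec_lapp)
  then have "bv g \<star> (bv i \<star> bv j) - (bv g \<star> bv i) \<star> bv j + scale (of_int ?s) (bv i \<star> (bv g \<star> bv j)) = 0"
    using ij g by (simp add: mult_bv scale_simps(4) scale_minus_one algebra_simps)
  moreover have "scale (of_int ?s) v = - ssgn (p g) (p i) v" for v :: "num \<Rightarrow> 'k"
    by (auto simp: bpar_def ssgn_def scale_def fun_eq_iff fun_ops)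
  ultimately show ?thesis by (simp add: algebra_simps)
qed

lemma cube_checkD: "cube_check T js \<Longrightarrow> i \<in> set js \<Longrightarrow> i \<in> I \<Longrightarrow> bv i \<star> (bv i \<star> bv i) = 0"
  using vec_zerob[of "app (trow T i) 1 (ent (trow T i) i) []"] closed'
  by (auto simp: cube_check_def list_all_iff vec_app Let_def mult_bv scale_simps)

lemma gen_checkD:
  assumes par: "\<And>i j v w. v \<in> part M i \<Longrightarrow> w \<in> part M j \<Longrightarrow> v \<star> w \<in> part M (i + j)"
    and gs: "set gs \<subseteq> I" "g0 \<in> set gs"
  shows "gen_check T od gs known st \<Longrightarrow> set (map fst st) \<subseteq> I \<Longrightarrow> set known \<subseteq> I \<Longrightarrow>
     (\<And>k. k \<in> set known \<Longrightarrow> bv k \<in> gspan I p c (set gs)) \<Longrightarrow> k \<in> set known \<union> set (map fst st) \<Longrightarrow> bv k \<in> gspan I p c (set gs)"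
proof (induction st arbitrary: known)
  case (Cons y st)
  obtain r xs where y: "y = (r, xs)" by (cases y)
  let ?G = "gspan I p c (set gs)"
  let ?S = "\<lambda>xs. \<Sum>x\<leftarrow>xs. scale (of_int (fst x)) (bv (fst (snd x)) \<star> bv (snd (snd x)))"
  have xs: "\<And>x. x \<in> set xs \<Longrightarrow> fst (snd x) \<in> set gs \<and> snd (snd x) \<in> set known \<and> (od (fst (snd x)) \<noteq> od (snd (snd x))) = od r"
    and z: "zerob (combo T xs [(r, -1)])" and rest: "gen_check T od gs (r # known) st"
    using Cons.prems(1) by (auto simp: y list_all_iff is_mem_iff split: if_splits)
  have zero: "0 \<in> ?G" using gspan_scale[OF gspan_gen[OF gs(2)], of 0] by (simp add: scale_simps)
  \<comment> \<open>Partial sums must keep the parity of \<open>r\<close>, since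
    \<open>gspan\<close> adds only vectors of equal parity; this is why the certificate also checks
    the parities of its terms.\<close>
  have "?S xs \<in> ?G \<and> ?S xs \<in> part M (p r)" if "\<And>x. x \<in> set xs \<Longrightarrow> fst (snd x) \<in> set gs \<and> snd (snd x) \<in> set known \<and> (od (fst (snd x)) \<noteq> od (snd (snd x))) = od r" for xs
    using that
  proof (induction xs)
    case (Cons x xs)
    let ?v = "scale (of_int (fst x)) (bv (fst (snd x)) \<star> bv (snd (snd x)))"
    have m: "fst (snd x) \<in> I" "snd (snd x) \<in> I" "fst (snd x) \<in> set gs" "snd (snd x) \<in> set known"
      using Cons.prems[of x] gs(1) \<open>set known \<subseteq> I\<close> by auto
    have "p (fst (snd x)) + p (snd (snd x)) = p r" using Cons.prems[of x] by (auto simp: bpar_def)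
    then have "bv (fst (snd x)) \<star> bv (snd (snd x)) \<in> part M (p r)"
      using par[OF basis_vec_part[OF m(1), of p c] basis_vec_part[OF m(2), of p c]] by simp
    then have "?v \<in> part M (p r)" by (rule sc_part_closed)
    moreover have "?v \<in> ?G" using m \<open>\<And>k. k \<in> set known \<Longrightarrow> bv k \<in> ?G\<close> by (intro gspan_scale gspan_mult) auto
    moreover have "?S xs \<in> ?G \<and> ?S xs \<in> part M (p r)" using Cons by auto
    ultimately show ?case by (auto intro: gspan_add sc_part_closed)
  qed (simp add: zero zero_part)
  from this[of xs] xs have S: "?S xs \<in> ?G" by blast
  have "lvec (combo T xs acc) = ?S xs + lvec acc" if "\<And>x. x \<in> set xs \<Longrightarrow> fst (snd x) \<in> I \<and> snd (snd x) \<in> I" for xs acc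
    using that by (induction xs) (auto simp: vec_scl mult_bv add.assoc)
  from this[of xs "[(r, -1)]"] have "lvec (combo T xs [(r, -1)]) = ?S xs - bv r"
    using xs gs(1) \<open>set known \<subseteq> I\<close> by (force simp: scale_def fun_eq_iff fun_ops)
  then have "bv r = ?S xs" using vec_zerob[OF z] by simp
  then have r: "bv r \<in> ?G" using S by simp
  show ?case
    by (rule Cons.IH[OF rest]) (use Cons.prems r y in auto)
qed auto

lemma base_checkD:
  assumes "base_check T dl gs z bs" "y \<in> set bs" "fst y \<in> I" "set gs \<subseteq> I"
  shows "snd y \<in> set gs" "bv (snd y) \<star> bv (fst y) \<noteq> 0" "ladd (dl (snd y)) (dl (fst y)) = z"
proof -
  let ?l = "ent (trow T (snd y)) (fst y)"
  have *: "snd y \<in> set gs" "ladd (dl (snd y)) (dl (fst y)) = z" "list_ex (\<lambda>x. unitb (sumk (fst x) ?l)) ?l"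
    using assms by (auto simp: base_check_def list_all_iff is_mem_iff Let_def)
  then obtain x where l: "unitb (sumk (fst x) ?l)" by (auto simp: list_ex_iff)
  have "(lvec ?l :: num \<Rightarrow> 'k) (fst x) = of_int (sumk (fst x) ?l)"
    using arg_cong[OF vec_split[of ?l "fst x"], of "\<lambda>v. v (fst x) :: 'k"] by (simp add: fun_ops vec_delk scale_def basis_vec_def)
  then have "(lvec ?l :: num \<Rightarrow> 'k) \<noteq> 0" using unitb_nz[OF l] by (auto simp: fun_ops)
  then show "bv (snd y) \<star> bv (fst y) \<noteq> 0" using mult_bv[of "snd y" "fst y"] * assms by auto
qed (use assms in \<open>auto simp: base_check_def list_all_iff is_mem_iff Let_def\<close>)

lemma step_checkD:
  assumes "set gs \<subseteq> I"
  shows "step_check T gs known st \<Longrightarrow> set (map fst st) \<subseteq> I \<Longrightarrow> set known \<subseteq> descent I c (set gs) deg \<Longrightarrow>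
     i \<in> set known \<union> set (map fst st) \<Longrightarrow> i \<in> descent I c (set gs) deg"
proof (induction st arbitrary: known)
  case (Cons y st)
  let ?l = "ent (trow T (snd y)) (fst y)"
  have g: "snd y \<in> set gs" and rest: "step_check T gs (fst y # known) st"
    using Cons.prems(1) by (auto simp: is_mem_iff split: if_splits)
  obtain x where x: "unitb (sumk (fst x) ?l)" "zerob (delk (fst x) ?l)" "fst x \<in> set known"
    using Cons.prems(1) by (auto simp: is_mem_iff list_ex_iff Let_def split: if_splits)
  have eq: "bv (snd y) \<star> bv (fst y) = scale (of_int (sumk (fst x) ?l)) (bv (fst x))"
    using mult_bv[of "snd y" "fst y"] g assms Cons.prems(2) vec_split[of ?l "fst x", where 'a = 'k] vec_zerob[OF x(2)]
    by (auto simp: subset_iff)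
  have "fst y \<in> descent I c (set gs) deg"
    by (rule descent_step[OF g _ unitb_nz[OF x(1)] eq]) (use Cons.prems(2,3) x(3) in auto)
  then show ?case by (intro Cons.IH[OF rest]) (use Cons.prems in auto)
qed auto

lemma rel_checkD:
  assumes rc: "rel_check T n es fs A" and I: "\<And>m. m < n \<Longrightarrow> es ! m \<in> I \<and> fs ! m \<in> I" and im: "i < n" "m < n"
  shows "(bv (es ! i) \<star> bv (fs ! i)) \<star> bv (es ! m) = scale (of_int (A ! i ! m)) (bv (es ! m))"
    "(bv (es ! i) \<star> bv (fs ! i)) \<star> bv (fs ! m) = - scale (of_int (A ! i ! m)) (bv (fs ! m))"
    "i \<noteq> m \<Longrightarrow> bv (es ! i) \<star> bv (fs ! m) = 0"
    "(bv (es ! i) \<star> bv (fs ! i)) \<star> (bv (es ! m) \<star> bv (fs ! m)) = 0"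
proof -
  let ?h = "\<lambda>i. ent (trow T (es ! i)) (fs ! i)"
  have z: "zerob (lapp (rows T (?h i)) 1 (es ! m) [(es ! m, - (A ! i ! m))])"
    "zerob (lapp (rows T (?h i)) 1 (fs ! m) [(fs ! m, A ! i ! m)])"
    "i = m \<or> zerob (ent (trow T (es ! i)) (fs ! m))" "zerob (lapps (rows T (?h i)) (?h m))"
    using rc im by (auto simp: rel_check_def list_all_iff Let_def)
  have cl: "fst ` set (?h i) \<subseteq> I" "fst ` set (?h m) \<subseteq> I" using I im closed' by auto
  have h: "bv (es ! i) \<star> bv (fs ! i) = lvec (?h i)" "bv (es ! m) \<star> bv (fs ! m) = lvec (?h m)" using I im mult_bv by auto
  have sm: "scale (- a) v = - scale a v" for a :: 'k and v :: "num \<Rightarrow> 'k" by (simp add: scale_def fun_eq_iff fun_ops)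
  show "(bv (es ! i) \<star> bv (fs ! i)) \<star> bv (es ! m) = scale (of_int (A ! i ! m)) (bv (es ! m))"
    using vec_zerob[OF z(1)] I[OF im(2)] cl by (simp add: vec_lapp h scale_simps sm)
  show "(bv (es ! i) \<star> bv (fs ! i)) \<star> bv (fs ! m) = - scale (of_int (A ! i ! m)) (bv (fs ! m))"
    using vec_zerob[OF z(2)] I[OF im(2)] cl by (simp add: vec_lapp h scale_simps eq_neg_iff_add_eq_0)
  show "bv (es ! i) \<star> bv (fs ! m) = 0" if "i \<noteq> m" using z(3) that vec_zerob I im mult_bv by auto
  show "(bv (es ! i) \<star> bv (fs ! i)) \<star> (bv (es ! m) \<star> bv (fs ! m)) = 0"
    using vec_zerob[OF z(4)] vec_lapps[OF cl] by (simp add: h)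
qed

end

section \<open>Isomorphisms, dual bases and frames\<close>

context class_vectorspace
begin

text \<open>Separation of points replaces a dimension count: a vector and its expansion have equal
  coordinates, so their difference is zero.\<close>

lemma dual_family:
  assumes J: "finite J" and g: "\<And>j. j \<in> J \<Longrightarrow> g j \<in> carrier V" and lf: "\<And>j. j \<in> J \<Longrightarrow> lin_fun (\<pi> j)"
    and dual: "\<And>i j. \<lbrakk>i \<in> J; j \<in> J\<rbrakk> \<Longrightarrow> \<pi> i (g j) = (if i = j then 1 else 0)"
    and sep: "\<And>v. \<lbrakk>v \<in> carrier V; \<forall>j\<in>J. \<pi> j v = 0\<rbrakk> \<Longrightarrow> v = \<zero>"
  shows "inj_on g J" "basis (g ` J)" "\<And>v j. \<lbrakk>v \<in> carrier V; j \<in> J\<rbrakk> \<Longrightarrow> basis_coeff V (g ` J) v (g j) = \<pi> j v" "fin_dim"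
proof -
  show inj: "inj_on g J"
  proof (rule inj_onI)
    fix i j assume "i \<in> J" "j \<in> J" "g i = g j"
    then show "i = j" using dual[of i i] dual[of i j] by (auto split: if_splits)
  qed
  let ?S = "g ` J"
  have S: "finite ?S" "?S \<subseteq> carrier V" using J g by auto
  define h where "h = inv_into J g"
  have h: "h (g j) = j" if "j \<in> J" for j using inj that by (simp add: h_def inv_into_f_f)
  have coeff: "\<pi> j (lincomb a ?S) = a (g j)" if "j \<in> J" for a j
  proof -
    have "\<pi> j (lincomb a ?S) = (\<Sum>i\<in>J. a (g i) * \<pi> j (g i))"
      using lin_fun_finsum[OF lf[OF that] S, of a] by (simp add: sum.reindex[OF inj])
    also have "\<dots> = (\<Sum>i\<in>J. if i = j then a (g i) else 0)" using that by (intro sum.cong refl) (auto simp: dual)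
    also have "\<dots> = a (g j)" using J that by simp
    finally show ?thesis .
  qed
  have expand: "lincomb (\<lambda>b. \<pi> (h b) v) ?S = v" if v: "v \<in> carrier V" for v
  proof -
    let ?w = "lincomb (\<lambda>b. \<pi> (h b) v) ?S"
    have w: "?w \<in> carrier V" using S by (intro lincomb_closed) auto
    have "v \<ominus> ?w = \<zero>"
    proof (rule sep)
      show "v \<ominus> ?w \<in> carrier V" using v w by simp
      show "\<forall>j\<in>J. \<pi> j (v \<ominus> ?w) = 0" using lin_funD(4)[OF lf v w] coeff h by simp
    qed
    moreover have "v = (v \<ominus> ?w) \<oplus> ?w" using v w by (simp add: a_minus_def a_assoc l_neg)
    ultimately show ?thesis using w by simp
  qed
  have "carrier V = span ?S"
  proof
    show "carrier V \<subseteq> span ?S"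
    proof
      fix v assume "v \<in> carrier V"
      from expand[OF this] show "v \<in> span ?S" unfolding finite_span[OF S] by (auto intro!: exI[of _ "\<lambda>b. \<pi> (h b) v"])
    qed
  qed (rule span_is_subset2[OF S(2)])
  then have gen: "gen_set ?S" by simp
  show "fin_dim" unfolding fin_dim_def using S gen by blast
  have "lin_indpt ?S"
  proof (rule finite_lin_indpt2[OF S])
    fix a assume z: "lincomb a ?S = \<zero>"
    have "a (g j) = 0" if "j \<in> J" for j using coeff[OF that, of a] lin_funD(5)[OF lf[OF that] zero_closed] z by simp
    then show "\<forall>v\<in>?S. a v = \<zero>\<^bsub>class_ring\<^esub>" by simp
  qed
  then show basis: "basis ?S" unfolding basis_def using gen S by simp
  show "basis_coeff V ?S v (g j) = \<pi> j v" if "v \<in> carrier V" "j \<in> J" for v j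
    using coeff_eqI[OF basis S(1) expand[OF that(1)], of "g j"] that h by simp
qed

end

lemma sc_algebra_cong:
  assumes "\<And>i j k. \<lbrakk>i \<in> I; j \<in> I; k \<in> I\<rbrakk> \<Longrightarrow> c i j k = c' i j k"
  shows "sc_algebra I p c = sc_algebra I p c'"
proof -
  have "sc_mult I c = sc_mult I c'"
    using assms by (intro ext) (auto simp: sc_mult_def intro!: sum.cong)
  then show ?thesis by (simp add: sc_algebra_def)
qed

lemma sc_super_cong:
  assumes "\<And>i j k. \<lbrakk>i \<in> I; j \<in> I; k \<in> I\<rbrakk> \<Longrightarrow> c i j k = c' i j k" "sc_super I p c"
  shows "sc_super I p c'"
  using assms unfolding sc_super_def by metis

lemma linear_mapI:
  assumes "vectorspace class_ring L" "vectorspace class_ring M" and "\<And>x. x \<in> carrier L \<Longrightarrow> f x \<in> carrier M"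
    and "\<And>x y. \<lbrakk>x \<in> carrier L; y \<in> carrier L\<rbrakk> \<Longrightarrow> f (x \<oplus>\<^bsub>L\<^esub> y) = f x \<oplus>\<^bsub>M\<^esub> f y"
    and "\<And>a x. x \<in> carrier L \<Longrightarrow> f (a \<odot>\<^bsub>L\<^esub> x) = a \<odot>\<^bsub>M\<^esub> f x"
  shows "linear_map (class_ring :: 'k::field ring) L M f"
proof -
  interpret L: vectorspace class_ring L by (rule assms(1))
  interpret M: vectorspace class_ring M by (rule assms(2))
  have "f \<in> LinearCombinations.module_hom class_ring L M"
    unfolding LinearCombinations.module_hom_def using assms(3-5) by auto
  then show ?thesis by unfold_locales
qed

lemma lie_isoD:
  assumes "lie_iso L M \<phi>"
  shows "vectorspace class_ring L" "vectorspace class_ring M" "bij_betw \<phi> (carrier L) (carrier M)"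
    "\<And>x. x \<in> carrier L \<Longrightarrow> \<phi> x \<in> carrier M"
    "\<And>x y. \<lbrakk>x \<in> carrier L; y \<in> carrier L\<rbrakk> \<Longrightarrow> \<phi> (x \<oplus>\<^bsub>L\<^esub> y) = \<phi> x \<oplus>\<^bsub>M\<^esub> \<phi> y"
    "\<And>a x. x \<in> carrier L \<Longrightarrow> \<phi> (a \<odot>\<^bsub>L\<^esub> x) = a \<odot>\<^bsub>M\<^esub> \<phi> x"
    "\<And>x y. \<lbrakk>x \<in> carrier L; y \<in> carrier L\<rbrakk> \<Longrightarrow> \<phi> (x \<otimes>\<^bsub>L\<^esub> y) = \<phi> x \<otimes>\<^bsub>M\<^esub> \<phi> y"
    "\<And>i. \<phi> ` part L i = part M i"
proof -
  interpret phi: linear_map class_ring L M \<phi> using assms by (simp add: lie_iso_def)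
  show "vectorspace class_ring L" "vectorspace class_ring M" by unfold_locales
  show "\<phi> (a \<odot>\<^bsub>L\<^esub> x) = a \<odot>\<^bsub>M\<^esub> \<phi> x" if "x \<in> carrier L" for a x using that by (intro phi.T_smult) auto
qed (use assms in \<open>auto simp: lie_iso_def linear_map_def mod_hom_def mod_hom_axioms_def LinearCombinations.module_hom_def Pi_def\<close>)

lemma lie_iso_compose:
  assumes f: "lie_iso L M \<phi>" and g: "lie_iso M N \<chi>"
  shows "lie_iso L N (\<chi> \<circ> \<phi>)"
  unfolding lie_iso_def
proof (intro conjI ballI allI)
  note f = lie_isoD[OF f] and g = lie_isoD[OF g]
  show "linear_map class_ring L N (\<chi> \<circ> \<phi>)" by (rule linear_mapI[OF f(1) g(2)]) (simp_all add: f g)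
  show "bij_betw (\<chi> \<circ> \<phi>) (carrier L) (carrier N)" by (rule bij_betw_trans[OF f(3) g(3)])
  show "(\<chi> \<circ> \<phi>) (x \<otimes>\<^bsub>L\<^esub> y) = (\<chi> \<circ> \<phi>) x \<otimes>\<^bsub>N\<^esub> (\<chi> \<circ> \<phi>) y" if "x \<in> carrier L" "y \<in> carrier L" for x y
    using that by (simp add: f g)
  show "(\<chi> \<circ> \<phi>) ` part L i = part N i" for i unfolding image_comp[symmetric] f g ..
qed

lemma lie_iso_inverse:
  assumes f: "lie_iso L M \<phi>" and L: "bilinear_algebra L" and part: "\<And>i. part L i \<subseteq> carrier L"
  shows "lie_iso M L (inv_into (carrier L) \<phi>)"
  unfolding lie_iso_def
proof (intro conjI ballI allI)
  note f = lie_isoD[OF f]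
  interpret L: bilinear_algebra L by (rule L)
  let ?g = "inv_into (carrier L) \<phi>"
  have g: "?g y \<in> carrier L" "\<phi> (?g y) = y" if "y \<in> carrier M" for y
    using f(3) that by (auto simp: bij_betw_def inv_into_into f_inv_into_f)
  have gf: "?g (\<phi> x) = x" if "x \<in> carrier L" for x using f(3) that by (auto simp: bij_betw_def)
  show "linear_map class_ring M L ?g"
  proof (rule linear_mapI[OF f(2,1) g(1)])
    show "?g (x \<oplus>\<^bsub>M\<^esub> y) = ?g x \<oplus>\<^bsub>L\<^esub> ?g y" if "x \<in> carrier M" "y \<in> carrier M" for x y
      using gf[of "?g x \<oplus>\<^bsub>L\<^esub> ?g y"] g that by (simp add: f)
    show "?g (a \<odot>\<^bsub>M\<^esub> x) = a \<odot>\<^bsub>L\<^esub> ?g x" if "x \<in> carrier M" for a x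
      using gf[of "a \<odot>\<^bsub>L\<^esub> ?g x"] g that by (simp add: f L.smult_carrier)
  qed
  show "bij_betw ?g (carrier M) (carrier L)" by (rule bij_betw_inv_into[OF f(3)])
  show "?g (x \<otimes>\<^bsub>M\<^esub> y) = ?g x \<otimes>\<^bsub>L\<^esub> ?g y" if "x \<in> carrier M" "y \<in> carrier M" for x y
    using gf[of "?g x \<otimes>\<^bsub>L\<^esub> ?g y"] g that by (simp add: f L.mult_closed)
  show "?g ` part M i = part L i" for i
    unfolding f(8)[symmetric] image_image using gf part by (force simp: subset_iff)
qed

text \<open>With all elements even, the Jacobi identity says that \<open>e\<close> acts as a
  derivation.\<close>

lemma rep_alpha3_ad:
  assumes L: "lie_superalgebra L" and odd: "part L 1 = {\<zero>\<^bsub>L\<^esub>}" and fd: "vectorspace.fin_dim class_ring L"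
    and e: "e \<in> carrier L" and cube: "\<And>x. x \<in> carrier L \<Longrightarrow> e \<otimes>\<^bsub>L\<^esub> (e \<otimes>\<^bsub>L\<^esub> (e \<otimes>\<^bsub>L\<^esub> x)) = \<zero>\<^bsub>L\<^esub>"
  shows "rep_alpha3_lie_algebra L (\<lambda>x. e \<otimes>\<^bsub>L\<^esub> x)"
  unfolding rep_alpha3_lie_algebra_def
proof (intro conjI ballI L odd fd cube)
  interpret lie_superalgebra L by (rule L)
  interpret bilinear_algebra L by (rule lie_superalgebra_bilinear[OF L])
  have sub: "part L 0 \<subseteq> carrier L" using part_subspace[of 0] by (auto simp: VectorSpace.subspace_def submodule_def)
  have even: "x \<in> part L 0" if "x \<in> carrier L" for x
  proof -
    obtain a b where "a \<in> part L 0" "b \<in> part L 1" "x = a \<oplus>\<^bsub>L\<^esub> b" using \<open>x \<in> carrier L\<close> part_sum by (auto simp: set_add_def')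
    then show ?thesis using sub odd by (auto simp: subset_iff)
  qed
  show "linear_map class_ring L L (\<lambda>x. e \<otimes>\<^bsub>L\<^esub> x)"
    by (rule linear_mapI) (simp_all add: vectorspace_axioms e mult_closed mult_add_right mult_smult_right)
  fix x y assume "x \<in> carrier L" "y \<in> carrier L"
  then show "e \<otimes>\<^bsub>L\<^esub> (x \<otimes>\<^bsub>L\<^esub> y) = (e \<otimes>\<^bsub>L\<^esub> x) \<otimes>\<^bsub>L\<^esub> y \<oplus>\<^bsub>L\<^esub> x \<otimes>\<^bsub>L\<^esub> (e \<otimes>\<^bsub>L\<^esub> y)"
    using jacobi[OF even[OF e] even even, of x y] e by (simp add: koszul_def one_smult mult_closed)
qed

context alpha3_lie_algebra
begin

lemma frame_reindex:
  assumes f: "frame J p \<sigma> \<pi>" and r: "bij_betw r J J'"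
    and s: "\<And>j. j \<in> J \<Longrightarrow> p' (r j) = p j \<and> \<sigma>' (r j) = \<sigma> j"
    and pi: "\<And>j v. \<lbrakk>j \<in> J; v \<in> carrier L\<rbrakk> \<Longrightarrow> \<pi>' (r j) v = \<pi> j v"
  shows "frame J' p' \<sigma>' \<pi>'"
proof -
  have J': "J' = r ` J" and inj: "inj_on r J" using r by (auto simp: bij_betw_def)
  have sc: "\<sigma> j \<in> carrier L" if "j \<in> J" for j using frameD(2)[OF f that] .
  show ?thesis
    unfolding frame_def J'
  proof (intro conjI ballI allI impI)
    show "finite (r ` J)" using f by (simp add: frame_def)
  next
    fix j' assume "j' \<in> r ` J"
    then obtain j where j: "j \<in> J" "j' = r j" by blast
    note fj = frameD[OF f j(1)]
    show "\<sigma>' j' \<in> ker (p' j')" using s fj j by simp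
    show "lin_fun (\<pi>' j')" using fj(3) j pi by (simp add: lin_fun_def smult_carrier)
    show "\<pi>' j' (d x) = 0" if "x \<in> carrier L" for x using fj(4)[OF that] j pi[OF j(1) d_closed[OF that]] by simp
    show "\<pi>' j' x = 0" if "p' j' = 1" "x \<in> carrier L" "d x = \<zero>" for x
      using fj(5)[OF _ that(2,3)] j pi[OF j(1) that(2)] s[OF j(1)] that(1) by simp
  next
    fix j' k' assume "j' \<in> r ` J" "k' \<in> r ` J" and pp: "p' j' = p' k'"
    then obtain j k where jk: "j \<in> J" "j' = r j" "k \<in> J" "k' = r k" by blast
    have "\<pi> j (\<sigma> k) = (if j = k then 1 else 0)" using f jk pp s by (simp add: frame_def)
    then show "\<pi>' j' (\<sigma>' k') = (if j' = k' then 1 else 0)"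
      using jk s pi[OF jk(1) sc[OF jk(3)]] inj by (simp add: inj_on_eq_iff)
  next
    fix q F v assume F: "lin_fun F" "kills q F" and v: "v \<in> ker q"
    have vc: "v \<in> carrier L" using v by (simp add: ker_def)
    have eq: "{j' \<in> r ` J. p' j' = q} = r ` {j \<in> J. p j = q}" using s by auto
    have inj': "inj_on r {j \<in> J. p j = q}" using inj by (rule inj_on_subset) auto
    have "(\<Sum>j'\<in>{j' \<in> r ` J. p' j' = q}. \<pi>' j' v * F (\<sigma>' j')) = (\<Sum>j\<in>{j \<in> J. p j = q}. \<pi> j v * F (\<sigma> j))"
      unfolding eq sum.reindex[OF inj'] using s pi[OF _ vc] by (intro sum.cong) auto
    then show "F v = (\<Sum>j'\<in>{j' \<in> r ` J. p' j' = q}. \<pi>' j' v * F (\<sigma>' j'))"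
      using frame_expand[OF f F v] by simp
  qed
qed

text \<open>Parity is built into the coefficients. Antisymmetry comes from the Lie bracket: swapping
  the arguments gives a sign except in the odd-odd formula, which is symmetric. For the table of
  g(1,6) this takes the place of a separate check.\<close>

lemma frame_sc_super: assumes f: "frame J p \<sigma> \<pi>" shows "sc_super J p (frame_coeff p \<sigma> \<pi>)"
proof
  show "finite J" using f by (simp add: frame_def)
  show "p k = p i + p j" if "frame_coeff p \<sigma> \<pi> i j k \<noteq> 0" for i j k
    using that by (auto simp: frame_coeff_def split: if_splits)
  show "frame_coeff p \<sigma> \<pi> i j k = - ssgn (p i) (p j) (frame_coeff p \<sigma> \<pi> j i k)" if ijk: "i \<in> J" "j \<in> J" "k \<in> J" for i j k
  proof -
    have "\<pi> k (brk (p i) (p j) (\<sigma> i) (\<sigma> j)) = (if p i = 1 \<and> p j = 1 then \<pi> k (brk (p j) (p i) (\<sigma> j) (\<sigma> i)) else - \<pi> k (brk (p j) (p i) (\<sigma> j) (\<sigma> i)))"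
      by (rule F_swap[OF frameD(3)[OF f ijk(3)] frameD(2)[OF f ijk(1)] frameD(2)[OF f ijk(2)]])
    moreover have "p j + p i = p i + p j" by (rule add.commute)
    ultimately show ?thesis by (auto simp: frame_coeff_def ssgn_def)
  qed
qed

end

section \<open>The tables of \<open>f4\<close> and \<open>g(1,6)\<close>\<close>

text \<open>Raw tables use integers because the sign of an entry carries its coefficient; the index
  is the absolute value.\<close>

definition num_of :: "int \<Rightarrow> num" where "num_of i = num_of_nat (nat \<bar>i\<bar>)"

lemma num_of_code [code]: "num_of (Int.Pos k) = k" "num_of (Int.Neg k) = k" "num_of 0 = num.One"
  by (auto simp: num_of_def nat_of_num_numeral[symmetric] nat_of_num_inverse num_of_nat.simps)

text \<open>In the raw tables below, \<open>(i, [\<dots>, (j, ks), \<dots>])\<close> with \<open>i < j\<close> says that the bracket of the basis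
  vectors \<open>i\<close> and \<open>j\<close> is the sum of the basis vectors in \<open>ks\<close>, where \<open>- k\<close> stands for minus the \<open>k\<close>-th one.\<close>

primrec terms :: "int list \<Rightarrow> lin" where
  "terms [] = []" | "terms (k # l) = (num_of k, if k < 0 then -1 else 1) # terms l"

fun put :: "num \<Rightarrow> num \<Rightarrow> lin \<Rightarrow> tab \<Rightarrow> tab" where
  "put i j l T = ins Leaf i (ins [] j l (trow T i)) T"

primrec mk_row :: "num \<Rightarrow> (int \<times> int list) list \<Rightarrow> tab \<Rightarrow> tab" where
  "mk_row i [] T = T"
| "mk_row i (x # xs) T = mk_row i xs (let j = num_of (fst x); l = terms (snd x) in put i j l (put j i (neg l) T))"

primrec mk :: "(int \<times> (int \<times> int list) list) list \<Rightarrow> tab \<Rightarrow> tab" where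
  "mk [] T = T"
| "mk (x # xs) T = mk xs (mk_row (num_of (fst x)) (snd x) T)"

definition off_diagonal :: "(int \<times> (int \<times> int list) list) list \<Rightarrow> bool" where
  "off_diagonal raw = list_all (\<lambda>x. list_all (\<lambda>y. num_of (fst x) \<noteq> num_of (fst y)) (snd x)) raw"

lemma ent_put: "ent (trow (put i j l T) a) b = (if a = i \<and> b = j then l else ent (trow T a) b)"
  by (auto simp: trow_def ent_def look_ins)

text \<open>Every entry is written together with its negative at the transposed place.
  \<open>off_diagonal\<close> ensures that the two places differ, so neither write destroys the
  other.\<close>

lemma mk_antisym:
  assumes "off_diagonal raw" "\<And>i j. ent (trow T j) i = neg (ent (trow T i) j)"
  shows "ent (trow (mk raw T) j) i = neg (ent (trow (mk raw T) i) j)"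
proof -
  have row: "(\<And>a b. ent (trow T b) a = neg (ent (trow T a) b)) \<Longrightarrow> list_all (\<lambda>y. k \<noteq> num_of (fst y)) xs \<Longrightarrow>
      ent (trow (mk_row k xs T) j) i = neg (ent (trow (mk_row k xs T) i) j)" for k xs T i j
  proof (induction xs arbitrary: T i j)
    case Nil
    show ?case unfolding mk_row.simps by (rule Nil.prems(1))
  next
    case (Cons y xs)
    have anti: "ent (trow (put k j l (put j k (neg l) T)) b) a = neg (ent (trow (put k j l (put j k (neg l) T)) a) b)"
      if "k \<noteq> j" for j l a b
      using that by (auto simp: ent_put neg_neg simp del: put.simps intro: Cons.prems(1))
    show ?case unfolding mk_row.simps Let_def
      by (rule Cons.IH; (rule anti)?) (use Cons.prems(2) in simp)+
  qed
  show ?thesis using assms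
  proof (induction raw arbitrary: T i j)
    case Nil
    show ?case unfolding mk.simps by (rule Nil.prems(2))
  next
    case (Cons x raw)
    have anti: "ent (trow (mk_row (num_of (fst x)) (snd x) T) j) i = neg (ent (trow (mk_row (num_of (fst x)) (snd x) T) i) j)" for i j
      by (rule row, rule Cons.prems(2)) (use Cons.prems(1) in \<open>simp add: off_diagonal_def\<close>)
    show ?case unfolding mk.simps
      by (rule Cons.IH; (rule anti)?) (use Cons.prems(1) in \<open>simp add: off_diagonal_def\<close>)
  qed
qed

definition f4_table :: "(int \<times> (int \<times> int list) list) list" where
  "f4_table = [
   (1, [(11,[-1]), (12,[-1]), (13,[2]), (15,[4]), (18,[7]), (20,[9]), (21,[-10,11,12]), (28,[-22]), (31,[23]),
     (33,[-24]), (34,[26]), (35,[-29]), (42,[-36]), (45,[37]), (47,[-38]), (48,[40]), (49,[-43])]),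
   (2, [(9,[-1]), (10,[2]), (13,[3]), (14,[4]), (15,[-5]), (17,[7]), (18,[-8]), (19,[9]), (20,[-10,12]),
     (21,[-13]), (27,[-22]), (30,[23]), (32,[-24]), (33,[25]), (34,[27]), (35,[-30]), (41,[-36]), (44,[37]),
     (46,[-38]), (47,[39]), (48,[41]), (49,[-44])]),
   (3, [(9,[-2]), (10,[-3]), (11,[3]), (12,[3]), (14,[5]), (17,[8]), (19,[-10,-11,12]), (20,[-13]), (26,[22]),
     (29,[-23]), (32,[-25]), (34,[-28]), (35,[31]), (40,[36]), (43,[-37]), (46,[-39]), (48,[-42]), (49,[45])]),
   (4, [(7,[1]), (8,[2]), (10,[-4]), (11,[4]), (13,[-5]), (15,[-6]), (16,[7]), (17,[-9]), (18,[-10,-12]),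
     (20,[14]), (21,[-15]), (25,[22]), (30,[-24]), (31,[25]), (32,[-26]), (33,[-27]), (35,[-32]), (39,[36]),
     (44,[-38]), (45,[39]), (46,[-40]), (47,[-41]), (49,[-46])]),
   (5, [(7,[2]), (8,[-3]), (9,[-4]), (11,[-5]), (12,[5]), (14,[6]), (16,[8]), (17,[10,-11,12]), (18,[13]),
     (19,[-14]), (20,[-15]), (24,[-22]), (29,[-24]), (30,[25]), (32,[-27]), (33,[-28]), (35,[-33]),
     (38,[-36]), (43,[-38]), (44,[39]), (46,[-41]), (47,[-42]), (49,[-47])]),
   (6, [(7,[-4]), (8,[-5]), (10,[6]), (12,[6]), (16,[-11,12]), (17,[-14]), (18,[-15]), (23,[22]), (29,[-26]),
     (30,[-27]), (31,[-28]), (35,[34]), (37,[36]), (43,[-40]), (44,[-41]), (45,[-42]), (49,[48])]),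
   (7, [(10,[7]), (11,[7]), (12,[-7]), (13,[-8]), (14,[9]), (15,[10,11]), (18,[16]), (20,[17]), (21,[-18]),
     (25,[-23]), (27,[24]), (28,[-25]), (32,[-29]), (33,[-30]), (34,[-32]), (39,[-37]), (41,[38]), (42,[-39]),
     (46,[-43]), (47,[-44]), (48,[-46])]),
   (8, [(9,[-7]), (10,[-8]), (11,[-8]), (14,[-10]), (15,[-13]), (17,[-16]), (19,[-17]), (20,[-18]), (24,[23]),
     (26,[24]), (27,[-25]), (32,[-30]), (33,[-31]), (34,[-33]), (38,[37]), (40,[38]), (41,[-39]), (46,[-44]),
     (47,[-45]), (48,[-47])]),
   (9, [(10,[-9]), (11,[-9]), (12,[-9]), (13,[-11]), (15,[14]), (18,[17]), (20,[-19]), (21,[-20]), (25,[24]),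
     (27,[26]), (28,[-27]), (30,[29]), (31,[-30]), (33,[32]), (39,[38]), (41,[40]), (42,[-41]), (44,[43]),
     (45,[-44]), (47,[46])]),
   (10, [(13,[-13]), (14,[-14]), (15,[15]), (16,[16]), (18,[-18]), (19,[-19]), (20,[20]), (23,[23]),
     (25,[-25]), (26,[-26]), (27,[27]), (30,[-30]), (31,[31]), (32,[32]), (34,[-34]), (37,[37]), (39,[-39]),
     (40,[-40]), (41,[41]), (44,[-44]), (45,[45]), (46,[46]), (48,[-48])]),
   (11, [(13,[-13]), (14,[-14]), (15,[15]), (17,[-17]), (18,[18]), (19,[19]), (21,[-21]), (24,[-24]),
     (25,[25]), (26,[26]), (28,[-28]), (29,[29]), (31,[-31]), (32,[-32]), (33,[33]), (38,[-38]), (39,[39]),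
     (40,[40]), (42,[-42]), (43,[43]), (45,[-45]), (46,[-46]), (47,[47])]),
   (12, [(13,[-13]), (15,[-15]), (16,[16]), (17,[17]), (19,[19]), (21,[-21]), (22,[22]), (23,[-23]),
     (24,[-24]), (25,[25]), (26,[-26]), (27,[27]), (30,[-30]), (31,[31]), (32,[-32]), (33,[33]), (34,[34]),
     (35,[-35]), (36,[36]), (37,[-37]), (38,[-38]), (39,[39]), (40,[-40]), (41,[41]), (44,[-44]), (45,[45]),
     (46,[-46]), (47,[47]), (48,[48]), (49,[-49])]),
   (13, [(14,[15]), (17,[18]), (19,[20]), (20,[21]), (24,[25]), (26,[-27]), (27,[28]), (29,[-30]), (30,[31]),
     (32,[33]), (38,[39]), (40,[-41]), (41,[42]), (43,[-44]), (44,[45]), (46,[47])]),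
   (14, [(16,[17]), (17,[19]), (18,[-20]), (23,[-24]), (24,[-26]), (25,[-27]), (30,[-32]), (31,[33]),
     (33,[34]), (37,[-38]), (38,[-40]), (39,[-41]), (44,[-46]), (45,[47]), (47,[48])]),
   (15, [(16,[18]), (17,[-20]), (18,[-21]), (23,[-25]), (24,[-27]), (25,[-28]), (29,[-32]), (30,[33]),
     (32,[-34]), (37,[-39]), (38,[-41]), (39,[-42]), (43,[-46]), (44,[47]), (46,[-48])]),
   (16, [(22,[23]), (26,[-29]), (27,[-30]), (28,[-31]), (34,[35]), (36,[37]), (40,[-43]), (41,[-44]),
     (42,[-45]), (48,[49])]),
   (17, [(22,[-24]), (24,[-29]), (25,[-30]), (27,[32]), (28,[-33]), (33,[-35]), (36,[-38]), (38,[-43]),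
     (39,[-44]), (41,[46]), (42,[-47]), (47,[-49])]),
   (18, [(22,[-25]), (24,[-30]), (25,[-31]), (26,[32]), (27,[-33]), (32,[35]), (36,[-39]), (38,[-44]),
     (39,[-45]), (40,[46]), (41,[-47]), (46,[49])]),
   (19, [(22,[26]), (23,[-29]), (25,[-32]), (28,[-34]), (31,[35]), (36,[40]), (37,[-43]), (39,[-46]),
     (42,[-48]), (45,[49])]),
   (20, [(22,[-27]), (23,[30]), (24,[32]), (25,[-33]), (27,[34]), (30,[-35]), (36,[-41]), (37,[44]),
     (38,[46]), (39,[-47]), (41,[48]), (44,[-49])]),
   (21, [(22,[-28]), (23,[31]), (24,[-33]), (26,[34]), (29,[-35]), (36,[-42]), (37,[45]), (38,[-47]),
     (40,[48]), (43,[-49])]),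
   (22, [(35,[-50]), (43,[1]), (44,[2]), (45,[-3]), (46,[4]), (47,[5]), (48,[-6]), (49,[-10,11,51]),
     (51,[22]), (52,[-36])]),
   (23, [(34,[50]), (40,[1]), (41,[2]), (42,[-3]), (46,[-7]), (47,[-8]), (48,[10,11,12,-51]), (49,[16]),
     (51,[23]), (52,[-37])]),
   (24, [(33,[50]), (38,[-1]), (39,[-2]), (41,[4]), (42,[-5]), (44,[7]), (45,[-8]), (46,[-9]),
     (47,[-10,11,12,-51]), (48,[14]), (49,[-17]), (51,[24]), (52,[-38])]),
   (25, [(32,[-50]), (38,[-2]), (39,[3]), (40,[4]), (41,[-5]), (43,[7]), (44,[-8]), (46,[10,11,-12,51]),
     (47,[13]), (48,[15]), (49,[-18]), (51,[25]), (52,[-39])]),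
   (26, [(31,[50]), (37,[1]), (39,[4]), (42,[-6]), (44,[-9]), (45,[11,12,-51]), (47,[14]), (49,[19]),
     (51,[26]), (52,[-40])]),
   (27, [(30,[50]), (37,[2]), (38,[4]), (39,[-5]), (41,[-6]), (43,[9]), (44,[-11,12,-51]), (45,[13]),
     (46,[14]), (47,[-15]), (49,[-20]), (51,[27]), (52,[-41])]),
   (28, [(29,[50]), (37,[-3]), (38,[-5]), (40,[-6]), (43,[12,-51]), (44,[-13]), (46,[-15]), (49,[-21]),
     (51,[28]), (52,[-42])]),
   (29, [(36,[1]), (39,[7]), (41,[9]), (42,[12,51]), (45,[16]), (47,[17]), (48,[19]), (51,[29]), (52,[-43])]),
   (30, [(36,[2]), (38,[7]), (39,[-8]), (40,[-9]), (41,[-11,12,51]), (42,[-13]), (44,[16]), (46,[17]),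
     (47,[-18]), (48,[-20]), (51,[30]), (52,[-44])]),
   (31, [(36,[-3]), (38,[-8]), (40,[11,12,51]), (41,[13]), (43,[16]), (46,[-18]), (48,[-21]), (51,[31]),
     (52,[-45])]),
   (32, [(36,[4]), (37,[-7]), (38,[-9]), (39,[10,11,-12,-51]), (41,[14]), (42,[-15]), (44,[17]), (45,[-18]),
     (46,[-19]), (47,[20]), (51,[32]), (52,[-46])]),
   (33, [(36,[5]), (37,[-8]), (38,[-10,11,12,51]), (39,[13]), (40,[14]), (41,[-15]), (43,[17]), (44,[-18]),
     (46,[20]), (47,[21]), (51,[33]), (52,[-47])]),
   (34, [(36,[-6]), (37,[10,11,12,51]), (38,[14]), (39,[15]), (43,[19]), (44,[-20]), (45,[-21]), (51,[34]),
     (52,[-48])]),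
   (35, [(36,[-10,11,-51]), (37,[16]), (38,[-17]), (39,[-18]), (40,[19]), (41,[-20]), (42,[-21]), (51,[35]),
     (52,[-49])]),
   (36, [(49,[52]), (50,[-22]), (51,[-36])]),
   (37, [(48,[-52]), (50,[-23]), (51,[-37])]),
   (38, [(47,[-52]), (50,[-24]), (51,[-38])]),
   (39, [(46,[52]), (50,[-25]), (51,[-39])]),
   (40, [(45,[-52]), (50,[-26]), (51,[-40])]),
   (41, [(44,[-52]), (50,[-27]), (51,[-41])]),
   (42, [(43,[-52]), (50,[-28]), (51,[-42])]),
   (43, [(50,[-29]), (51,[-43])]),
   (44, [(50,[-30]), (51,[-44])]),
   (45, [(50,[-31]), (51,[-45])]),
   (46, [(50,[-32]), (51,[-46])]),
   (47, [(50,[-33]), (51,[-47])]),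
   (48, [(50,[-34]), (51,[-48])]),
   (49, [(50,[-35]), (51,[-49])]),
   (50, [(51,[-50]), (52,[-51])]),
   (51, [(52,[-52])])]"

text \<open>The roots of basis vectors 1 to 52, in this order and in coordinates with respect to the
  four simple roots.\<close>

definition f4_degrees :: "int list list" where
  "f4_degrees = [
   [-2,-4,-2,-1], [-2,-3,-2,-1], [-2,-2,-2,-1], [-1,-3,-2,-1], [-1,-2,-2,-1], [0,-2,-2,-1], [-1,-1,0,0],
   [-1,0,0,0], [0,-1,0,0], [0,0,0,0], [0,0,0,0], [0,0,0,0], [0,1,0,0], [1,0,0,0], [1,1,0,0], [0,2,2,1],
   [1,2,2,1], [1,3,2,1], [2,2,2,1], [2,3,2,1], [2,4,2,1], [-2,-4,-3,-2], [-2,-2,-1,-1], [-1,-2,-1,-1],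
   [-1,-1,-1,-1], [0,-2,-1,-1], [0,-1,-1,-1], [0,0,-1,-1], [0,0,1,0], [0,1,1,0], [0,2,1,0], [1,1,1,0],
   [1,2,1,0], [2,2,1,0], [2,4,3,1], [-2,-4,-3,-1], [-2,-2,-1,0], [-1,-2,-1,0], [-1,-1,-1,0], [0,-2,-1,0],
   [0,-1,-1,0], [0,0,-1,0], [0,0,1,1], [0,1,1,1], [0,2,1,1], [1,1,1,1], [1,2,1,1], [2,2,1,1], [2,4,3,2],
   [0,0,0,-1], [0,0,0,0], [0,0,0,1]]"

text \<open>Certificates for generation and for the descent to degree 0. In \<open>words\<close>, an entry \<open>(r, ts)\<close> writes the
  basis vector \<open>r\<close> as the sum of \<open>a [g, s]\<close> over the triples \<open>(a, g, s)\<close> in \<open>ts\<close>, where \<open>g\<close> is a generator and \<open>s\<close>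
  occurs earlier. In \<open>base\<close> and \<open>steps\<close>, an entry \<open>(k, g)\<close> says that the bracket of the generator \<open>g\<close> with \<open>k\<close>
  is nonzero, and of degree 0 or proportional to an earlier basis vector, respectively.\<close>

definition f4_words :: "(int \<times> (int \<times> int \<times> int) list) list" where
  "f4_words = [
   (15, [(-1, 14, 13)]), (10, [(1, 14, 8)]), (30, [(-1, 13, 29)]), (11, [(1, 13, 9)]),
   (43, [(-1, 29, 52)]), (32, [(1, 29, 15)]), (51, [(1, 52, 50)]), (44, [(1, 52, 30)]),
   (46, [(1, 52, 32)]), (7, [(-1, 8, 9)]), (41, [(-1, 9, 42)]), (28, [(-1, 42, 50)]), (39, [(1, 42, 7)]),
   (27, [(1, 50, 41)]), (25, [(1, 50, 39)]), (12, [(1, 29, 42), (-1, 52, 50)]), (31, [(1, 13, 30)]),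
   (33, [(1, 13, 32)]), (45, [(1, 13, 44)]), (47, [(1, 13, 46)]), (16, [(1, 29, 45)]), (17, [(1, 29, 47)]),
   (40, [(1, 9, 41)]), (38, [(1, 9, 39)]), (26, [(1, 9, 27)]), (24, [(1, 9, 25)]), (6, [(1, 42, 26)]),
   (5, [(1, 42, 24)]), (34, [(1, 14, 33)]), (48, [(1, 14, 47)]), (19, [(1, 14, 17)]), (18, [(1, 13, 17)]),
   (20, [(1, 13, 19)]), (37, [(1, 8, 38)]), (23, [(1, 8, 24)]), (3, [(1, 8, 5)]), (4, [(1, 9, 5)]),
   (2, [(1, 9, 3)]), (21, [(1, 13, 20)]), (35, [(1, 29, 21)]), (49, [(1, 52, 35)]), (1, [(1, 9, 2)]),
   (36, [(1, 42, 1)]), (22, [(1, 50, 36)])]"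

definition f4_base :: "(int \<times> int) list" where
  "f4_base = [
   (8, 14), (9, 13), (13, 9), (14, 8), (29, 42), (42, 29), (50, 52), (52, 50)]"

definition f4_steps :: "(int \<times> int) list" where
  "f4_steps = [
   (7, 14), (15, 8), (28, 29), (30, 9), (31, 9), (32, 8), (33, 8), (34, 8), (39, 29), (41, 13), (43, 42),
   (44, 9), (45, 9), (46, 8), (47, 8), (48, 8), (16, 42), (17, 8), (18, 9), (19, 8), (20, 8), (21, 9),
   (25, 52), (27, 13), (35, 42), (38, 13), (40, 13), (49, 50), (24, 13), (26, 13), (37, 14), (5, 29),
   (6, 29), (23, 14), (3, 14), (4, 13), (2, 14), (1, 13), (36, 29), (22, 52)]"

definition g16_words :: "(int \<times> (int \<times> int \<times> int) list) list" where
  "g16_words = [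
   (15, [(-1, 14, 13)]), (10, [(1, 14, 8)]), (30, [(-1, 13, 29)]), (11, [(1, 13, 9)]), (12, [(1, 29, 28)]),
   (32, [(1, 29, 15)]), (7, [(-1, 8, 9)]), (27, [(-1, 9, 28)]), (25, [(1, 28, 7)]), (31, [(1, 13, 30)]),
   (33, [(1, 13, 32)]), (16, [(1, 29, 31)]), (17, [(1, 29, 33)]), (26, [(1, 9, 27)]), (24, [(1, 9, 25)]),
   (6, [(-1, 28, 26)]), (5, [(-1, 28, 24)]), (34, [(1, 14, 33)]), (19, [(1, 14, 17)]), (18, [(1, 13, 17)]),
   (20, [(1, 13, 19)]), (23, [(1, 8, 24)]), (3, [(1, 8, 5)]), (4, [(1, 9, 5)]), (2, [(1, 9, 3)]),
   (21, [(1, 13, 20)]), (35, [(1, 29, 21)]), (1, [(1, 9, 2)]), (22, [(1, 28, 1)])]"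

definition g16_base :: "(int \<times> int) list" where
  "g16_base = [
   (8, 14), (9, 13), (13, 9), (14, 8), (28, 29), (29, 28)]"

definition g16_steps :: "(int \<times> int) list" where
  "g16_steps = [
   (7, 14), (15, 8), (25, 29), (27, 13), (30, 9), (31, 9), (32, 8), (33, 8), (34, 8), (16, 28), (17, 8),
   (18, 9), (19, 8), (20, 8), (21, 9), (24, 13), (26, 13), (35, 28), (5, 29), (6, 29), (23, 14), (3, 14),
   (4, 13), (2, 14), (1, 13), (22, 29)]"

primrec upto_num :: "nat \<Rightarrow> num \<Rightarrow> num list" where
  "upto_num 0 k = []" | "upto_num (Suc m) k = k # upto_num m (Num.inc k)"

definition "nums ks = map num_of ks"
definition "pairs xs = map (\<lambda>(a, b). (num_of a, num_of b)) xs"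
definition "words xs = map (\<lambda>(r, ts). (num_of r, map (\<lambda>(a, g, s). (a, num_of g, num_of s)) ts)) xs"

primrec degree_trie :: "num list \<Rightarrow> int list list \<Rightarrow> int list trie" where
  "degree_trie [] ds = Leaf"
| "degree_trie (k # ks) ds = ins [] k (hd ds) (degree_trie ks (tl ds))"

definition "f4_T = mk f4_table Leaf"
definition "f4_idx = upto_num 52 num.One"
definition "f4_deg i = look [] (degree_trie f4_idx f4_degrees) i"
definition "f4_e = nums [14, 13, 29, 52]"
definition "f4_f = nums [8, 9, 42, 50]"
definition "f4_cartan = nums [10, 11, 12, 51]"
definition all_even :: "num \<Rightarrow> bool" where "all_even i = False"

text \<open>The basis of \<open>f4\<close> is adapted to the action of \<open>e\<^sub>4\<close>, which is basis vector 52: vectors 1 to 21 are the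
  blocks of size 1, vectors 22 to 35 and 36 to 49 the tops and bottoms of the blocks of size 2, and
  50, 51, 52 is the block of size 3 (\<open>f\<^sub>4\<close>, \<open>h\<^sub>4\<close>, \<open>e\<^sub>4\<close>). Vector 12 is \<open>h\<^sub>3 - h\<^sub>4\<close>.\<close>

definition is_odd :: "num \<Rightarrow> bool" where "is_odd i \<longleftrightarrow> num_of 21 < i"

text \<open>The bound 36 removes the bottoms of the blocks of size 2 and the whole block of size 3,
  which leaves the coordinates at the tops.\<close>

primrec proj :: "bool \<Rightarrow> lin \<Rightarrow> lin" where
  "proj b [] = []"
| "proj b (x # l) = (if is_odd (fst x) = b \<and> fst x < num_of 36 then x # proj b l else proj b l)"

text \<open>\<open>R\<close> is the row of e_4, \<open>Ri\<close> the row of \<open>i\<close>, and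
  \<open>rs\<close> the rows of the image of \<open>i\<close> under ad e_4. With this reading the
  odd-odd entry is \<open>- [i, d j] + [d i, j]\<close>.\<close>

definition n_ent :: "lin trie \<Rightarrow> lin trie \<Rightarrow> (lin trie \<times> int) list \<Rightarrow> num \<Rightarrow> num \<Rightarrow> lin" where
  "n_ent R Ri rs i j = (if is_odd i \<and> is_odd j then proj False (app Ri (-1) (ent R j) (lapp rs 1 j []))
    else proj (is_odd i \<noteq> is_odd j) (ent Ri j))"

primrec n_row :: "lin trie \<Rightarrow> lin trie \<Rightarrow> (lin trie \<times> int) list \<Rightarrow> num \<Rightarrow> num list \<Rightarrow> lin trie" where
  "n_row R Ri rs i [] = Leaf"
| "n_row R Ri rs i (j # js) = ins [] j (n_ent R Ri rs i j) (n_row R Ri rs i js)"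

primrec n_tab :: "tab \<Rightarrow> lin trie \<Rightarrow> num list \<Rightarrow> num list \<Rightarrow> tab" where
  "n_tab T R js [] = Leaf"
| "n_tab T R js (i # is) = ins Leaf i (n_row R (trow T i) (rows T (ent R i)) i js) (n_tab T R js is)"

text \<open>The semisimplification of \<open>f4\<close>, on the tops of the blocks of sizes 1 and 2. Its degrees forget the
  coefficient of \<open>\<alpha>\<^sub>4\<close>, and \<open>f\<^sub>3\<close> is represented by vector 28, the top of the block that ends in the
  element \<open>f\<^sub>3\<close> of \<open>f4\<close>, which is vector 42.\<close>

definition "g16_idx = upto_num 35 num.One"
definition "g16_T = n_tab f4_T (trow f4_T (num_of 52)) g16_idx g16_idx"
definition "g16_deg i = butlast (f4_deg i)"
definition "g16_e = nums [14, 13, 29]"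
definition "g16_f = nums [8, 9, 28]"
definition "g16_cartan = nums [10, 11, 12]"

definition closed_check :: "tab \<Rightarrow> num list \<Rightarrow> bool" where
  "closed_check T idx = check_tab (\<lambda>i j l. list_all (\<lambda>x. is_mem (fst x) idx) l) T idx idx"

text \<open>\<open>zs\<close> has to contain the indices of degree 0 and \<open>ds\<close> all
  others; distinctness makes every root space of nonzero degree one-dimensional.\<close>

definition degree_check :: "(num \<Rightarrow> int list) \<Rightarrow> int list \<Rightarrow> num list \<Rightarrow> num list \<Rightarrow> num list \<Rightarrow> bool" where
  "degree_check dl z idx zs ds = (list_all (\<lambda>i. let l = dl i in length l = length z \<and>
      (if l = z then is_mem i zs else is_mem i ds)) idx \<and> distinct (filter (\<lambda>l. l \<noteq> z) (map dl idx)))"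

section \<open>Verification of the tables and certificates by evaluation\<close>

lemma f4_off: "off_diagonal f4_table" by code_simp
lemma f4_closed: "closed_check f4_T f4_idx" by code_simp
lemma f4_jac1: "jac_g f4_T f4_idx all_even f4_e" by code_simp
lemma f4_jac2: "jac_g f4_T f4_idx all_even f4_f" by code_simp
lemma f4_gen: "gen_check f4_T all_even (f4_e @ f4_f) (f4_e @ f4_f) (words f4_words)" by code_simp
lemma f4_graded: "graded_check f4_T f4_deg f4_idx (f4_e @ f4_f @ f4_cartan)" by code_simp
lemma f4_basec: "base_check f4_T f4_deg (f4_e @ f4_f) [0,0,0,0] (pairs f4_base)" by code_simp
lemma f4_stepc: "step_check f4_T (f4_e @ f4_f) (map fst (pairs f4_base)) (pairs f4_steps)" by code_simp
lemma f4_degc: "degree_check f4_deg [0,0,0,0] f4_idx f4_cartan (map fst (pairs f4_base) @ map fst (pairs f4_steps))" by code_simp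
lemma f4_rel: "rel_check f4_T 4 f4_e f4_f [[2,-1,0,0],[-1,2,-2,0],[0,-1,2,-1],[0,0,-1,2]]" by code_simp
lemma f4_mem: "mem_all (f4_e @ f4_f @ map fst (words f4_words)) f4_idx" "mem_all f4_idx (f4_e @ f4_f @ map fst (words f4_words))"
   "mem_all (map fst (pairs f4_base) @ map fst (pairs f4_steps)) f4_idx"
  by code_simp+

lemma g16_closed: "closed_check g16_T g16_idx" by code_simp
lemma g16_jac1: "jac_g g16_T g16_idx is_odd g16_e" by code_simp
lemma g16_jac2: "jac_g g16_T g16_idx is_odd g16_f" by code_simp
lemma g16_cube: "cube_check g16_T (filter is_odd g16_idx)" by code_simp
lemma g16_gen: "gen_check g16_T is_odd (g16_e @ g16_f) (g16_e @ g16_f) (words g16_words)" by code_simp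
lemma g16_graded: "graded_check g16_T g16_deg g16_idx (g16_e @ g16_f @ g16_cartan)" by code_simp
lemma g16_basec: "base_check g16_T g16_deg (g16_e @ g16_f) [0,0,0] (pairs g16_base)" by code_simp
lemma g16_stepc: "step_check g16_T (g16_e @ g16_f) (map fst (pairs g16_base)) (pairs g16_steps)" by code_simp
lemma g16_degc: "degree_check g16_deg [0,0,0] g16_idx g16_cartan (map fst (pairs g16_base) @ map fst (pairs g16_steps))" by code_simp
lemma g16_rel: "rel_check g16_T 3 g16_e g16_f [[2,-1,0],[-1,2,-2],[0,-1,0]]" by code_simp
lemma g16_mem: "mem_all (g16_e @ g16_f @ map fst (words g16_words)) g16_idx" "mem_all g16_idx (g16_e @ g16_f @ map fst (words g16_words))"
   "mem_all (map fst (pairs g16_base) @ map fst (pairs g16_steps)) g16_idx"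
  by code_simp+

section \<open>From tables to contragredient superalgebras\<close>

lemma (in contragredient_model) contragredient_e_carrier: "m < n \<Longrightarrow> contragredient_e n par R m \<in> carrier L"
proof -
  assume m: "m < n"
  have "contragredient_e n par R m = proj (gen (EGen m))"
    by (simp add: contragredient_e_def max_ideal_eq proj_def tilde_coset_def)
  then show ?thesis using m by (simp add: L_carrier gen_carrier gen_mem)
qed

definition coordinates :: "nat \<Rightarrow> int mat \<Rightarrow> ('k::field, 'h) realization \<Rightarrow> ('h \<Rightarrow> nat \<Rightarrow> 'k) \<Rightarrow> bool" where
  "coordinates n A R co \<longleftrightarrow>
     (\<forall>h\<in>carrier R. \<forall>h'\<in>carrier R. \<forall>a. \<forall>i<n. co (a \<odot>\<^bsub>R\<^esub> h \<oplus>\<^bsub>R\<^esub> h') i = a * co h i + co h' i) \<and>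
     (\<forall>h\<in>carrier R. \<forall>j<n. root R j h = (\<Sum>i<n. co h i * of_int (A $$ (i, j)))) \<and>
     (\<forall>h\<in>carrier R. (\<forall>i<n. co h i = 0) \<longrightarrow> h = \<zero>\<^bsub>R\<^esub>) \<and>
     (\<forall>l<n. \<forall>i<n. co (coroot R l) i = (if i = l then 1 else 0))"

text \<open>Full rank makes the dimension \<open>2 * n - n = n\<close>, so the \<open>n\<close>
  independent coroots form a basis and the roots are determined by the Cartan matrix.\<close>

lemma realization_coordinates:
  fixes R :: "('k::field, 'h) realization"
  assumes real: "realization_of A R" and A: "A \<in> carrier_mat n n"
    and rk: "vec_space.rank n (map_mat of_int A :: 'k mat) = n"
  shows "\<exists>co. coordinates n A R co"
proof -
  have dr: "dim_row A = n" using A by simp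
  have vs: "vectorspace class_ring R" and fd: "vectorspace.fin_dim class_ring R"
    and dim: "vectorspace.dim class_ring R = n"
    and cr: "\<And>i. i < n \<Longrightarrow> coroot R i \<in> carrier R"
    and indep: "\<And>c i. (\<Oplus>\<^bsub>R\<^esub>i\<in>{..<n}. c i \<odot>\<^bsub>R\<^esub> coroot R i) = \<zero>\<^bsub>R\<^esub> \<Longrightarrow> i < n \<Longrightarrow> c i = 0"
    and lin: "\<And>j x y a. \<lbrakk>j < n; x \<in> carrier R; y \<in> carrier R\<rbrakk> \<Longrightarrow> root R j (x \<oplus>\<^bsub>R\<^esub> y) = root R j x + root R j y \<and>
          root R j (a \<odot>\<^bsub>R\<^esub> x) = a * root R j x"
    and mat: "\<And>i j. i < n \<Longrightarrow> j < n \<Longrightarrow> root R j (coroot R i) = of_int (A $$ (i, j))"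
    using real rk unfolding realization_of_def Let_def dr by auto
  interpret V: class_vectorspace R by (rule class_vectorspace.intro[OF vs])
  let ?S = "coroot R ` {..<n}"
  have S: "?S \<subseteq> carrier R" "finite ?S" using cr by auto
  have inj: "inj_on (coroot R) {..<n}"
  proof (rule inj_onI, rule ccontr)
    fix i j assume ij: "i \<in> {..<n}" "j \<in> {..<n}" "coroot R i = coroot R j" "i \<noteq> j"
    \<comment> \<open>Independence is given for the indexed family, whereas a basis is a set. Two
      equal coroots would satisfy the relation with coefficients 1 and -1.\<close>
    let ?c = "\<lambda>k. if k = i then 1 else if k = j then - 1 else (0::'k)"
    let ?f = "\<lambda>k. if i = k then coroot R k else \<zero>\<^bsub>R\<^esub>" and ?g = "\<lambda>k. if j = k then \<ominus>\<^bsub>R\<^esub> coroot R k else \<zero>\<^bsub>R\<^esub>"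
    have "(\<Oplus>\<^bsub>R\<^esub>k\<in>{..<n}. ?c k \<odot>\<^bsub>R\<^esub> coroot R k) = (\<Oplus>\<^bsub>R\<^esub>k\<in>{..<n}. ?f k \<oplus>\<^bsub>R\<^esub> ?g k)"
      using cr ij by (intro V.finsum_cong') (auto simp: V.one_smult V.zero_smult V.neg_smult V.smult_carrier)
    also have "\<dots> = (\<Oplus>\<^bsub>R\<^esub>k\<in>{..<n}. ?f k) \<oplus>\<^bsub>R\<^esub> (\<Oplus>\<^bsub>R\<^esub>k\<in>{..<n}. ?g k)"
      using cr by (intro V.finsum_addf) auto
    also have "\<dots> = coroot R i \<oplus>\<^bsub>R\<^esub> \<ominus>\<^bsub>R\<^esub> coroot R j"
      by (subst V.finsum_singleton[of i "{..<n}" "coroot R"], use cr ij in auto)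
        (subst V.finsum_singleton[of j "{..<n}" "\<lambda>k. \<ominus>\<^bsub>R\<^esub> coroot R k"], use cr ij in auto)
    also have "\<dots> = \<zero>\<^bsub>R\<^esub>" using cr ij by (simp add: V.r_neg)
    finally have "?c i = 0" using ij(1) by (intro indep) auto
    then show False by simp
  qed
  have "V.lin_indpt ?S"
  proof (rule V.finite_lin_indpt2[OF S(2,1)])
    fix a assume z: "V.lincomb a ?S = \<zero>\<^bsub>R\<^esub>"
    have eq: "V.lincomb a ?S = (\<Oplus>\<^bsub>R\<^esub>i\<in>{..<n}. a (coroot R i) \<odot>\<^bsub>R\<^esub> coroot R i)"
      unfolding V.lincomb_def using cr by (intro V.finsum_reindex inj) (auto simp: V.smult_carrier)
    have "a (coroot R i) = 0" if "i < n" for i by (rule indep[OF trans[OF eq[symmetric] z] that])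
    then show "\<forall>v\<in>?S. a v = \<zero>\<^bsub>class_ring\<^esub>" by simp
  qed
  moreover have "card ?S = n" using inj by (simp add: card_image)
  ultimately have basis: "V.basis ?S" using S fd dim by (intro V.dim_li_is_basis) auto
  define co where "co h i = basis_coeff R ?S h (coroot R i)" for h i
  note lf = V.lin_funD[OF V.lin_fun_coeff[OF basis S(2)]]
  show ?thesis
    unfolding coordinates_def
  proof (intro exI[of _ co] conjI ballI allI impI)
    show "co (a \<odot>\<^bsub>R\<^esub> h \<oplus>\<^bsub>R\<^esub> h') i = a * co h i + co h' i" if "h \<in> carrier R" "h' \<in> carrier R" "i < n" for h h' a i
      using that by (simp add: co_def lf V.smult_carrier)
  next
    fix h j assume h: "h \<in> carrier R" and j: "j < n"
    have "V.lin_fun (root R j)" using lin[OF j] by (simp add: V.lin_fun_def)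
    from V.lin_fun_expand[OF basis S(2) this h]
    have "root R j h = (\<Sum>i<n. co h i * root R j (coroot R i))" by (simp add: sum.reindex[OF inj] co_def)
    then show "root R j h = (\<Sum>i<n. co h i * of_int (A $$ (i, j)))" using j by (simp add: mat)
  next
    fix h assume h: "h \<in> carrier R" and z: "\<forall>i<n. co h i = 0"
    have "h = V.lincomb (basis_coeff R ?S h) ?S" using V.lincomb_coeff[OF basis S(2) h] by simp
    also have "\<dots> = (\<Oplus>\<^bsub>R\<^esub>v\<in>?S. \<zero>\<^bsub>R\<^esub>)"
      unfolding V.lincomb_def using z cr by (intro V.finsum_cong') (auto simp: co_def V.zero_smult)
    finally show "h = \<zero>\<^bsub>R\<^esub>" by simp
  next
    fix l i assume "l < n" "i < n"
    then show "co (coroot R l) i = (if i = l then 1 else 0)"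
      using V.coeff_basis[OF basis S(2), of "coroot R i" "coroot R l"] inj by (auto simp: co_def inj_on_eq_iff)
  qed
qed

text \<open>A list and its extension by zeros define the same mapping, hence the condition on the
  lengths.\<close>

lemma nth_mapping_eq_iff: "length xs = length ys \<Longrightarrow> Poly_Mapping.nth xs = Poly_Mapping.nth ys \<longleftrightarrow> xs = ys"
proof
  assume l: "length xs = length ys" and eq: "Poly_Mapping.nth xs = Poly_Mapping.nth ys"
  show "xs = ys"
  proof (rule nth_equalityI[OF l])
    fix i assume "i < length xs"
    then show "xs ! i = ys ! i"
      using arg_cong[OF eq, of "\<lambda>p. Poly_Mapping.lookup p i"] l by (simp add: nth.rep_eq nth_default_def)
  qed
qed simp

lemma nth_mapping_ladd: "length xs = length ys \<Longrightarrow> Poly_Mapping.nth (ladd xs ys) = Poly_Mapping.nth xs + Poly_Mapping.nth ys"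
proof (rule poly_mapping_eqI)
  fix k assume "length xs = length ys"
  then have "nth_default 0 (ladd xs ys) k = nth_default 0 xs k + nth_default 0 ys k"
  proof (induction xs arbitrary: ys k)
    case (Cons x xs)
    then obtain y ys' where "ys = y # ys'" "length xs = length ys'" by (cases ys) auto
    then show ?case using Cons.IH by (cases k) auto
  qed simp
  then show "Poly_Mapping.lookup (Poly_Mapping.nth (ladd xs ys)) k = Poly_Mapping.lookup (Poly_Mapping.nth xs + Poly_Mapping.nth ys) k"
    by (simp add: nth.rep_eq lookup_add)
qed

lemma nth_mapping_zero: "Poly_Mapping.nth (replicate n 0) = 0"
  by (rule poly_mapping_eqI) (simp add: nth.rep_eq nth_default_def)

lemma nth_mapping_single: "m < n \<Longrightarrow> Poly_Mapping.nth ((replicate n 0)[m := a]) = Poly_Mapping.single m a"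
  by (rule poly_mapping_eqI) (auto simp: nth.rep_eq nth_default_def lookup_single when_def nth_list_update)

context table
begin

theorem contragredient_table:
  fixes R :: "('k, 'h) realization" and dl :: "num \<Rightarrow> int list" and Al :: "int list list" and n :: nat
  defines "z \<equiv> replicate n 0"
  assumes lie: "lie_superalgebra M"
    and len: "length es = n" "length fs = n" and ef: "set (es @ fs) \<subseteq> I"
    and par: "\<And>m. m < n \<Longrightarrow> p (es ! m) = par m \<and> p (fs ! m) = par m"
    and dle: "\<And>m. m < n \<Longrightarrow> dl (es ! m) = z[m := 1] \<and> dl (fs ! m) = z[m := - 1]"
    and degs: "degree_check dl z idx zs ds"
    and graded: "graded_check T dl idx (es @ fs @ zs)"
    and gen: "\<And>i. i \<in> I \<Longrightarrow> bv i \<in> gspan I p c (set (es @ fs))"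
    and base: "base_check T dl (es @ fs) z bs" and step: "step_check T (es @ fs) (map fst bs) ss"
    and ds: "set ds = set (map fst bs) \<union> set (map fst ss)" "set ds \<subseteq> I"
    and rel: "rel_check T n es fs Al" and A: "A \<in> carrier_mat n n" "\<And>i j. i < n \<Longrightarrow> j < n \<Longrightarrow> A $$ (i, j) = Al ! i ! j"
    and indep: "\<And>a i. (\<Sum>i<n. scale (a i) (bv (es ! i) \<star> bv (fs ! i))) = 0 \<Longrightarrow> i < n \<Longrightarrow> a i = 0"
    and rank: "vec_space.rank n (map_mat of_int A :: 'k mat) = n" and real: "realization_of A R"
  shows "\<exists>\<phi>. lie_iso (contragredient n par R) M \<phi> \<and> (\<forall>m<n. \<phi> (contragredient_e n par R m) = bv (es ! m))"
    and "\<And>m. m < n \<Longrightarrow> contragredient_e n par R m \<in> carrier (contragredient n par R)"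
    and "lie_superalgebra (contragredient n par R)"
proof -
  obtain co where co: "coordinates n A R co" using realization_coordinates[OF real A(1) rank] by blast
  have co_lin: "\<And>h h' a i. \<lbrakk>h \<in> carrier R; h' \<in> carrier R; i < n\<rbrakk> \<Longrightarrow> co (a \<odot>\<^bsub>R\<^esub> h \<oplus>\<^bsub>R\<^esub> h') i = a * co h i + co h' i"
    and co_root: "\<And>h j. \<lbrakk>h \<in> carrier R; j < n\<rbrakk> \<Longrightarrow> root R j h = (\<Sum>i<n. co h i * of_int (A $$ (i, j)))"
    and co_zero: "\<And>h. \<lbrakk>h \<in> carrier R; \<forall>i<n. co h i = 0\<rbrakk> \<Longrightarrow> h = \<zero>\<^bsub>R\<^esub>"
    and co_coroot: "\<And>l i. \<lbrakk>l < n; i < n\<rbrakk> \<Longrightarrow> co (coroot R l) i = (if i = l then 1 else 0)"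
    using co unfolding coordinates_def by blast+
  define H where "H i = bv (es ! i) \<star> bv (fs ! i)" for i
  \<comment> \<open>The linear map sending the \<open>i\<close>-th coroot of the realization to the
    bracket \<open>H i\<close> in the model. Relations involving a general Cartan element thereby
    reduce to those for the \<open>H i\<close>.\<close>
  define \<eta> where "\<eta> h = (\<Sum>i<n. scale (co h i) (H i))" for h
  define deg where "deg i = Poly_Mapping.nth (dl i)" for i
  let ?G = "(!) es ` {..<n} \<union> (!) fs ` {..<n}"
  have G: "?G = set (es @ fs)" using len by (auto simp: in_set_conv_nth)
  have mem: "es ! m \<in> I" "fs ! m \<in> I" if "m < n" for m using ef len that by (auto simp: nth_mem subset_iff)
  have lz: "length z = n" by (simp add: z_def)
  have degl: "length (dl i) = n \<and> (dl i = z \<longrightarrow> i \<in> set zs) \<and> (dl i \<noteq> z \<longrightarrow> i \<in> set ds)" if "i \<in> I" for i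
    using degs that lz by (auto simp: degree_check_def list_all_iff Let_def is_mem_iff split: if_splits)
  have deg0: "deg i = 0 \<longleftrightarrow> dl i = z" if "i \<in> I" for i
    using degl[OF that] nth_mapping_eq_iff[of "dl i" z] lz by (simp add: deg_def z_def nth_mapping_zero)
  have HE: "H i \<star> bv (es ! m) = scale (of_int (A $$ (i, m))) (bv (es ! m))"
    "H i \<star> bv (fs ! m) = - scale (of_int (A $$ (i, m))) (bv (fs ! m))"
    "i \<noteq> m \<Longrightarrow> bv (es ! i) \<star> bv (fs ! m) = 0" "H i \<star> H m = 0" if "i < n" "m < n" for i m
    using rel_checkD[OF rel _ that] mem A(2)[OF that] unfolding H_def by auto
  have gr: "deg k = deg i + deg j" if "i \<in> I" "j \<in> I" "k \<in> I" "c i j k \<noteq> 0" "i \<in> ?G \<or> deg i = 0" for i j k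
  proof -
    have "i \<in> set (es @ fs @ zs)" using that(5) G deg0[OF that(1)] degl[OF that(1)] by auto
    from check_tabD[OF graded[unfolded graded_check_def] this that(2)]
    have *: "\<And>x. x \<in> set (ent (trow T i) j) \<Longrightarrow> ladd (dl i) (dl j) = dl (fst x)" by (auto simp: list_all_iff)
    have "k \<in> fst ` set (ent (trow T i) j)" using that(4) vec_outside[of k "ent (trow T i) j"] by (auto simp: tc_def)
    then have "ladd (dl i) (dl j) = dl k" using * by auto
    then show ?thesis using nth_mapping_ladd[of "dl i" "dl j"] degl that by (simp add: deg_def)
  qed
  interpret M: lie_superalgebra M by (rule lie)
  have vs: "vectorspace class_ring R" and cr: "\<And>i. i < n \<Longrightarrow> coroot R i \<in> carrier R"
    using real A(1) by (auto simp: realization_of_def Let_def)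
  have Hp: "H i \<in> part M 0 \<and> (\<forall>k. H i k \<noteq> 0 \<longrightarrow> deg k = 0)" if i: "i < n" for i
  proof
    have "H i \<in> part M (par i + par i)"
      using M.bracket_part[OF basis_vec_part[OF mem(1)[OF i]] basis_vec_part[OF mem(2)[OF i]]] par[OF i]
      unfolding H_def sc_simps(2) by metis
    then show "H i \<in> part M 0" by simp
    show "\<forall>k. H i k \<noteq> 0 \<longrightarrow> deg k = 0"
    proof (intro allI impI)
      fix k assume "H i k \<noteq> 0"
      then have k: "k \<in> I" "c (es ! i) (fs ! i) k \<noteq> 0" using mem[OF i] by (auto simp: H_def sc_mult_unit split: if_splits)
      have "deg k = deg (es ! i) + deg (fs ! i)" using gr[OF mem[OF i] k] i by auto
      then show "deg k = 0" using dle[OF i] i by (simp add: deg_def z_def nth_mapping_single single_add[symmetric])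
    qed
  qed
  have eta_app: "\<eta> h k = (\<Sum>i<n. co h i * H i k)" for h k
    unfolding \<eta>_def by (induction n) (auto simp: fun_ops scale_def)
  have model: "contragredient_model n par R I p c ((!) es) ((!) fs) deg \<eta>"
  proof (intro contragredient_model.intro contragredient_model_axioms.intro contragredient_presentation.intro
      contragredient_presentation_axioms.intro vs cr lie)
    show "finite I" by simp
    show "es ! m \<in> I \<and> p (es ! m) = par m \<and> deg (es ! m) = Poly_Mapping.single m 1" if "m < n" for m
      using mem that par[OF that] dle[OF that] by (simp add: deg_def z_def nth_mapping_single)
    show "fs ! m \<in> I \<and> p (fs ! m) = par m \<and> deg (fs ! m) = Poly_Mapping.single m (- 1)" if "m < n" for m
      using mem that par[OF that] dle[OF that] by (simp add: deg_def z_def nth_mapping_single)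
    show "deg k = deg i + deg j" if "i \<in> I" "j \<in> I" "k \<in> I" "c i j k \<noteq> 0" "i \<in> ?G \<or> deg i = 0" for i j k
      by (rule gr[OF that])
    show "i = k" if "i \<in> I" "k \<in> I" "deg i = deg k" "deg i \<noteq> 0" for i k
    proof -
      have eq: "dl i = dl k" using that degl nth_mapping_eq_iff[of "dl i" "dl k"] by (simp add: deg_def)
      have ik: "i \<in> {x \<in> I. dl x \<noteq> z}" "k \<in> {x \<in> I. dl x \<noteq> z}" using that deg0 eq by auto
      have "distinct (map dl (filter (\<lambda>x. dl x \<noteq> z) idx))"
        using degs by (simp add: degree_check_def filter_map comp_def)
      then have "inj_on dl {x \<in> I. dl x \<noteq> z}" by (simp add: distinct_map)
      then show ?thesis using eq ik by (auto simp: inj_on_def)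
    qed
    show "bv i \<in> gspan I p c ?G" if "i \<in> I" for i using gen[OF that] unfolding G .
    show "i \<in> descent I c ?G deg" if "i \<in> I" "deg i \<noteq> 0" for i
      unfolding G
    proof (rule step_checkD[OF ef step])
      show "set (map fst ss) \<subseteq> I" using ds by auto
      show "i \<in> set (map fst bs) \<union> set (map fst ss)" using that deg0 degl ds by auto
      show "set (map fst bs) \<subseteq> descent I c (set (es @ fs)) deg"
      proof
        fix k assume "k \<in> set (map fst bs)"
        then obtain y where y: "y \<in> set bs" "k = fst y" by auto
        have k: "fst y \<in> I" using y ds by auto
        note b = base_checkD[OF base y(1) k ef]
        have s: "snd y \<in> I" using b(1) ef by auto
        have "deg (snd y) + deg (fst y) = 0"
          using nth_mapping_ladd[of "dl (snd y)" "dl (fst y)"] degl[OF s] degl[OF k] b(3)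
          by (simp add: deg_def z_def nth_mapping_zero)
        then show "k \<in> descent I c (set (es @ fs)) deg"
          unfolding y(2) by (rule descent_base[OF b(1) k b(2)])
      qed
    qed
    show "\<eta> h \<in> part M 0 \<and> (\<forall>i. \<eta> h i \<noteq> 0 \<longrightarrow> deg i = 0)" if "h \<in> carrier R" for h
    proof
      have "(\<Sum>i\<in>S. scale (co h i) (H i)) \<in> part M 0" if "S \<subseteq> {..<n}" for S
        using that by (induction S rule: infinite_finite_induct) (auto simp: zero_part intro!: sc_part_closed(1,2) Hp[THEN conjunct1])
      then show "\<eta> h \<in> part M 0" by (simp add: \<eta>_def)
      show "\<forall>i. \<eta> h i \<noteq> 0 \<longrightarrow> deg i = 0"
        using Hp unfolding eta_app by (metis (no_types, lifting) lessThan_iff mult_zero_right sum.neutral)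
    qed
    show "\<eta> (a \<odot>\<^bsub>R\<^esub> h \<oplus>\<^bsub>R\<^esub> h') = scale a (\<eta> h) + \<eta> h'" if "h \<in> carrier R" "h' \<in> carrier R" for a h h'
      using that by (simp add: fun_eq_iff eta_app fun_ops scale_def co_lin sum_distrib_left algebra_simps sum.distrib)
    show "h = \<zero>\<^bsub>R\<^esub>" if "h \<in> carrier R" "\<eta> h = 0" for h
      using that indep[of "co h"] co_zero unfolding \<eta>_def H_def by blast
    show "bv (es ! l) \<star> bv (fs ! m) = (if l = m then \<eta> (coroot R l) else 0)" if "l < n" "m < n" for l m
    proof (cases "l = m")
      case True
      have "\<eta> (coroot R l) = (\<Sum>i<n. if i = l then H i else 0)"
        unfolding \<eta>_def by (intro sum.cong refl) (auto simp: co_coroot that scale_simps)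
      also have "\<dots> = H l" using that by simp
      finally show ?thesis using True by (simp add: H_def)
    qed (use HE(3)[OF that] in simp)
    have ssum: "(\<Sum>i<n. scale (a i) (scale (b i) v)) = scale (\<Sum>i<n. a i * b i) v" for a b :: "nat \<Rightarrow> 'k" and v :: "num \<Rightarrow> 'k"
      by (induction n) (auto simp: scale_simps)
    show "\<eta> h \<star> bv (es ! m) = scale (root R m h) (bv (es ! m))" if "h \<in> carrier R" "m < n" for h m
    proof -
      have "\<eta> h \<star> bv (es ! m) = (\<Sum>i<n. scale (co h i) (scale (of_int (A $$ (i, m))) (bv (es ! m))))"
        unfolding \<eta>_def sc_mult_sum_left using HE(1) that by (intro sum.cong refl) (auto simp: sc_mult_linear)
      then show ?thesis using that by (simp add: ssum co_root)
    qed
    show "\<eta> h \<star> bv (fs ! m) = - scale (root R m h) (bv (fs ! m))" if "h \<in> carrier R" "m < n" for h m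
    proof -
      have "\<eta> h \<star> bv (fs ! m) = (\<Sum>i<n. scale (co h i) (scale (of_int (A $$ (i, m))) (- bv (fs ! m))))"
        unfolding \<eta>_def sc_mult_sum_left using HE(2) that by (intro sum.cong refl) (auto simp: sc_mult_linear scale_simps)
      then show ?thesis using that by (simp add: ssum[unfolded scale_simps(2)] sum_negf co_root scale_simps)
    qed
    show "\<eta> h \<star> \<eta> h' = 0" if "h \<in> carrier R" "h' \<in> carrier R" for h h'
      unfolding \<eta>_def sc_mult_sum_left sc_mult_sum_right
      by (intro sum.neutral ballI) (simp add: sc_mult_linear HE(4) scale_simps)
  qed
  show "\<exists>\<phi>. lie_iso (contragredient n par R) M \<phi> \<and> (\<forall>m<n. \<phi> (contragredient_e n par R m) = bv (es ! m))"
    by (rule contragredient_model.contragredient_iso[OF model])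
  show "contragredient_e n par R m \<in> carrier (contragredient n par R)" if "m < n" for m
    by (rule contragredient_model.contragredient_e_carrier[OF model that])
  show "lie_superalgebra (contragredient n par R)"
    by (rule contragredient_model.contragredient_lie[OF model])
qed

theorem table_lie:
  assumes ss: "sc_super I p c" and jac: "jac_g T idx od es" "jac_g T idx od fs" and mem: "mem_all (es @ fs @ map fst st) idx"
    "mem_all idx (es @ fs @ map fst st)" and ne: "es \<noteq> []" and gen: "gen_check T od (es @ fs) (es @ fs) st"
    and cube: "cube_check T (filter od idx)"
  shows "lie_superalgebra M" and "\<And>i. i \<in> I \<Longrightarrow> bv i \<in> gspan I p c (set (es @ fs))"
proof -
  have ef: "set (es @ fs) \<subseteq> I" "set es \<subseteq> I" "set fs \<subseteq> I" using mem(1) by (auto simp: mem_all_iff)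
  obtain g0 where g0: "g0 \<in> set (es @ fs)" using ne by (cases es) auto
  show span: "bv i \<in> gspan I p c (set (es @ fs))" if "i \<in> I" for i
    by (rule gen_checkD[OF sc_super.mult_part[OF ss] ef(1) g0 gen])
      (use mem that in \<open>auto simp: mem_all_iff intro: gspan_gen\<close>)
  show "lie_superalgebra M"
  proof (rule sc_super.lie_superalgebra_from_generators[OF ss _ span])
    show "sc_super.good I p c (p g) (bv g)" if "g \<in> set (es @ fs)" for g
    proof (rule sc_super.good_unit[OF ss])
      show "g \<in> I" using that ef by auto
      show "bv g \<star> (bv i \<star> bv j) = (bv g \<star> bv i) \<star> bv j + ssgn (p g) (p i) (bv i \<star> (bv g \<star> bv j))" if "i \<in> I" "j \<in> I" for i j
        using jac_gD[OF jac(1) _ ef(2) that] jac_gD[OF jac(2) _ ef(3) that] \<open>g \<in> set (es @ fs)\<close> by auto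
    qed
    show "bv i \<star> (bv i \<star> bv i) = 0" if "i \<in> I" "p i = 1" for i
      using cube_checkD[OF cube, of i] that by (auto simp: bpar_def split: if_splits)
  qed
qed

end

lemma closed_checkD: "closed_check T idx \<Longrightarrow> i \<in> set idx \<Longrightarrow> j \<in> set idx \<Longrightarrow> x \<in> set (ent (trow T i) j) \<Longrightarrow> fst x \<in> set idx"
  unfolding closed_check_def by (drule (2) check_tabD) (auto simp: list_all_iff is_mem_iff)

section \<open>The semisimplification of \<open>f4\<close>\<close>

lemma upto_num_nth: "m < n \<Longrightarrow> upto_num n k ! m = num_of_nat (nat_of_num k + m)"
proof (induction n arbitrary: k m)
  case (Suc n)
  show ?case
  proof (cases m)
    case 0
    then show ?thesis by (simp add: nat_of_num_inverse)
  next
    case (Suc m')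
    then show ?thesis using Suc.IH[of m' "Num.inc k"] Suc.prems by (simp add: nat_of_num_inc)
  qed
qed simp

lemma length_upto_num: "length (upto_num n k) = n"
  by (induction n arbitrary: k) auto

lemma f4_length: "length f4_idx = 52" by (simp add: f4_idx_def length_upto_num)

lemma f4_distinct: "distinct f4_idx"
  unfolding distinct_conv_nth f4_length
proof (intro allI impI)
  fix i j :: nat assume ij: "i < 52" "j < 52" "i \<noteq> j"
  have "nat_of_num (f4_idx ! m) = Suc m" if "m < 52" for m
    using num_of_nat_inverse[of "Suc m"] upto_num_nth[OF that, of num.One]
    by (simp add: f4_idx_def del: num_of_nat.simps)
  then show "f4_idx ! i \<noteq> f4_idx ! j" using ij by (metis Suc_inject)
qed

lemma g16_idx_nth: "i < 35 \<Longrightarrow> g16_idx ! i = f4_idx ! i"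
  by (simp add: g16_idx_def f4_idx_def upto_num_nth)

lemma g16_length: "length g16_idx = 35" by (simp add: g16_idx_def length_upto_num)

text \<open>The action of e_4 on positions, which count from 0 and thus hold the basis vector with
  number one higher. The tops at 21 to 34 move 14 places to their bottoms, and 49, 50, 51 is the
  block of size 3.\<close>

definition next_pos :: "nat \<Rightarrow> nat option" where
  "next_pos m = (if 21 \<le> m \<and> m < 35 then Some (m + 14) else if m = 49 \<or> m = 50 then Some (Suc m) else None)"

lemma f4_next: "list_all (\<lambda>m. ent (trow f4_T (num_of 52)) (f4_idx ! m) =
    (case next_pos m of None \<Rightarrow> [] | Some l \<Rightarrow> [(f4_idx ! l, 1)])) [0..<52]"
  by code_simp
lemma f4_odd: "list_all (\<lambda>m. is_odd (f4_idx ! m) = (\<not> m < 21)) [0..<35]" by code_simp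
lemma g16_bound: "list_all (\<lambda>k. k < num_of 36) g16_idx" by code_simp
text \<open>Vector 12 is h_3 - h_4 and vector 51 is h_4, so h_3 is their sum.\<close>

lemma f4_coroots: "map (\<lambda>i. ent (trow f4_T (f4_e ! i)) (f4_f ! i)) [0..<4] =
    [[(num_of 10, 1)], [(num_of 11, 1)], [(num_of 12, 1), (num_of 51, 1)], [(num_of 51, 1)]]" by code_simp
text \<open>The odd bracket of e_3 and f_3 is -2 times vector 12, which is h_3 - h_4 itself in
  characteristic 3.\<close>

lemma g16_coroots: "map (\<lambda>i. ent (trow g16_T (g16_e ! i)) (g16_f ! i)) [0..<3] =
    [[(num_of 10, 1)], [(num_of 11, 1)], [(num_of 12, -1), (num_of 12, -1)]]" by code_simp
lemma f4_mem52: "is_mem (num_of 52) f4_idx" by code_simp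
lemma f4_e4: "f4_e ! 3 = num_of 52" by code_simp
lemma g16_sub: "mem_all g16_idx f4_idx" by code_simp

lemma n_tab_ent: "i \<in> set is \<Longrightarrow> j \<in> set js \<Longrightarrow>
    ent (trow (n_tab T R js is) i) j = n_ent R (trow T i) (rows T (ent R i)) i j"
proof -
  have row: "j \<in> set js \<Longrightarrow> ent (n_row R Ri rs i js) j = n_ent R Ri rs i j" for Ri rs i j js
    by (induction js) (auto simp: ent_def look_ins)
  show "i \<in> set is \<Longrightarrow> j \<in> set js \<Longrightarrow> ?thesis"
    by (induction "is") (auto simp: trow_def look_ins row[unfolded ent_def] ent_def)
qed

lemma lvec_proj: "lvec (proj b l) k = (if is_odd k = b \<and> k < num_of 36 then lvec l k else 0)"
  by (induction l) (auto simp: fun_ops scale_def basis_vec_def)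

lemma bij_jordan_indices:
  "bij_betw (\<lambda>(i, k). if i < 35 then i + 14 * k else 49 + k) (jordan_indices 21 14 1) {..<52}" (is "bij_betw ?f ?J _")
  unfolding bij_betw_def
proof
  show "inj_on ?f ?J"
    \<comment> \<open>The inverse reads positions below 35 as tops, those from 35 to 48 as bottoms
      of blocks of size 2, and the last three as the block of size 3.\<close>
    by (rule inj_on_inverseI[of _ "\<lambda>m. if m < 35 then (m, 0) else if m < 49 then (m - 14, 1) else (35, m - 49)"])
      (auto simp: jordan_indices_def block_size_def less_2_cases_iff split: if_splits, presburger)
  show "?f ` ?J = {..<52}"
  proof
    show "?f ` ?J \<subseteq> {..<52}" by (auto simp: jordan_indices_def block_size_def split: if_splits)
    show "{..<52} \<subseteq> ?f ` ?J"
    proof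
      fix m :: nat assume m: "m \<in> {..<52}"
      let ?p = "if m < 35 then (m, 0) else if m < 49 then (m - 14, 1) else (35, m - 49)"
      have "?p \<in> ?J" "?f ?p = m" using m by (auto simp: jordan_indices_def block_size_def)
      then show "m \<in> ?f ` ?J" using imageI[of ?p ?J ?f] by (simp only:)
    qed
  qed
qed

text \<open>Forgets the realization and retains only an isomorphism with the table and the element
  that corresponds to basis vector 52.\<close>

locale f4_model = char3 K for K :: "'k::field itself" +
  fixes L :: "('k, 'v) superalgebra" and e \<phi>
  assumes lie: "lie_superalgebra L" and iso: "lie_iso L (sc_algebra (set f4_idx) (bpar all_even) (tc f4_T)) \<phi>"
    and e: "e \<in> carrier L" "\<phi> e = basis_vec (num_of 52)"
begin

sublocale F: table K f4_T f4_idx all_even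
  by unfold_locales (rule closed_checkD[OF f4_closed])

sublocale L: bilinear_algebra L by (rule lie_superalgebra_bilinear[OF lie])

notation F.B (infixl "\<star>" 70)

lemma two: "(2::'k) \<noteq> 0" using unitb_nz[of 2] by (simp add: unitb_def)

definition u :: "nat \<Rightarrow> 'v" where "u m = inv_into (carrier L) \<phi> (F.bv (f4_idx ! m))"

abbreviation d :: "'v \<Rightarrow> 'v" where "d \<equiv> (\<lambda>x. e \<otimes>\<^bsub>L\<^esub> x)"

lemmas iso' = lie_isoD[OF iso, unfolded sc_simps]

lemma phi_inj: "\<lbrakk>\<phi> x = \<phi> y; x \<in> carrier L; y \<in> carrier L\<rbrakk> \<Longrightarrow> x = y"
  using iso'(3) by (auto simp: bij_betw_def inj_on_def)

lemma phi_zero: "\<phi> \<zero>\<^bsub>L\<^esub> = 0"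
  using iso'(6)[of "\<zero>\<^bsub>L\<^esub>" 0] by (simp add: L.zero_smult scale_simps)

lemma phi_uminus: "x \<in> carrier L \<Longrightarrow> \<phi> (\<ominus>\<^bsub>L\<^esub> x) = - \<phi> x"
  by (simp add: L.neg_smult iso' scale_minus_one)

lemma phi_out: "x \<in> carrier L \<Longrightarrow> k \<notin> F.I \<Longrightarrow> \<phi> x k = 0"
  using iso'(4) by auto

lemma phi_lin: "L.lin_fun (\<lambda>v. \<phi> v k)"
  by (auto simp: L.lin_fun_def iso' fun_ops scale_def)

lemma idx_bij: "bij_betw ((!) f4_idx) {..<52} F.I"
  using bij_betw_nth[OF f4_distinct, of "{..<52}" F.I] by (simp add: f4_length)

lemma idx_obtain: assumes "i \<in> F.I" obtains m where "m < 52" "i = f4_idx ! m"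
proof -
  have "i \<in> (!) f4_idx ` {..<52}" using idx_bij assms by (simp add: bij_betw_def)
  then show thesis using that by blast
qed

lemma idx_mem: "m < 52 \<Longrightarrow> f4_idx ! m \<in> F.I" by (simp add: f4_length)

lemma idx_eq: "m < 52 \<Longrightarrow> l < 52 \<Longrightarrow> f4_idx ! m = f4_idx ! l \<longleftrightarrow> m = l"
  using f4_distinct by (simp add: nth_eq_iff_index_eq f4_length)

lemma u: assumes "m < 52" shows "u m \<in> carrier L" "\<phi> (u m) = F.bv (f4_idx ! m)"
proof -
  have "F.bv (f4_idx ! m) \<in> \<phi> ` carrier L"
    using iso'(3) idx_mem[OF assms] by (auto simp: bij_betw_def basis_vec_def)
  then show "u m \<in> carrier L" "\<phi> (u m) = F.bv (f4_idx ! m)"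
    by (simp_all add: u_def inv_into_into f_inv_into_f)
qed

lemma d_closed: "x \<in> carrier L \<Longrightarrow> d x \<in> carrier L" by (simp add: L.mult_closed e)

lemma phi_d: "x \<in> carrier L \<Longrightarrow> \<phi> (d x) = F.bv (num_of 52) \<star> \<phi> x"
  by (simp add: iso' e)

lemma mem52: "num_of 52 \<in> F.I" using f4_mem52 by (simp add: is_mem_iff)

lemma next_less: "next_pos m = Some l \<Longrightarrow> l < 52" by (auto simp: next_pos_def split: if_splits)

lemma e_bv: assumes "m < 52"
  shows "F.bv (num_of 52) \<star> F.bv (f4_idx ! m) = (case next_pos m of None \<Rightarrow> 0 | Some l \<Rightarrow> F.bv (f4_idx ! l))"
proof -
  have "ent (trow f4_T (num_of 52)) (f4_idx ! m) = (case next_pos m of None \<Rightarrow> [] | Some l \<Rightarrow> [(f4_idx ! l, 1)])"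
    using f4_next assms by (simp add: list_all_iff)
  then show ?thesis
    unfolding F.mult_bv[OF mem52 idx_mem[OF assms]] by (auto simp: scale_simps split: option.splits)
qed

lemma d_u: assumes "m < 52" shows "d (u m) = (case next_pos m of None \<Rightarrow> \<zero>\<^bsub>L\<^esub> | Some l \<Rightarrow> u l)"
  using u[OF assms] e_bv[OF assms]
  by (intro phi_inj) (auto simp: phi_d phi_zero d_closed u next_less split: option.splits)

text \<open>It suffices to treat basis vectors, which are moved along \<open>next_pos\<close>; no
  chain there admits three moves.\<close>

lemma d_cube: assumes x: "x \<in> carrier L" shows "d (d (d x)) = \<zero>\<^bsub>L\<^esub>"
proof (rule phi_inj)
  let ?D = "\<lambda>v. F.bv (num_of 52) \<star> v"
  have "?D (?D (?D (F.bv i))) = 0" if "i \<in> F.I" for i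
  proof -
    obtain m where m: "m < 52" "i = f4_idx ! m" by (rule idx_obtain[OF \<open>i \<in> F.I\<close>])
    show ?thesis unfolding m(2) e_bv[OF m(1)]
      by (auto simp: next_pos_def e_bv sc_mult_linear split: option.splits if_splits)
  qed
  then have "?D (?D (?D (\<Sum>i\<in>F.I. scale (\<phi> x i) (F.bv i)))) = 0"
    unfolding sc_mult_sum_right by (simp add: sc_mult_linear scale_simps)
  moreover have "\<phi> x = (\<Sum>i\<in>F.I. scale (\<phi> x i) (F.bv i))" by (rule sum_units) (auto simp: phi_out x)
  ultimately have "?D (?D (?D (\<phi> x))) = 0" by simp
  then show "\<phi> (d (d (d x))) = \<phi> \<zero>\<^bsub>L\<^esub>" by (simp add: phi_d d_closed x phi_zero)
qed (simp_all add: d_closed x)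

abbreviation "pos \<equiv> (\<lambda>(i, k). if i < 35 then i + 14 * k else 49 + k)"
abbreviation "J \<equiv> jordan_indices 21 14 1"
definition x :: "nat \<Rightarrow> 'v" where "x i = u (pos (i, 0))"

lemma jordan_vector: assumes "(i, k) \<in> J" shows "jordan_vector d x (i, k) = u (pos (i, k))"
proof -
  have i: "i < 36" "k < block_size 21 14 i" using assms by (auto simp: jordan_indices_def)
  have "(d ^^ k) (x i) = u (pos (i, k))" if "k < block_size 21 14 i" for k
    using that
  proof (induction k)
    case (Suc k)
    have "pos (i, k) < 52" using Suc.prems i(1) by (auto simp: block_size_def split: if_splits)
    note step = d_u[OF this]
    have "next_pos (pos (i, k)) = Some (pos (i, Suc k))"
      using Suc.prems i(1) by (auto simp: block_size_def next_pos_def split: if_splits)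
    with step show ?case using Suc by simp
  qed (simp add: x_def)
  then show ?thesis using i by (simp add: jordan_vector_def)
qed

lemma pos_less: "ik \<in> J \<Longrightarrow> pos ik < 52"
  using bij_jordan_indices by (auto simp: bij_betw_def)

text \<open>The functionals that read off table coordinates are dual to the Jordan vectors and
  separate points, so \<open>dual_family\<close> applies and identifies them with the basis
  coefficients.\<close>

lemma jordan_basis:
  "inj_on (jordan_vector d x) J" "L.basis (jordan_vector d x ` J)" "L.fin_dim"
  "\<And>v ik. \<lbrakk>v \<in> carrier L; ik \<in> J\<rbrakk> \<Longrightarrow> basis_coeff L (jordan_vector d x ` J) v (jordan_vector d x ik) = \<phi> v (f4_idx ! pos ik)"
proof -
  have jv: "jordan_vector d x ik = u (pos ik)" if "ik \<in> J" for ik using jordan_vector that by (cases ik) simp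
  have fin: "finite J" by (auto simp: jordan_indices_def)
  note r = L.dual_family[of J "jordan_vector d x" "\<lambda>ik v. \<phi> v (f4_idx ! pos ik)", OF fin]
  have c1: "jordan_vector d x ik \<in> carrier L" if "ik \<in> J" for ik using jv[OF that] u pos_less[OF that] by simp
  have c2: "\<phi> (jordan_vector d x jl) (f4_idx ! pos ik) = (if ik = jl then 1 else 0)" if "ik \<in> J" "jl \<in> J" for ik jl
  proof -
    have "pos ik = pos jl \<longleftrightarrow> ik = jl"
      using bij_jordan_indices that unfolding bij_betw_def by (meson inj_on_eq_iff)
    then show ?thesis
      unfolding jv[OF that(2)] u(2)[OF pos_less[OF that(2)]] basis_vec_def
      using idx_eq[OF pos_less[OF that(1)] pos_less[OF that(2)]] by simp
  qed
  have c3: "v = \<zero>\<^bsub>L\<^esub>" if v: "v \<in> carrier L" and z: "\<forall>ik\<in>J. \<phi> v (f4_idx ! pos ik) = 0" for v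
  proof (rule phi_inj)
    show "\<phi> v = \<phi> \<zero>\<^bsub>L\<^esub>" unfolding phi_zero
    proof
      fix k
      show "\<phi> v k = 0 k"
      proof (cases "k \<in> F.I")
        case True
        then obtain m where "m < 52" "k = f4_idx ! m" using idx_obtain by blast
        then obtain ik where "ik \<in> J" "k = f4_idx ! pos ik"
          using bij_jordan_indices unfolding bij_betw_def by (metis (no_types, lifting) imageE lessThan_iff)
        then show ?thesis using z by (simp add: fun_ops)
      qed (simp add: phi_out v fun_ops)
    qed
  qed (simp_all add: v)
  show "inj_on (jordan_vector d x) J" "L.basis (jordan_vector d x ` J)" "L.fin_dim"
    by (rule r(1) r(2) r(4), rule c1, assumption, rule phi_lin, rule c2, assumption, assumption, rule c3, assumption, assumption)+
  show "basis_coeff L (jordan_vector d x ` J) v (jordan_vector d x ik) = \<phi> v (f4_idx ! pos ik)"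
    if "v \<in> carrier L" "ik \<in> J" for v ik
    by (rule r(3)[OF c1 phi_lin c2 c3 that])
qed

lemma jordan: "jordan_decomposition L d 21 14 1 x"
  unfolding jordan_decomposition_def
proof (intro conjI allI impI jordan_basis)
  fix i :: nat assume i: "i < 21 + 14 + 1"
  have "block_size 21 14 i \<noteq> 0" by (simp add: block_size_def)
  then obtain k where k: "block_size 21 14 i = Suc k" by (metis not0_implies_Suc)
  then have ik: "(i, k) \<in> J" using i by (auto simp: jordan_indices_def)
  have "next_pos (pos (i, k)) = None" using i k by (auto simp: next_pos_def block_size_def split: if_splits)
  then have "d (u (pos (i, k))) = \<zero>\<^bsub>L\<^esub>" using d_u[OF pos_less[OF ik]] by simp
  then show "(d ^^ block_size 21 14 i) (x i) = \<zero>\<^bsub>L\<^esub>"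
    unfolding k using jordan_vector[OF ik] by (simp add: jordan_vector_def)
qed

lemma odd_part: "part L 1 = {\<zero>\<^bsub>L\<^esub>}"
proof -
  interpret Ls: lie_superalgebra L by (rule lie)
  have sub: "part L 1 \<subseteq> carrier L" "\<zero>\<^bsub>L\<^esub> \<in> part L 1"
    using Ls.part_subspace[of 1] by (auto simp: VectorSpace.subspace_def submodule_def)
  have "\<phi> y = 0" if "y \<in> part L 1" for y
  proof -
    have "\<phi> y \<in> {v. \<forall>i. v i \<noteq> 0 \<longrightarrow> i \<in> F.I \<and> F.p i = 1}" using iso'(8)[of 1] that by blast
    then show ?thesis by (auto simp: bpar_def all_even_def fun_eq_iff fun_ops)
  qed
  then have "y = \<zero>\<^bsub>L\<^esub>" if "y \<in> part L 1" for y
    using phi_inj[of y "\<zero>\<^bsub>L\<^esub>"] that sub by (auto simp: phi_zero)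
  then show ?thesis using sub by blast
qed

lemma rep_alpha3: "rep_alpha3_lie_algebra L d"
  by (rule rep_alpha3_ad[OF lie odd_part jordan_basis(3) e(1) d_cube])

sublocale alpha3_lie_algebra L d by unfold_locales (rule rep_alpha3, rule two)

abbreviation "N \<equiv> sc_algebra (set g16_idx) (bpar is_odd) (tc g16_T) :: ('k, num \<Rightarrow> 'k) superalgebra"
abbreviation "\<sigma> \<equiv> \<lambda>k. inv_into (carrier L) \<phi> (F.bv k)"

lemma g16_in: "k \<in> set g16_idx \<Longrightarrow> k \<in> F.I" using g16_sub by (auto simp: mem_all_iff)

lemma sigma: assumes "k \<in> F.I" shows "\<sigma> k \<in> carrier L" "\<phi> (\<sigma> k) = F.bv k"
proof -
  obtain m where "m < 52" "k = f4_idx ! m" using idx_obtain[OF assms] by blast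
  then show "\<sigma> k \<in> carrier L" "\<phi> (\<sigma> k) = F.bv k" using u[of m] by (simp_all add: u_def)
qed

text \<open>The Jordan frame of the adapted basis, renamed from block numbers to table
  indices.\<close>

lemma g16_frame: "frame (set g16_idx) (bpar is_odd) \<sigma> (\<lambda>k v. \<phi> v k)"
proof (rule frame_reindex[OF jordan_frame[OF jordan]])
  have "distinct g16_idx"
    using f4_distinct by (simp add: distinct_conv_nth g16_length f4_length g16_idx_nth)
  from bij_betw_nth[OF this, of "{..<35}" "set g16_idx"]
  show "bij_betw ((!) g16_idx) {..<21 + 14} (set g16_idx)" by (simp add: g16_length)
next
  fix j :: nat assume j: "j \<in> {..<21 + 14}"
  then have "is_odd (f4_idx ! j) = (\<not> j < 21)" using f4_odd by (simp add: list_all_iff)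
  then show "bpar is_odd (g16_idx ! j) = block_parity 21 j \<and> \<sigma> (g16_idx ! j) = x j"
    using j by (simp add: bpar_def block_parity_def g16_idx_nth x_def u_def)
  fix v assume v: "v \<in> carrier L"
  have "(j, 0) \<in> J" using j by (auto simp: jordan_indices_def block_size_def)
  from jordan_basis(4)[OF v this]
  show "\<phi> v (g16_idx ! j) = basis_coeff L (jordan_vector d x ` J) v (jordan_vector d x (j, 0))"
    using j by (simp add: g16_idx_nth)
qed

lemma g16_coeff:
  assumes i: "i \<in> set g16_idx" and j: "j \<in> set g16_idx" and k: "k \<in> set g16_idx"
  shows "frame_coeff (bpar is_odd) \<sigma> (\<lambda>k v. \<phi> v k) i j k = tc g16_T i j k"
proof -
  note I = i[THEN g16_in] j[THEN g16_in]
  note s = sigma[OF I(1)] sigma[OF I(2)]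
  let ?R = "trow f4_T (num_of 52)"
  \<comment> \<open>\<open>k\<close> is the index of a top, so the projection in the computed table
    keeps its coordinate whenever the parities match.\<close>
  have k36: "k < num_of 36" using g16_bound k by (simp add: list_all_iff)
  have tc: "tc g16_T i j k = lvec (n_ent ?R (trow f4_T i) (rows f4_T (ent ?R i)) i j) k"
    unfolding tc_def g16_T_def using n_tab_ent[OF i j, of f4_T ?R] by simp
  have cl: "fst ` set (ent ?R i) \<subseteq> F.I" "fst ` set (ent ?R j) \<subseteq> F.I" using F.closed' mem52 I by auto
  show ?thesis
  proof (cases "is_odd i \<and> is_odd j")
    case True
    have "lvec (app (trow f4_T i) (- 1) (ent ?R j) (lapp (rows f4_T (ent ?R i)) 1 j [])) =
        - (F.bv i \<star> (F.bv (num_of 52) \<star> F.bv j)) + (F.bv (num_of 52) \<star> F.bv i) \<star> F.bv j"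
      using I cl mem52 by (simp add: F.vec_app F.vec_lapp F.mult_bv scale_minus_one scale_simps)
    then show ?thesis
      unfolding tc frame_coeff_def n_ent_def brk_def using True s k36 e
      by (simp add: bpar_def lvec_proj iso' phi_uminus L.mult_closed)
  next
    case False
    then show ?thesis
      unfolding tc frame_coeff_def n_ent_def brk_def using s k36 I
      by (auto simp: bpar_def lvec_proj iso' F.mult_bv)
  qed
qed

lemma frame_algebra:
  "sc_algebra (set g16_idx) (bpar is_odd) (frame_coeff (bpar is_odd) \<sigma> (\<lambda>k v. \<phi> v k)) = N"
  by (rule sc_algebra_cong) (rule g16_coeff)

theorem semisimplification_iso:
  assumes "jordan_decomposition L d n1 n2 n3 y"
  shows "\<exists>\<chi>. lie_iso (semisimplification L d n1 n2 n3 y) N \<chi>"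
  using frame_independence[OF jordan_frame[OF assms] g16_frame]
  unfolding frame_algebra semisimplification_frame[OF assms] .

text \<open>The computed table coincides with the coefficients of a frame and so inherits their
  parity rule and antisymmetry.\<close>

theorem g16_super: "sc_super (set g16_idx) (bpar is_odd) (tc g16_T :: num \<Rightarrow> num \<Rightarrow> num \<Rightarrow> 'k)"
  by (rule sc_super_cong[OF g16_coeff frame_sc_super[OF g16_frame]])

end

text \<open>The integer matrix \<open>B\<close> certifies that the determinant of \<open>A\<close>
  divides a power of \<open>a\<close>, hence does not vanish in a field where \<open>a\<close> does
  not.\<close>

lemma rank_of_int_mat:
  fixes A B :: "int mat"
  assumes A: "A \<in> carrier_mat n n" and B: "B \<in> carrier_mat n n" and AB: "A * B = a \<cdot>\<^sub>m 1\<^sub>m n" and a: "of_int a \<noteq> (0::'k::field)"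
  shows "vec_space.rank n (map_mat of_int A :: 'k mat) = n"
proof -
  have "det A * det B = a ^ n" using det_mult[OF A B] by (simp add: AB det_smult)
  then have "of_int (det A) * of_int (det B) = (of_int a :: 'k) ^ n" by (metis of_int_mult of_int_power)
  then have "det (map_mat of_int A :: 'k mat) \<noteq> 0" using a by (auto simp: of_int_hom.hom_det)
  then show ?thesis using vec_space.det_rank_iff[of "map_mat of_int A :: 'k mat" n] A by simp
qed

lemma num_of_numeral: "num_of (numeral k) = k"
  using num_of_code(1)[of k] by simp

lemma mat_of_rows_list_carrier: "length rs = m \<Longrightarrow> mat_of_rows_list n rs \<in> carrier_mat m n"
  by (auto simp: mat_of_rows_list_def)

lemma f4_matrix_carrier: "f4_matrix \<in> carrier_mat 4 4" and g16_matrix_carrier: "g16_matrix \<in> carrier_mat 3 3"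
  unfolding f4_matrix_def g16_matrix_def by (rule mat_of_rows_list_carrier, simp)+

lemma f4_matrix_entry: "i < 4 \<Longrightarrow> j < 4 \<Longrightarrow>
    f4_matrix $$ (i, j) = [[2, -1, 0, 0], [-1, 2, -2, 0], [0, -1, 2, -1], [0, 0, -1, 2]] ! i ! j"
  by (simp add: f4_matrix_def mat_of_rows_list_def)

lemma g16_matrix_entry: "i < 3 \<Longrightarrow> j < 3 \<Longrightarrow> g16_matrix $$ (i, j) = [[2, -1, 0], [-1, 2, -2], [0, -1, 0]] ! i ! j"
  by (simp add: g16_matrix_def mat_of_rows_list_def)

lemma rank_f4: "vec_space.rank 4 (map_mat of_int f4_matrix :: 'k::field mat) = 4"
proof (rule rank_of_int_mat[OF f4_matrix_carrier])
  \<comment> \<open>The inverse over the integers, as the matrix of f4 has determinant 1.\<close>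
  let ?B = "mat_of_rows_list 4 [[2, 3, 4, 2], [3, 6, 8, 4], [2, 4, 6, 3], [1, 2, 3, 2]] :: int mat"
  show "?B \<in> carrier_mat 4 4" by (rule mat_of_rows_list_carrier) simp
  show "f4_matrix * ?B = 1 \<cdot>\<^sub>m 1\<^sub>m 4"
    by (rule eq_matI)
      (auto simp: f4_matrix_def mat_of_rows_list_def scalar_prod_def numeral_eq_Suc less_Suc_eq)
qed simp

lemma (in char3) rank_g16: "vec_space.rank 3 (map_mat of_int g16_matrix :: 'k mat) = 3"
proof (rule rank_of_int_mat[OF g16_matrix_carrier])
  \<comment> \<open>The adjugate; the determinant is -4, which is nonzero modulo 3.\<close>
  let ?B = "mat_of_rows_list 3 [[-2, 0, 2], [0, 0, 4], [1, 2, 3]] :: int mat"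
  show "?B \<in> carrier_mat 3 3" by (rule mat_of_rows_list_carrier) simp
  show "g16_matrix * ?B = (- 4) \<cdot>\<^sub>m 1\<^sub>m 3"
    by (rule eq_matI)
      (auto simp: g16_matrix_def mat_of_rows_list_def scalar_prod_def numeral_3_eq_3 less_Suc_eq)
  show "of_int (- 4) \<noteq> (0::'k)" by (rule unitb_nz) (simp add: unitb_def)
qed

lemma f4_simple_degrees: "list_all (\<lambda>m. f4_deg (f4_e ! m) = (replicate 4 0)[m := 1] \<and>
    f4_deg (f4_f ! m) = (replicate 4 0)[m := -1]) [0..<4]" by code_simp
lemma g16_simple_degrees: "list_all (\<lambda>m. g16_deg (g16_e ! m) = (replicate 3 0)[m := 1] \<and>
    g16_deg (g16_f ! m) = (replicate 3 0)[m := -1]) [0..<3]" by code_simp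
lemma g16_simple_parity: "list_all (\<lambda>m. is_odd (g16_e ! m) = (m = 2) \<and> is_odd (g16_f ! m) = (m = 2)) [0..<3]" by code_simp

lemma f4_len: "length f4_e = 4" "length f4_f = 4" "f4_e \<noteq> []"
  and g16_len: "length g16_e = 3" "length g16_f = 3" "g16_e \<noteq> []"
  by (simp_all add: f4_e_def f4_f_def g16_e_def g16_f_def nums_def)

context char3
begin

lemma f4_is_table: "table TYPE('k) f4_T f4_idx"
  by unfold_locales (rule closed_checkD[OF f4_closed])

lemma g16_is_table: "table TYPE('k) g16_T g16_idx"
  by unfold_locales (rule closed_checkD[OF g16_closed])

lemma f4_super: "sc_super (set f4_idx) (bpar all_even) (tc f4_T :: num \<Rightarrow> num \<Rightarrow> num \<Rightarrow> 'k)"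
proof
  show "bpar all_even k = bpar all_even i + bpar all_even j" for i j k by (simp add: bpar_def all_even_def)
  show "(tc f4_T i j k :: 'k) = - ssgn (bpar all_even i) (bpar all_even j) (tc f4_T j i k)" for i j k
  proof -
    have "ent (trow f4_T j) i = neg (ent (trow f4_T i) j)"
      unfolding f4_T_def by (rule mk_antisym[OF f4_off]) (simp add: ent_def trow_def)
    then show ?thesis by (simp add: tc_def vec_neg fun_ops bpar_def all_even_def ssgn_def)
  qed
qed simp

lemma f4_lie: "lie_superalgebra (sc_algebra (set f4_idx) (bpar all_even) (tc f4_T) :: ('k, num \<Rightarrow> 'k) superalgebra)"
  and f4_generated: "i \<in> set f4_idx \<Longrightarrow>
    basis_vec i \<in> gspan (set f4_idx) (bpar all_even) (tc f4_T :: num \<Rightarrow> num \<Rightarrow> num \<Rightarrow> 'k) (set (f4_e @ f4_f))"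
proof -
  have cube: "cube_check f4_T (filter all_even f4_idx)" by (simp add: cube_check_def all_even_def)
  note t = table.table_lie[OF f4_is_table f4_super f4_jac1 f4_jac2 f4_mem(1,2) f4_len(3) f4_gen cube]
  show "lie_superalgebra (sc_algebra (set f4_idx) (bpar all_even) (tc f4_T) :: ('k, num \<Rightarrow> 'k) superalgebra)" by (rule t)
  show "i \<in> set f4_idx \<Longrightarrow>
    basis_vec i \<in> gspan (set f4_idx) (bpar all_even) (tc f4_T :: num \<Rightarrow> num \<Rightarrow> num \<Rightarrow> 'k) (set (f4_e @ f4_f))" by (rule t)
qed

theorem f4_iso:
  fixes R :: "('k, 'h) realization"
  assumes real: "realization_of f4_matrix R"
  shows "\<exists>\<phi>. lie_iso (f4 R) (sc_algebra (set f4_idx) (bpar all_even) (tc f4_T)) \<phi> \<and>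
      \<phi> (contragredient_e 4 (\<lambda>_. 0) R 3) = basis_vec (num_of 52)"
    and "contragredient_e 4 (\<lambda>_. 0) R 3 \<in> carrier (f4 R)" and "lie_superalgebra (f4 R)"
proof -
  interpret F: table K f4_T f4_idx all_even by (rule f4_is_table)
  let ?ds = "map fst (pairs f4_base) @ map fst (pairs f4_steps)"
  have z: "replicate 4 0 = [0, 0, 0, 0::int]" by (simp add: numeral_eq_Suc)
  have indep: "a i = 0" if s: "(\<Sum>i<4. scale (a i) (sc_mult F.I F.c (F.bv (f4_e ! i)) (F.bv (f4_f ! i)))) = 0" and i: "i < 4" for a :: "nat \<Rightarrow> 'k" and i
  proof -
    let ?L = "[[(num_of 10, 1)], [(num_of 11, 1)], [(num_of 12, 1), (num_of 51, 1)], [(num_of 51, 1)]] :: lin list"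
    have "sc_mult F.I F.c (F.bv (f4_e ! i)) (F.bv (f4_f ! i)) = lvec (?L ! i)" if "i < 4" for i
    proof -
      have "f4_e ! i \<in> F.I" "f4_f ! i \<in> F.I" using f4_mem(1) f4_len that by (auto simp: mem_all_iff nth_mem subset_iff)
      then show ?thesis using arg_cong[OF f4_coroots, of "\<lambda>l. l ! i"] that by (simp add: F.mult_bv)
    qed
    then have "(\<Sum>i<4. scale (a i) (lvec (?L ! i))) = (\<Sum>i<4. scale (a i) (sc_mult F.I F.c (F.bv (f4_e ! i)) (F.bv (f4_f ! i))))"
      by (intro sum.cong) auto
    then have eq: "(\<Sum>i<4. scale (a i) (lvec (?L ! i))) k = 0" for k using s by (simp add: fun_ops)
    \<comment> \<open>The coordinates at 10, 11 and 12 isolate the first three coefficients; the one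
      at 51 then determines the last.\<close>
    have "a 0 = 0" "a 1 = 0" "a 2 = 0" "a 2 + a 3 = 0"
      using eq[of "num_of 10"] eq[of "num_of 11"] eq[of "num_of 12"] eq[of "num_of 51"]
      by (simp_all add: num_of_numeral numeral_eq_Suc lessThan_Suc fun_ops scale_def basis_vec_def add.commute)
    moreover have "i = 0 \<or> i = 1 \<or> i = 2 \<or> i = 3" using i by auto
    ultimately show ?thesis by auto
  qed
  have *: "set (f4_e @ f4_f) \<subseteq> F.I" "set ?ds \<subseteq> F.I" using f4_mem by (auto simp: mem_all_iff)
  have deg: "f4_deg (f4_e ! m) = (replicate 4 0)[m := 1] \<and> f4_deg (f4_f ! m) = (replicate 4 0)[m := -1]" if "m < 4" for m
    using f4_simple_degrees that by (simp add: list_all_iff)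
  have even: "F.p i = 0" for i by (simp add: bpar_def all_even_def)
  have ds: "set ?ds = set (map fst (pairs f4_base)) \<union> set (map fst (pairs f4_steps))" by simp
  have ev: "F.p (f4_e ! m) = 0 \<and> F.p (f4_f ! m) = 0" for m by (simp add: even)
  note C' = F.contragredient_table[where n = 4 and es = f4_e and fs = f4_f and par = "\<lambda>_. 0" and dl = f4_deg
      and zs = f4_cartan and ds = ?ds and bs = "pairs f4_base" and ss = "pairs f4_steps" and A = f4_matrix
      and Al = "[[2, -1, 0, 0], [-1, 2, -2, 0], [0, -1, 2, -1], [0, 0, -1, 2]]" and R = R]
  note C = C'[OF f4_lie f4_len(1,2) *(1) ev deg f4_degc[folded z] f4_graded f4_generated f4_basec[folded z] f4_stepc
      ds *(2) f4_rel f4_matrix_carrier f4_matrix_entry _ rank_f4 real]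
  have "\<exists>\<phi>. lie_iso (f4 R) (sc_algebra (set f4_idx) (bpar all_even) (tc f4_T)) \<phi> \<and>
      (\<forall>m<4. \<phi> (contragredient_e 4 (\<lambda>_. 0) R m) = basis_vec (f4_e ! m))"
    unfolding f4_def by (rule C(1)) (assumption | rule indep, assumption, assumption)+
  then show "\<exists>\<phi>. lie_iso (f4 R) (sc_algebra (set f4_idx) (bpar all_even) (tc f4_T)) \<phi> \<and>
      \<phi> (contragredient_e 4 (\<lambda>_. 0) R 3) = basis_vec (num_of 52)"
    unfolding f4_e4[symmetric] by (metis numeral_less_iff semiring_norm(76) semiring_norm(81))
  show "contragredient_e 4 (\<lambda>_. 0) R 3 \<in> carrier (f4 R)" unfolding f4_def by (rule C(2)) (assumption | rule indep, assumption, assumption | simp)+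
  show "lie_superalgebra (f4 R)" unfolding f4_def by (rule C(3)) (assumption | rule indep, assumption, assumption)+
qed

theorem g16_iso:
  fixes S :: "('k, 'h) realization"
  assumes real: "realization_of g16_matrix S"
    and super: "sc_super (set g16_idx) (bpar is_odd) (tc g16_T :: num \<Rightarrow> num \<Rightarrow> num \<Rightarrow> 'k)"
  defines "N \<equiv> sc_algebra (set g16_idx) (bpar is_odd) (tc g16_T) :: ('k, num \<Rightarrow> 'k) superalgebra"
  shows "lie_superalgebra N" and "lie_superalgebra (g16 S)" and "\<exists>\<phi>. lie_iso (g16 S) N \<phi>"
proof -
  interpret G: table K g16_T g16_idx is_odd by (rule g16_is_table)
  let ?ds = "map fst (pairs g16_base) @ map fst (pairs g16_steps)"
  note t = table.table_lie[OF g16_is_table super g16_jac1 g16_jac2 g16_mem(1,2) g16_len(3) g16_gen g16_cube]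
  show "lie_superalgebra N" unfolding N_def by (rule t)
  have z: "replicate 3 0 = [0, 0, 0::int]" by (simp add: numeral_eq_Suc)
  have indep: "a i = 0" if s: "(\<Sum>i<3. scale (a i) (sc_mult G.I G.c (G.bv (g16_e ! i)) (G.bv (g16_f ! i)))) = 0" and i: "i < 3" for a :: "nat \<Rightarrow> 'k" and i
  proof -
    let ?L = "[[(num_of 10, 1)], [(num_of 11, 1)], [(num_of 12, -1), (num_of 12, -1)]] :: lin list"
    have "sc_mult G.I G.c (G.bv (g16_e ! i)) (G.bv (g16_f ! i)) = lvec (?L ! i)" if "i < 3" for i
    proof -
      have "g16_e ! i \<in> G.I" "g16_f ! i \<in> G.I" using g16_mem(1) g16_len that by (auto simp: mem_all_iff nth_mem subset_iff)
      then show ?thesis using arg_cong[OF g16_coroots, of "\<lambda>l. l ! i"] that by (simp add: G.mult_bv)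
    qed
    then have "(\<Sum>i<3. scale (a i) (lvec (?L ! i))) = (\<Sum>i<3. scale (a i) (sc_mult G.I G.c (G.bv (g16_e ! i)) (G.bv (g16_f ! i))))"
      by (intro sum.cong) auto
    then have eq: "(\<Sum>i<3. scale (a i) (lvec (?L ! i))) k = 0" for k using s by (simp add: fun_ops)
    \<comment> \<open>The third coroot is -2 times vector 12, so the last equation still has to be
      divided by 2.\<close>
    have a: "a 0 = 0" "a 1 = 0" "- a 2 - a 2 = 0"
      using eq[of "num_of 10"] eq[of "num_of 11"] eq[of "num_of 12"]
      by (simp_all add: num_of_numeral numeral_eq_Suc lessThan_Suc fun_ops scale_def basis_vec_def algebra_simps)
    have "2 * a 2 = - (- a 2 - a 2)" by simp
    then have "2 * a 2 = 0" using a(3) by simp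
    moreover have "(2::'k) \<noteq> 0" using unitb_nz[of 2] by (simp add: unitb_def)
    ultimately have "a 2 = 0" by simp
    moreover have "i = 0 \<or> i = 1 \<or> i = 2" using i by auto
    ultimately show ?thesis using a by auto
  qed
  have *: "set (g16_e @ g16_f) \<subseteq> G.I" "set ?ds \<subseteq> G.I" using g16_mem by (auto simp: mem_all_iff)
  have deg: "g16_deg (g16_e ! m) = (replicate 3 0)[m := 1] \<and> g16_deg (g16_f ! m) = (replicate 3 0)[m := -1]" if "m < 3" for m
    using g16_simple_degrees that by (simp add: list_all_iff)
  have ds: "set ?ds = set (map fst (pairs g16_base)) \<union> set (map fst (pairs g16_steps))" by simp
  have par: "G.p (g16_e ! m) = (if m = 2 then 1 else 0) \<and> G.p (g16_f ! m) = (if m = 2 then 1 else 0)" if "m < 3" for m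
    using g16_simple_parity that by (simp add: list_all_iff bpar_def)
  note C' = G.contragredient_table[where n = 3 and es = g16_e and fs = g16_f and par = "\<lambda>i. if i = 2 then 1 else 0" and dl = g16_deg
      and zs = g16_cartan and ds = ?ds and bs = "pairs g16_base" and ss = "pairs g16_steps" and A = g16_matrix
      and Al = "[[2, -1, 0], [-1, 2, -2], [0, -1, 0]]" and R = S]
  note C = C'[OF t(1) g16_len(1,2) *(1) par deg g16_degc[folded z] g16_graded t(2) g16_basec[folded z] g16_stepc
      ds *(2) g16_rel g16_matrix_carrier g16_matrix_entry _ rank_g16 real]
  show "lie_superalgebra (g16 S)" unfolding g16_def by (rule C(3)) (assumption | rule indep, assumption, assumption)+
  have "\<exists>\<phi>. lie_iso (g16 S) N \<phi> \<and> (\<forall>m<3. \<phi> (contragredient_e 3 (\<lambda>i. if i = 2 then 1 else 0) S m) = basis_vec (g16_e ! m))"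
    unfolding g16_def N_def by (rule C(1)) (assumption | rule indep, assumption, assumption)+
  then show "\<exists>\<phi>. lie_iso (g16 S) N \<phi>" by blast
qed

end

theorem corollary4p3p1:
  fixes R :: "('k::alg_closed_field, 'a) realization"
    and S :: "('k, 'b) realization"
  assumes "CHAR('k) = 3"
    and "realization_of f4_matrix R"
    and "realization_of g16_matrix S"
  shows "rep_alpha3_lie_algebra (f4 R) (f4_ad_e4 R)
    \<and> (\<exists>n1 n2 n3 x. jordan_decomposition (f4 R) (f4_ad_e4 R) n1 n2 n3 x)
    \<and> (\<forall>n1 n2 n3 x. jordan_decomposition (f4 R) (f4_ad_e4 R) n1 n2 n3 x \<longrightarrow>
         isomorphic_lie_superalgebras (semisimplification (f4 R) (f4_ad_e4 R) n1 n2 n3 x) (g16 S))"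
proof -
  have "(3::'k) = of_nat CHAR('k)" unfolding assms(1) by simp
  then have "(3::'k) = 0" unfolding of_nat_CHAR .
  then interpret char3 "TYPE('k)" by unfold_locales
  obtain \<phi> where phi: "lie_iso (f4 R) (sc_algebra (set f4_idx) (bpar all_even) (tc f4_T)) \<phi>"
    "\<phi> (contragredient_e 4 (\<lambda>_. 0) R 3) = basis_vec (num_of 52)"
    using f4_iso(1)[OF assms(2)] by blast
  have m: "f4_model (f4 R) (contragredient_e 4 (\<lambda>_. 0) R 3) \<phi>"
    by (rule f4_model.intro[OF char3_axioms f4_model_axioms.intro[OF f4_iso(3)[OF assms(2)] phi(1) f4_iso(2)[OF assms(2)] phi(2)]])
  have d: "f4_ad_e4 R = (\<lambda>x. contragredient_e 4 (\<lambda>_. 0) R 3 \<otimes>\<^bsub>f4 R\<^esub> x)" by (simp add: fun_eq_iff f4_ad_e4_def)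
  let ?N = "sc_algebra (set g16_idx) (bpar is_odd) (tc g16_T) :: ('k, num \<Rightarrow> 'k) superalgebra"
  let ?d = "\<lambda>x. contragredient_e 4 (\<lambda>_. 0) R 3 \<otimes>\<^bsub>f4 R\<^esub> x"
  interpret alpha3_lie_algebra "f4 R" ?d
    by (rule alpha3_lie_algebra.intro[OF f4_model.rep_alpha3[OF m] f4_model.two[OF m]])
  note g = g16_iso[OF assms(3) f4_model.g16_super[OF m]]
  obtain \<chi> where chi: "lie_iso (g16 S) ?N \<chi>" using g(3) by blast
  have part: "part L i \<subseteq> carrier L" if "lie_superalgebra L" for L :: "('k, 'v, 'm) superalgebra_scheme" and i
    using lie_superalgebra.part_subspace[OF that, of i] by (auto simp: VectorSpace.subspace_def submodule_def)
  note inv = lie_iso_inverse[OF chi lie_superalgebra_bilinear[OF g(2)] part[OF g(2)]]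
  show ?thesis
  proof (intro conjI allI impI)
    show "rep_alpha3_lie_algebra (f4 R) (f4_ad_e4 R)" unfolding d by (rule f4_model.rep_alpha3[OF m])
    show "\<exists>n1 n2 n3 x. jordan_decomposition (f4 R) (f4_ad_e4 R) n1 n2 n3 x" unfolding d using f4_model.jordan[OF m] by blast
    fix n1 n2 n3 x assume "jordan_decomposition (f4 R) (f4_ad_e4 R) n1 n2 n3 x"
    then have jd: "jordan_decomposition (f4 R) ?d n1 n2 n3 x" unfolding d .
    let ?S = "semisimplification (f4 R) ?d n1 n2 n3 x"
    obtain \<psi> where psi: "lie_iso ?S ?N \<psi>" using f4_model.semisimplification_iso[OF m jd] by blast
    \<comment> \<open>The axioms of the semisimplification, including the cube condition, are pulled
      back from the verified table.\<close>
    have "lie_superalgebra ?S"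
      by (rule lie_superalgebra_iso[OF g(1) _ psi])
        (auto simp: semisimplification_frame[OF jd] sc_bilinear_algebra sc_part_carrier)
    then show "isomorphic_lie_superalgebras (semisimplification (f4 R) (f4_ad_e4 R) n1 n2 n3 x) (g16 S)"
      unfolding d isomorphic_lie_superalgebras_def using g(2) lie_iso_compose[OF psi inv] unfolding lie_iso_def by blast
  qed
qed

end
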